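(* Let $\Phi:\mathcal{Y}^{(1)}\to\mathrm{Sym}$ be the unital algebra homomorphism uniquely determined by $\Phi(Y_n)=y_n$ for all $n\ge2$, where $$y_n=\sum_{\pi=\{A_1,\dots,A_q\}\in NC(n-1)}e_{|A_1|}\cdots e_{|A_q|}\in\mathrm{Sym}.$$ Then $\Phi$ is an isomorphism of graded Hopf algebras.
   Context: $NC(n)$ is the lattice of non-crossing partitions of $\{1,\dots,n\}$, with maximum $1_n$ (one block). For $\pi\in NC(n)$, $P_\pi$ is the permutation of $\{1,\dots,n\}$ which maps cyclically $b_1\mapsto b_2\mapsto\cdots\mapsto b_m\mapsto b_1$ on every block $\{b_1<\dots<b_m\}$ of $\pi$. The Kreweras complement $K(\pi)\in NC(n)$ is determined by $P_{K(\pi)}=P_\pi^{-1}P_{1_n}$. The Hopf algebra $\mathcal{Y}^{(1)}$: as an algebra, $\mathcal{Y}^{(1)}=\mathbb{C}[Y_n\mid n\ge2]$ (commutative polynomials). Put $Y_1:=1$ and $Y_\pi:=\prod_{A\text{ block of }\pi}Y_{|A|}$ for $\pi\in NC(n)$. The comultiplication $\Delta$ is the unital algebra homomorphism with $\Delta(Y_n)=\sum_{\pi\in NC(n)}Y_\pi\otimes Y_{K(\pi)}$ for $n\ge2$, and the counit $\varepsilon$ is the unital algebra homomorphism with $\varepsilon(Y_n)=0$ for $n\ge2$. With these, $\mathcal{Y}^{(1)}$ is a graded connected Hopf algebra, graded by declaring $Y_n$ homogeneous of degree $n-1$. $\mathrm{Sym}$ is the Hopf algebra of symmetric functions over $\mathbb{C}$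 with its usual grading; $e_n$ ($n\ge1$) are the elementary symmetric functions, which generate $\mathrm{Sym}$ as a commutative polynomial algebra. Its comultiplication satisfies $\Delta(e_n)=\sum_{i=0}^ne_i\otimes e_{n-i}$ ($e_0:=1$), and its counit vanishes on homogeneous elements of degree $\ge1$. *)

theory Defs
  imports Complex_Main "HOL-Library.Poly_Mapping" "HOL-Library.Product_Plus"
    "HOL-Library.Disjoint_Sets" "HOL-Library.Nat_Bijection"
begin

section \<open>Non-crossing partitions\<close>

definition noncrossing :: "nat set set \<Rightarrow> bool" where
  "noncrossing \<pi> \<longleftrightarrow>
     \<not> (\<exists>A\<in>\<pi>. \<exists>B\<in>\<pi>. A \<noteq> B \<and>
          (\<exists>a b c d. a < b \<and> b < c \<and> c < d \<and> a \<in> A \<and> b \<in> B \<and> c \<in> A \<and> d \<in> B))"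

definition NC :: "nat \<Rightarrow> nat set set set" where
  "NC n = {\<pi>. partition_on {1..n} \<pi> \<and> noncrossing \<pi>}"

text \<open>The permutation \<open>P\<^sub>\<pi>\<close>, extended by the identity outside the underlying set of \<open>\<pi>\<close>.\<close>

definition block_perm :: "nat set set \<Rightarrow> nat \<Rightarrow> nat" where
  "block_perm \<pi> i =
     (if i \<in> \<Union>\<pi> then
        let A = (THE A. A \<in> \<pi> \<and> i \<in> A)
        in if \<exists>j\<in>A. i < j then Min {j \<in> A. i < j} else Min A
      else i)"

definition kreweras :: "nat \<Rightarrow> nat set set \<Rightarrow> nat set set" where
  "kreweras n \<pi> =
     (THE \<sigma>. \<sigma> \<in> NC n \<and> block_perm \<sigma> = inv (block_perm \<pi>) \<circ> block_perm {{1..n}})"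


section \<open>The Hopf algebra \<open>\<Y>\<^sup>(\<^sup>1\<^sup>)\<close>\<close>

text \<open>
  The polynomial variable with index \<open>i\<close> stands for \<open>Y\<^bsub>i+2\<^esub>\<close>, so that the whole type is
  the polynomial algebra on \<open>Y\<^sub>2, Y\<^sub>3, \<dots>\<close>.  Its tensor square has the pairs of monomials
  as a basis; this is the monoid algebra of the monoid of pairs.
\<close>

type_synonym mono = "nat \<Rightarrow>\<^sub>0 nat"
type_synonym yalg = "mono \<Rightarrow>\<^sub>0 complex"
type_synonym yalg2 = "(mono \<times> mono) \<Rightarrow>\<^sub>0 complex"

definition Y :: "nat \<Rightarrow> yalg" where
  "Y n = (if n \<le> 1 then 1 else Poly_Mapping.single (Poly_Mapping.single (n - 2) 1) 1)"

definition Y_part :: "nat set set \<Rightarrow> yalg" where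
  "Y_part \<pi> = (\<Prod>A\<in>\<pi>. Y (card A))"

definition y_scale :: "complex \<Rightarrow> yalg \<Rightarrow> yalg" where
  "y_scale c p = Poly_Mapping.single 0 c * p"

definition y_tensor :: "yalg \<Rightarrow> yalg \<Rightarrow> yalg2" where
  "y_tensor p q =
     (\<Sum>a\<in>Poly_Mapping.keys p. \<Sum>b\<in>Poly_Mapping.keys q.
        Poly_Mapping.single (a, b) (Poly_Mapping.lookup p a * Poly_Mapping.lookup q b))"

text \<open>
  The unital algebra homomorphism sending \<open>Y n\<close> to \<open>v n\<close> for \<open>n \<ge> 2\<close>, where \<open>emb\<close> is the
  embedding of the scalars into the target algebra.
\<close>

definition y_eval :: "(complex \<Rightarrow> 'r) \<Rightarrow> (nat \<Rightarrow> 'r) \<Rightarrow> yalg \<Rightarrow> 'r::comm_ring_1" where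
  "y_eval emb v p =
     (\<Sum>m\<in>Poly_Mapping.keys p. emb (Poly_Mapping.lookup p m) *
        (\<Prod>i\<in>Poly_Mapping.keys m. v (i + 2) ^ Poly_Mapping.lookup m i))"

definition y_comult :: "yalg \<Rightarrow> yalg2" where
  "y_comult = y_eval (Poly_Mapping.single 0)
     (\<lambda>n. \<Sum>\<pi>\<in>NC n. y_tensor (Y_part \<pi>) (Y_part (kreweras n \<pi>)))"

definition y_counit :: "yalg \<Rightarrow> complex" where
  "y_counit = y_eval (\<lambda>c. c) (\<lambda>n. 0)"

text \<open>The weight \<open>i + 1\<close> is the degree \<open>n - 1\<close> of \<open>Y n\<close> with \<open>n = i + 2\<close>.\<close>

definition y_grade :: "nat \<Rightarrow> yalg set" where
  "y_grade d =
     {p. \<forall>m\<in>Poly_Mapping.keys p. (\<Sum>i\<in>Poly_Mapping.keys m. (i + 1) * Poly_Mapping.lookup m i) = d}"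


section \<open>Formal power series in arbitrarily many variables\<close>

typedef 'v mser = "UNIV :: (('v \<Rightarrow>\<^sub>0 nat) \<Rightarrow> complex) set"
  morphisms mcoeff Abs_mser ..

lemma mcoeff_Abs [simp]: "mcoeff (Abs_mser f) = f"
  by (simp add: Abs_mser_inverse)

lemma mser_eqI: "(\<And>m. mcoeff f m = mcoeff g m) \<Longrightarrow> f = g"
  by (rule mcoeff_inject[THEN iffD1]) (rule ext)

lemma finite_decomp: "finite {(a, b). a + b = (m :: 'v \<Rightarrow>\<^sub>0 nat)}"
proof -
  let ?S = "{(a, b). a + b = m}"
  let ?N = "\<Sum>i\<in>Poly_Mapping.keys m. Poly_Mapping.lookup m i"
  let ?F = "{f. \<forall>i. (i \<in> Poly_Mapping.keys m \<longrightarrow> f i \<in> {..?N}) \<and> (i \<notin> Poly_Mapping.keys m \<longrightarrow> f i = 0)}"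
  have "finite ?F"
    by (rule finite_set_of_finite_funs) auto
  moreover have "Poly_Mapping.lookup a i \<le> ?N" if "i \<in> Poly_Mapping.keys m" "a + b = m" for a b i
  proof -
    have "Poly_Mapping.lookup a i \<le> Poly_Mapping.lookup m i"
      using that(2) by (auto simp: lookup_add)
    also have "\<dots> \<le> ?N"
      using that(1) by (intro member_le_sum) auto
    finally show ?thesis .
  qed
  then have "(\<lambda>(a, b). Poly_Mapping.lookup a) ` ?S \<subseteq> ?F"
    by (auto simp: in_keys_iff lookup_add)
  moreover have "inj_on (\<lambda>(a, b). Poly_Mapping.lookup a) ?S"
    by (auto simp: inj_on_def lookup_inject)
  ultimately show ?thesis
    by (meson finite_imageD finite_subset)
qed

instantiation mser :: (type) comm_ring_1
begin

definition zero_mser :: "'a mser" where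
  "0 = Abs_mser (\<lambda>m. 0)"

definition one_mser :: "'a mser" where
  "1 = Abs_mser (\<lambda>m. if m = 0 then 1 else 0)"

definition plus_mser :: "'a mser \<Rightarrow> 'a mser \<Rightarrow> 'a mser" where
  "f + g = Abs_mser (\<lambda>m. mcoeff f m + mcoeff g m)"

definition uminus_mser :: "'a mser \<Rightarrow> 'a mser" where
  "- f = Abs_mser (\<lambda>m. - mcoeff f m)"

definition minus_mser :: "'a mser \<Rightarrow> 'a mser \<Rightarrow> 'a mser" where
  "f - g = Abs_mser (\<lambda>m. mcoeff f m - mcoeff g m)"

definition times_mser :: "'a mser \<Rightarrow> 'a mser \<Rightarrow> 'a mser" where
  "f * g = Abs_mser (\<lambda>m. \<Sum>(a, b) | a + b = m. mcoeff f a * mcoeff g b)"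

instance
proof
  fix f g h :: "'a mser"
  show "f + g + h = f + (g + h)" "f + g = g + f" "0 + f = f" "- f + f = 0" "f - g = f + - g"
    by (auto intro!: mser_eqI simp: plus_mser_def zero_mser_def uminus_mser_def minus_mser_def)
  show "(0::'a mser) \<noteq> 1"
  proof
    assume "(0::'a mser) = 1"
    then have "mcoeff (0::'a mser) 0 = mcoeff 1 0" by simp
    then show False by (simp add: zero_mser_def one_mser_def)
  qed
  show "f * g = g * f"
  proof (rule mser_eqI)
    fix m
    show "mcoeff (f * g) m = mcoeff (g * f) m"
      unfolding times_mser_def mcoeff_Abs
      by (rule sum.reindex_bij_witness[of _ prod.swap prod.swap]) (auto simp: add.commute)
  qed
  show "1 * f = f"
  proof (rule mser_eqI)
    fix m
    have "mcoeff (1 * f) m = (\<Sum>(a, b) | a + b = m. (if a = 0 then 1 else 0) * mcoeff f b)"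
      by (simp add: times_mser_def one_mser_def)
    also have "\<dots> = (\<Sum>(a, b)\<in>{(0 :: 'a \<Rightarrow>\<^sub>0 nat, m)}. (if a = 0 then 1 else 0) * mcoeff f b)"
      by (rule sum.mono_neutral_right) (auto simp: finite_decomp split: if_splits)
    finally show "mcoeff (1 * f) m = mcoeff f m" by simp
  qed
  show "(f + g) * h = f * h + g * h"
    by (rule mser_eqI)
      (simp add: times_mser_def plus_mser_def case_prod_unfold distrib_right sum.distrib)
  show "f * g * h = f * (g * h)"
  proof (rule mser_eqI)
    fix m
    have "mcoeff (f * g * h) m =
        (\<Sum>x | fst x + snd x = m. \<Sum>y | fst y + snd y = fst x.
           mcoeff f (fst y) * mcoeff g (snd y) * mcoeff h (snd x))"
      by (simp add: times_mser_def case_prod_unfold sum_distrib_right)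
    also have "\<dots> = (\<Sum>(x, y)\<in>(SIGMA x:{x. fst x + snd x = m}. {y. fst y + snd y = fst x}).
           mcoeff f (fst y) * mcoeff g (snd y) * mcoeff h (snd x))"
      using finite_decomp by (intro sum.Sigma) (auto simp: case_prod_unfold)
    also have "\<dots> = (\<Sum>(x, y)\<in>(SIGMA x:{x. fst x + snd x = m}. {y. fst y + snd y = snd x}).
           mcoeff f (fst x) * (mcoeff g (fst y) * mcoeff h (snd y)))"
      by (rule sum.reindex_bij_witness[of _ "\<lambda>((a, s), (b, c)). ((a + b, c), (a, b))"
            "\<lambda>((s, c), (a, b)). ((a, b + c), (b, c))"])
        (auto simp: add.assoc mult.assoc)
    also have "\<dots> = (\<Sum>x | fst x + snd x = m. \<Sum>y | fst y + snd y = snd x.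
           mcoeff f (fst x) * (mcoeff g (fst y) * mcoeff h (snd y)))"
      using finite_decomp by (intro sum.Sigma[symmetric]) (auto simp: case_prod_unfold)
    also have "\<dots> = mcoeff (f * (g * h)) m"
      by (simp add: times_mser_def case_prod_unfold sum_distrib_left)
    finally show "mcoeff (f * g * h) m = mcoeff (f * (g * h)) m" .
  qed
qed

end

definition mscale :: "complex \<Rightarrow> 'v mser \<Rightarrow> 'v mser" where
  "mscale c f = Abs_mser (\<lambda>m. c * mcoeff f m)"

definition mdeg :: "('v \<Rightarrow>\<^sub>0 nat) \<Rightarrow> nat" where
  "mdeg m = (\<Sum>i\<in>Poly_Mapping.keys m. Poly_Mapping.lookup m i)"


section \<open>The Hopf algebra of symmetric functions\<close>

text \<open>
  Symmetric functions are the power series of bounded degree in \<open>x\<^sub>0, x\<^sub>1, \<dots>\<close> which are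
  invariant under all permutations of the variables.
\<close>

definition Sym :: "nat mser set" where
  "Sym = {f. (\<exists>d. \<forall>m. mcoeff f m \<noteq> 0 \<longrightarrow> mdeg m \<le> d) \<and>
             (\<forall>s m. bij s \<longrightarrow> mcoeff f (Poly_Mapping.map_key s m) = mcoeff f m)}"

definition sym_grade :: "nat \<Rightarrow> nat mser set" where
  "sym_grade d = {f \<in> Sym. \<forall>m. mcoeff f m \<noteq> 0 \<longrightarrow> mdeg m = d}"

definition esym :: "nat \<Rightarrow> nat mser" where
  "esym n = Abs_mser (\<lambda>m.
     if (\<forall>i. Poly_Mapping.lookup m i \<le> 1) \<and> card (Poly_Mapping.keys m) = n then 1 else 0)"

text \<open>
  The tensor square of \<open>Sym\<close> is realised inside the power series in two alphabets
  (\<open>Inl i\<close> for \<open>x\<^sub>i\<close> and \<open>Inr i\<close> for \<open>y\<^sub>i\<close>), with \<open>f \<otimes> g = f(x) g(y)\<close>, as the span of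
  these products.  The comultiplication is \<open>f \<mapsto> f(x, y)\<close>: the variables of \<open>f\<close> are replaced
  by those of both alphabets, enumerated along the bijection \<open>sum_decode\<close>; by symmetry of
  \<open>f\<close> the choice of the enumeration is irrelevant.
\<close>

definition sym_tensor :: "nat mser \<Rightarrow> nat mser \<Rightarrow> (nat + nat) mser" where
  "sym_tensor f g = Abs_mser (\<lambda>m.
     mcoeff f (Poly_Mapping.map_key Inl m) * mcoeff g (Poly_Mapping.map_key Inr m))"

definition sym_comult :: "nat mser \<Rightarrow> (nat + nat) mser" where
  "sym_comult f = Abs_mser (\<lambda>m. mcoeff f (Poly_Mapping.map_key sum_decode m))"

definition sym_counit :: "nat mser \<Rightarrow> complex" where
  "sym_counit f = mcoeff f 0"

definition y_sym :: "nat \<Rightarrow> nat mser" where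
  "y_sym n = (\<Sum>\<pi>\<in>NC (n - 1). \<Prod>A\<in>\<pi>. esym (card A))"


section \<open>Homomorphisms from \<open>\<Y>\<^sup>(\<^sup>1\<^sup>)\<close> to \<open>Sym\<close>\<close>

definition unital_algebra_hom :: "(yalg \<Rightarrow> nat mser) \<Rightarrow> bool" where
  "unital_algebra_hom \<Phi> \<longleftrightarrow>
     (\<forall>p. \<Phi> p \<in> Sym) \<and>
     \<Phi> 1 = 1 \<and>
     (\<forall>p q. \<Phi> (p + q) = \<Phi> p + \<Phi> q) \<and>
     (\<forall>c p. \<Phi> (y_scale c p) = mscale c (\<Phi> p)) \<and>
     (\<forall>p q. \<Phi> (p * q) = \<Phi> p * \<Phi> q)"

text \<open>The linear map \<open>\<Phi> \<otimes> \<Phi>\<close>, given by its values on the basis of pairs of monomials.\<close>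

definition tensor_map :: "(yalg \<Rightarrow> nat mser) \<Rightarrow> yalg2 \<Rightarrow> (nat + nat) mser" where
  "tensor_map \<Phi> t =
     (\<Sum>(a, b)\<in>Poly_Mapping.keys t. mscale (Poly_Mapping.lookup t (a, b))
        (sym_tensor (\<Phi> (Poly_Mapping.single a 1)) (\<Phi> (Poly_Mapping.single b 1))))"

text \<open>A homomorphism of bialgebras between Hopf algebras automatically preserves the antipodes.\<close>

definition graded_hopf_iso :: "(yalg \<Rightarrow> nat mser) \<Rightarrow> bool" where
  "graded_hopf_iso \<Phi> \<longleftrightarrow>
     unital_algebra_hom \<Phi> \<and>
     bij_betw \<Phi> UNIV Sym \<and>
     (\<forall>p. tensor_map \<Phi> (y_comult p) = sym_comult (\<Phi> p)) \<and>
     (\<forall>p. sym_counit (\<Phi> p) = y_counit p) \<and>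
     (\<forall>d. \<Phi> ` y_grade d = sym_grade d)"

end

theory Submission
  imports Defs "HOL-Computational_Algebra.Formal_Power_Series"
begin

text \<open>
  The theorem has two independent halves: \<open>\<Phi>\<close> is a degree preserving bijection, and it is
  compatible with the comultiplications.  Write \<open>E(z) = \<Sum> e\<^sub>n z\<^sup>n\<close>.

  \<^emph>\<open>Bijectivity.\<close>  The \<open>e\<^sub>n\<close> are free generators of \<open>Sym\<close> (\<open>e_eval_inj\<close>, \<open>e_eval_surj\<close>): for the
  weight \<open>\<Sum> j m\<^sub>j\<close> on monomials \<open>\<Prod> x\<^sub>j^m\<^sub>j\<close>, the monomial of least weight in
  \<open>e\<^sub>n\<close> is \<open>x\<^sub>0 \<dots> x\<^bsub>n-1\<^esub>\<close>.  Such leading monomials multiply, and the one of a product of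
  \<open>e\<^sub>n\<close>'s is the conjugate partition, so that each decreasing exponent occurs exactly
  once.  The one-block partition contributes \<open>e\<^bsub>n-1\<^esub>\<close> to \<open>y\<^sub>n\<close>, and all others contribute
  products of several \<open>e\<^sub>k\<close> with smaller indices.  Hence \<open>\<Phi>\<close> is a unitriangular change of
  generators (\<open>bij_y_moment_eval\<close>) followed by the isomorphism \<open>Y\<^bsub>n+1\<^esub> \<mapsto> e\<^sub>n\<close>.  As \<open>y\<^sub>n\<close> is
  homogeneous of degree \<open>n - 1\<close>, degrees are preserved, and so is the counit.

  \<^emph>\<open>Comultiplication.\<close>  All maps involved are algebra homomorphisms, so it suffices to compare
  values on \<open>Y\<^sub>n\<close>.  Here \<open>y\<^sub>n\<close> is the moment of order \<open>n - 1\<close> for the free cumulants \<open>e\<^sub>k\<close>, which means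
  that \<open>F(z) = \<Sum> y\<^sub>n z\<^sup>n\<close> satisfies \<open>F = z E(F)\<close> (\<open>moment_fps_fixpoint\<close>).  The comultiplication of
  \<open>Sym\<close> replaces \<open>E\<close> by the product \<open>E\<^sub>x E\<^sub>y\<close> of the series of two alphabets \<open>x\<close> and \<open>y\<close>.  The
  claim is therefore that the series \<open>h(z)\<close> whose coefficient of \<open>z\<^sup>n\<close> is the sum over \<open>\<pi>\<close> of
  \<open>y\<^sub>\<pi>(x) y\<^bsub>K(\<pi>)\<^esub>(y)\<close> solves \<open>h = z E\<^sub>x(h) E\<^sub>y(h)\<close>, an equation which has only one solution
  (\<open>moment_multiplicative_convolution\<close>).  This is the multiplicativity of the \<open>S\<close>-transform in
  free probability.

  To prove it, a partition of \<open>{1..n}\<close> is cut at the block of \<open>1\<close>: it is glued from an arbitrary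
  partition \<open>\<rho>\<close> of the gap between \<open>1\<close> and the next element of its block (the gap is all of
  \<open>{2..n}\<close> if \<open>1\<close> is alone) and an arbitrary partition \<open>\<sigma>\<close> of what follows the gap
  (\<open>bij_betw_glue\<close>).  The Kreweras complement of the result is glued from those of \<open>\<rho>\<close> and \<open>\<sigma>\<close> (\<open>kreweras_glue\<close>).  Keeping track of the block of
  \<open>1\<close> in \<open>\<pi>\<close> and of the block of \<open>n\<close> in \<open>K(\<pi>)\<close> turns this into linear recursions for power series.
  Their solution is \<open>h = F\<^sub>x(u) = F\<^sub>y(v)\<close> with \<open>h = c u\<close> and \<open>v = c z\<close> for some \<open>c\<close> with constant
  term \<open>1\<close>.  The equations of \<open>F\<^sub>x\<close> and \<open>F\<^sub>y\<close> give \<open>h = u E\<^sub>x(h)\<close> and \<open>h = v E\<^sub>y(h)\<close>; cancelling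
  \<open>c\<close> in the second leaves \<open>u = z E\<^sub>y(h)\<close>, and the first becomes the claim.
\<close>

section \<open>Cutting a non-crossing partition at the block of 1\<close>

definition cyc_succ :: "nat set \<Rightarrow> nat \<Rightarrow> nat" where
  "cyc_succ A i = (if \<exists>j\<in>A. i < j then Min {j \<in> A. i < j} else Min A)"

text \<open>
  The block of \<open>i\<close>, which is empty if \<open>i\<close> lies outside the underlying set.  This default lets an
  empty gap and an empty remainder be treated like the other cases below.
\<close>

definition blk :: "nat \<Rightarrow> nat set set \<Rightarrow> nat set" where
  "blk i \<pi> = \<Union>{A \<in> \<pi>. i \<in> A}"

abbreviation shift :: "nat \<Rightarrow> nat set \<Rightarrow> nat set" where
  "shift a A \<equiv> (+) a ` A"

lemma NC_D:
  assumes "\<pi> \<in> NC n"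
  shows "\<Union>\<pi> = {1..n}" "{} \<notin> \<pi>" "disjoint \<pi>"
  using assms by (auto simp: NC_def partition_on_def)

lemma NC_block:
  assumes "\<pi> \<in> NC n" "A \<in> \<pi>"
  shows "A \<subseteq> {1..n}" "finite A" "A \<noteq> {}"
proof -
  show "A \<subseteq> {1..n}" using NC_D(1)[OF assms(1)] assms(2) by blast
  then show "finite A" by (rule finite_subset) simp
  show "A \<noteq> {}" using NC_D(2)[OF assms(1)] assms(2) by blast
qed

lemma NC_elem: "\<pi> \<in> NC n \<Longrightarrow> A \<in> \<pi> \<Longrightarrow> i \<in> A \<Longrightarrow> 1 \<le> i \<and> i \<le> n"
  using NC_block(1) by fastforce

lemma NC_same_block:
  assumes "\<pi> \<in> NC n" "A \<in> \<pi>" "B \<in> \<pi>" "i \<in> A" "i \<in> B"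
  shows "A = B"
  using NC_D(3)[OF assms(1)] assms(2-) by (auto simp: disjoint_def)

lemma NC_crossing:
  assumes "\<pi> \<in> NC n" "A \<in> \<pi>" "B \<in> \<pi>"
    and "a < b" "b < c" "c < d" "a \<in> A" "b \<in> B" "c \<in> A" "d \<in> B"
  shows "A = B"
proof (rule ccontr)
  assume "A \<noteq> B"
  then have "\<exists>A\<in>\<pi>. \<exists>B\<in>\<pi>. A \<noteq> B \<and>
      (\<exists>a b c d. a < b \<and> b < c \<and> c < d \<and> a \<in> A \<and> b \<in> B \<and> c \<in> A \<and> d \<in> B)"
    using assms(2-) by (intro bexI[of _ A] bexI[of _ B] conjI exI[of _ a] exI[of _ b] exI[of _ c] exI[of _ d])
  moreover have "noncrossing \<pi>" using assms(1) by (simp add: NC_def)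
  ultimately show False by (simp add: noncrossing_def)
qed

text \<open>
  The conditions are spelled out elementwise because blocks of glued partitions are compared
  through their elements.
\<close>

lemma NC_I:
  assumes "\<And>A i. A \<in> \<pi> \<Longrightarrow> i \<in> A \<Longrightarrow> 1 \<le> i \<and> i \<le> n"
    and "\<And>i. 1 \<le> i \<Longrightarrow> i \<le> n \<Longrightarrow> \<exists>A\<in>\<pi>. i \<in> A"
    and "{} \<notin> \<pi>"
    and "\<And>A B i. A \<in> \<pi> \<Longrightarrow> B \<in> \<pi> \<Longrightarrow> i \<in> A \<Longrightarrow> i \<in> B \<Longrightarrow> A = B"
    and "\<And>A B a b c d. A \<in> \<pi> \<Longrightarrow> B \<in> \<pi> \<Longrightarrow> a < b \<Longrightarrow> b < c \<Longrightarrow> c < d \<Longrightarrow>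
           a \<in> A \<Longrightarrow> b \<in> B \<Longrightarrow> c \<in> A \<Longrightarrow> d \<in> B \<Longrightarrow> A = B"
  shows "\<pi> \<in> NC n"
proof -
  have "\<Union>\<pi> = {1..n}" using assms(1,2) by fastforce
  moreover have "disjoint \<pi>"
    using assms(4) by (fastforce simp: disjoint_def)
  moreover have "noncrossing \<pi>"
    unfolding noncrossing_def by (auto dest: assms(5))
  ultimately show ?thesis using assms(3) by (auto simp: NC_def partition_on_def)
qed

lemma finite_NC [simp]: "finite (NC n)"
  by (rule finite_subset[of _ "{\<pi>. partition_on {1..n} \<pi>}"])
    (auto simp: NC_def finitely_many_partition_on)

lemma finite_NC_member: "\<pi> \<in> NC n \<Longrightarrow> finite \<pi>"
  by (rule finite_elements[of "{1..n}"]) (auto simp: NC_def)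

lemma NC_0 [simp]: "NC 0 = {{}}"
  by (auto simp: NC_def noncrossing_def partition_on_empty)

lemma blk_eq:
  assumes "\<pi> \<in> NC n" "A \<in> \<pi>" "i \<in> A"
  shows "blk i \<pi> = A"
  using NC_same_block[OF assms(1)] assms(2,3) unfolding blk_def by fastforce

lemma blk_outside:
  assumes "\<pi> \<in> NC n" "\<not> (1 \<le> i \<and> i \<le> n)"
  shows "blk i \<pi> = {}"
  using NC_elem[OF assms(1)] assms(2) by (force simp: blk_def)

lemma blk_in:
  assumes "\<pi> \<in> NC n" "1 \<le> i" "i \<le> n"
  shows "blk i \<pi> \<in> \<pi>" "i \<in> blk i \<pi>"
proof -
  have "i \<in> \<Union>\<pi>" using assms by (simp add: NC_D)
  then obtain A where A: "A \<in> \<pi>" "i \<in> A" by blast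
  then show "blk i \<pi> \<in> \<pi>" "i \<in> blk i \<pi>" using blk_eq[OF assms(1) A] by simp_all
qed

lemma blk_memD:
  assumes "\<pi> \<in> NC n" "j \<in> blk i \<pi>"
  shows "blk i \<pi> \<in> \<pi>" "i \<in> blk i \<pi>" "1 \<le> j" "j \<le> n"
proof -
  have i: "1 \<le> i \<and> i \<le> n" using blk_outside[OF assms(1), of i] assms(2) by auto
  then show "blk i \<pi> \<in> \<pi>" "i \<in> blk i \<pi>" using blk_in[OF assms(1)] by auto
  then show "1 \<le> j" "j \<le> n" using NC_elem[OF assms(1) _ assms(2)] by auto
qed

lemma blk_empty_or_mem: "\<pi> \<in> NC n \<Longrightarrow> blk i \<pi> = {} \<or> blk i \<pi> \<in> \<pi> \<and> i \<in> blk i \<pi>"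
  using blk_memD by blast

text \<open>
  The partition \<open>\<rho>\<close> is placed on \<open>{2..b+1}\<close> and \<open>\<sigma>\<close> on \<open>{b+2..}\<close>; the point \<open>1\<close> joins the block of
  the first point of \<open>\<sigma>\<close>, or becomes a singleton if \<open>\<sigma>\<close> is empty.
\<close>

definition glue :: "nat \<Rightarrow> nat set set \<Rightarrow> nat set set \<Rightarrow> nat set set" where
  "glue b \<rho> \<sigma> = (`) Suc ` \<rho> \<union> shift (Suc b) ` (\<sigma> - {blk 1 \<sigma>}) \<union>
     {insert 1 (shift (Suc b) (blk 1 \<sigma>))}"

text \<open>
  The Kreweras complement of a glued partition: \<open>\<rho>\<close> is placed on \<open>{2..b+1}\<close>, and \<open>1\<close> joins the
  block of its last point \<open>b+1\<close> (or stays alone if \<open>b = 0\<close>), while \<open>\<sigma>\<close> is placed on \<open>{b+2..}\<close> untouched.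
\<close>

definition coglue :: "nat \<Rightarrow> nat set set \<Rightarrow> nat set set \<Rightarrow> nat set set" where
  "coglue b \<rho> \<sigma> = (`) Suc ` (\<rho> - {blk b \<rho>}) \<union> shift (Suc b) ` \<sigma> \<union>
     {insert 1 (Suc ` blk b \<rho>)}"

lemma glue_I:
  "R \<in> \<rho> \<Longrightarrow> Suc ` R \<in> glue b \<rho> \<sigma>"
  "S \<in> \<sigma> \<Longrightarrow> S \<noteq> blk 1 \<sigma> \<Longrightarrow> shift (Suc b) S \<in> glue b \<rho> \<sigma>"
  "insert 1 (shift (Suc b) (blk 1 \<sigma>)) \<in> glue b \<rho> \<sigma>"
  unfolding glue_def by auto

lemma coglue_I:
  "R \<in> \<rho> \<Longrightarrow> R \<noteq> blk b \<rho> \<Longrightarrow> Suc ` R \<in> coglue b \<rho> \<sigma>"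
  "S \<in> \<sigma> \<Longrightarrow> shift (Suc b) S \<in> coglue b \<rho> \<sigma>"
  "insert 1 (Suc ` blk b \<rho>) \<in> coglue b \<rho> \<sigma>"
  unfolding coglue_def by auto

text \<open>
  An \<open>upper\<close> block \<open>A\<close> is described by the block \<open>S\<close> of \<open>\<sigma>\<close> that it comes from, where \<open>S\<close> may be empty.
  Distinct upper blocks have distinct \<open>S\<close>, so that two upper blocks can be compared inside \<open>\<sigma>\<close>.
\<close>

lemma glue_cases [consumes 3, case_names lower upper]:
  assumes \<rho>: "\<rho> \<in> NC b" and \<sigma>: "\<sigma> \<in> NC m" and "A \<in> glue b \<rho> \<sigma>"
  obtains R where "R \<in> \<rho>" "A = Suc ` R" "\<And>i. i \<in> A \<Longrightarrow> 2 \<le> i \<and> i \<le> Suc b"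
  | S where "S = blk 1 \<sigma> \<or> S \<in> \<sigma>" "A = (if S = blk 1 \<sigma> then insert 1 (shift (Suc b) S) else shift (Suc b) S)"
      "\<And>i. i \<in> A \<Longrightarrow> i = 1 \<and> S = blk 1 \<sigma> \<or> (\<exists>j\<in>S. i = Suc b + j \<and> S \<in> \<sigma> \<and> 1 \<le> j \<and> j \<le> m)"
proof -
  consider R where "R \<in> \<rho>" "A = Suc ` R" | S where "S \<in> \<sigma>" "S \<noteq> blk 1 \<sigma>" "A = shift (Suc b) S"
    | "A = insert 1 (shift (Suc b) (blk 1 \<sigma>))"
    using assms(3) by (auto simp: glue_def)
  then show thesis
  proof cases
    case 1
    show thesis by (rule that(1)[OF 1]) (use 1 NC_elem[OF \<rho> 1(1)] in auto)
  next
    case 2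
    show thesis by (rule that(2)[of S]) (use 2 NC_elem[OF \<sigma> 2(1)] in auto)
  next
    case 3
    have "blk 1 \<sigma> \<in> \<sigma> \<and> 1 \<le> j \<and> j \<le> m" if "j \<in> blk 1 \<sigma>" for j
      using blk_memD[OF \<sigma> that] by simp
    then show thesis using 3 by (intro that(2)[of "blk 1 \<sigma>"]) auto
  qed
qed

lemma coglue_cases [consumes 3, case_names upper lower]:
  assumes \<rho>: "\<rho> \<in> NC b" and \<sigma>: "\<sigma> \<in> NC m" and "A \<in> coglue b \<rho> \<sigma>"
  obtains S where "S \<in> \<sigma>" "A = shift (Suc b) S" "\<And>i. i \<in> A \<Longrightarrow> Suc b < i \<and> i \<le> Suc b + m"
  | R where "R = blk b \<rho> \<or> R \<in> \<rho>" "A = (if R = blk b \<rho> then insert 1 (Suc ` R) else Suc ` R)"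
      "\<And>i. i \<in> A \<Longrightarrow> i = 1 \<and> R = blk b \<rho> \<or> (\<exists>j\<in>R. i = Suc j \<and> R \<in> \<rho> \<and> 1 \<le> j \<and> j \<le> b)"
proof -
  consider R where "R \<in> \<rho>" "R \<noteq> blk b \<rho>" "A = Suc ` R" | S where "S \<in> \<sigma>" "A = shift (Suc b) S"
    | "A = insert 1 (Suc ` blk b \<rho>)"
    using assms(3) by (auto simp: coglue_def)
  then show thesis
  proof cases
    case 1
    show thesis by (rule that(2)[of R]) (use 1 NC_elem[OF \<rho> 1(1)] in auto)
  next
    case 2
    show thesis by (rule that(1)[OF 2]) (use 2 NC_elem[OF \<sigma> 2(1)] in fastforce)
  next
    case 3
    have "blk b \<rho> \<in> \<rho> \<and> 1 \<le> j \<and> j \<le> b" if "j \<in> blk b \<rho>" for j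
      using blk_memD[OF \<rho> that] by simp
    then show thesis using 3 by (intro that(2)[of "blk b \<rho>"]) auto
  qed
qed

text \<open>
  Blocks of \<open>\<rho>\<close> live in an interval which no other block meets, so crossings can only be among
  blocks of the same kind.  A crossing that uses the new point \<open>1\<close> yields one in \<open>\<sigma>\<close> with the first
  point of \<open>\<sigma>\<close> in place of \<open>1\<close>.
\<close>

lemma glue_NC:
  assumes \<rho>: "\<rho> \<in> NC b" and \<sigma>: "\<sigma> \<in> NC m"
  shows "glue b \<rho> \<sigma> \<in> NC (Suc (b + m))"
proof (rule NC_I)
  show "1 \<le> i \<and> i \<le> Suc (b + m)" if "A \<in> glue b \<rho> \<sigma>" "i \<in> A" for A i
    using \<rho> \<sigma> that(1)
  proof (cases rule: glue_cases)
    case (lower R)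
    then show ?thesis using that(2) by fastforce
  next
    case (upper S)
    show ?thesis using upper(3)[OF that(2)] by auto
  qed
next
  fix i :: nat
  assume i: "1 \<le> i" "i \<le> Suc (b + m)"
  consider "i = 1" | "2 \<le> i" "i \<le> Suc b" | "Suc b < i" using i by linarith
  then show "\<exists>A\<in>glue b \<rho> \<sigma>. i \<in> A"
  proof cases
    case 1
    then show ?thesis by (auto simp: glue_def)
  next
    case 2
    then have "1 \<le> i - 1" "i - 1 \<le> b" by auto
    from blk_in[OF \<rho> this] 2 have "blk (i - 1) \<rho> \<in> \<rho>" "i \<in> Suc ` blk (i - 1) \<rho>"
      by (auto intro!: image_eqI[of i Suc "i - 1"])
    then show ?thesis using glue_I(1) by (metis (no_types))
  next
    case 3
    then have j: "1 \<le> i - Suc b" "i - Suc b \<le> m" using i by auto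
    from blk_in[OF \<sigma> j] 3 have *: "i \<in> shift (Suc b) (blk (i - Suc b) \<sigma>)" "blk (i - Suc b) \<sigma> \<in> \<sigma>"
      by (auto intro!: image_eqI[of i _ "i - Suc b"])
    show ?thesis
    proof (cases "blk (i - Suc b) \<sigma> = blk 1 \<sigma>")
      case True
      then have "i \<in> insert 1 (shift (Suc b) (blk 1 \<sigma>))" using *(1) by simp
      then show ?thesis using glue_I(3) by (rule rev_bexI[rotated])
    next
      case False
      then show ?thesis using glue_I(2)[OF *(2)] *(1) by (intro rev_bexI)
    qed
  qed
next
  show "{} \<notin> glue b \<rho> \<sigma>"
    using NC_D(2)[OF \<rho>] NC_D(2)[OF \<sigma>] by (auto simp: glue_def)
next
  fix A B i
  assume AB: "A \<in> glue b \<rho> \<sigma>" "B \<in> glue b \<rho> \<sigma>" and i: "i \<in> A" "i \<in> B"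
  show "A = B"
    using \<rho> \<sigma> AB(1)
  proof (cases rule: glue_cases)
    case A: (lower R)
    show ?thesis using \<rho> \<sigma> AB(2)
    proof (cases rule: glue_cases)
      case (lower R')
      then show ?thesis using A lower i NC_same_block[OF \<rho>, of R R'] by auto
    next
      case (upper S)
      then show ?thesis using A(3)[OF i(1)] upper(3)[OF i(2)] by auto
    qed
  next
    case A: (upper S)
    show ?thesis using \<rho> \<sigma> AB(2)
    proof (cases rule: glue_cases)
      case (lower R')
      then show ?thesis using A(3)[OF i(1)] lower(3)[OF i(2)] by auto
    next
      case (upper S')
      have "S = S'"
      proof (cases "i = 1")
        case True
        then have "S = blk 1 \<sigma>" "S' = blk 1 \<sigma>" using A(3)[OF i(1)] upper(3)[OF i(2)] by auto
        then show ?thesis by simp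
      next
        case False
        obtain j where "i = Suc b + j" "j \<in> S" "S \<in> \<sigma>" using False A(3)[OF i(1)] by auto
        moreover from this have "j \<in> S'" "S' \<in> \<sigma>" using False upper(3)[OF i(2)] by auto
        ultimately show ?thesis using NC_same_block[OF \<sigma>, of S S' j] by simp
      qed
      then show ?thesis using A upper by simp
    qed
  qed
next
  fix A B w x y z
  assume AB: "A \<in> glue b \<rho> \<sigma>" "B \<in> glue b \<rho> \<sigma>" and lt: "w < x" "x < y" "y < z"
    and i: "w \<in> A" "x \<in> B" "y \<in> A" "z \<in> B"
  show "A = B"
    using \<rho> \<sigma> AB(1)
  proof (cases rule: glue_cases)
    case A: (lower R)
    show ?thesis using \<rho> \<sigma> AB(2)
    proof (cases rule: glue_cases)
      case (lower R')
      then obtain w' x' y' z' where "w = Suc w'" "x = Suc x'" "y = Suc y'" "z = Suc z'"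
        "w' \<in> R" "x' \<in> R'" "y' \<in> R" "z' \<in> R'" using A(2) i by auto
      then show ?thesis using A lower lt NC_crossing[OF \<rho>, of R R' w' x' y' z'] by auto
    next
      case (upper S)
      then show ?thesis using A(3)[OF i(1)] A(3)[OF i(3)] upper(3)[OF i(2)] lt by auto
    qed
  next
    case A: (upper S)
    show ?thesis using \<rho> \<sigma> AB(2)
    proof (cases rule: glue_cases)
      case (lower R')
      then show ?thesis using A(3)[OF i(3)] lower(3)[OF i(2)] lower(3)[OF i(4)] lt by auto
    next
      case (upper S')
      have w: "1 \<le> w" using A(3)[OF i(1)] by auto
      obtain x' z' where xz: "x = Suc b + x'" "z = Suc b + z'" "x' \<in> S'" "z' \<in> S'" "S' \<in> \<sigma>" "1 \<le> x'"
        using upper(3)[OF i(2)] upper(3)[OF i(4)] w lt by auto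
      obtain y' where y: "y = Suc b + y'" "y' \<in> S" "S \<in> \<sigma>"
        using A(3)[OF i(3)] w lt by auto
      have "S = S'"
      proof (cases "S = blk 1 \<sigma>")
        case True
        with y have "1 \<in> S" using blk_memD(2)[OF \<sigma>] by blast
        then show ?thesis
          \<comment> \<open>The added point is replaced by the first point of \<open>\<sigma>\<close>.\<close>
          using NC_crossing[OF \<sigma>, of S S' 1 x' y' z'] NC_same_block[OF \<sigma>, of S S' 1] xz y lt
          by (cases "x' = 1") auto
      next
        case False
        then obtain w' where "w = Suc b + w'" "w' \<in> S" using A(3)[OF i(1)] by auto
        then show ?thesis using NC_crossing[OF \<sigma>, of S S' w' x' y' z'] xz y lt by auto
      qed
      then show ?thesis using A upper by simp
    qed
  qed
qed

text \<open>
  As before, but now the added point \<open>1\<close> belongs to the block of the last point of \<open>\<rho>\<close>.  In a crossing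
  that uses \<open>1\<close>, that last point takes its place at the other end.
\<close>

lemma coglue_NC:
  assumes \<rho>: "\<rho> \<in> NC b" and \<sigma>: "\<sigma> \<in> NC m"
  shows "coglue b \<rho> \<sigma> \<in> NC (Suc (b + m))"
proof (rule NC_I)
  show "1 \<le> i \<and> i \<le> Suc (b + m)" if "A \<in> coglue b \<rho> \<sigma>" "i \<in> A" for A i
    using \<rho> \<sigma> that(1)
  proof (cases rule: coglue_cases)
    case (upper R)
    then show ?thesis using that(2) by fastforce
  next
    case (lower S)
    show ?thesis using lower(3)[OF that(2)] by auto
  qed
next
  fix i :: nat
  assume i: "1 \<le> i" "i \<le> Suc (b + m)"
  consider "i = 1" | "2 \<le> i" "i \<le> Suc b" | "Suc b < i" using i by linarith
  then show "\<exists>A\<in>coglue b \<rho> \<sigma>. i \<in> A"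
  proof cases
    case 1
    then show ?thesis by (auto simp: coglue_def)
  next
    case 2
    then have "1 \<le> i - 1" "i - 1 \<le> b" by auto
    from blk_in[OF \<rho> this] 2 have "blk (i - 1) \<rho> \<in> \<rho>" "i \<in> Suc ` blk (i - 1) \<rho>"
      by (auto intro!: image_eqI[of i Suc "i - 1"])
    then show ?thesis using coglue_I(1,3)[where b = b and \<rho> = \<rho>]
      by (cases "blk (i - 1) \<rho> = blk b \<rho>") (metis insertI2)+
  next
    case 3
    then have j: "1 \<le> i - Suc b" "i - Suc b \<le> m" using i by auto
    from blk_in[OF \<sigma> j] 3 have *: "i \<in> shift (Suc b) (blk (i - Suc b) \<sigma>)" "blk (i - Suc b) \<sigma> \<in> \<sigma>"
      by (auto intro!: image_eqI[of i _ "i - Suc b"])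
    then show ?thesis using coglue_I(2) by (metis (no_types))
  qed
next
  show "{} \<notin> coglue b \<rho> \<sigma>"
    using NC_D(2)[OF \<rho>] NC_D(2)[OF \<sigma>] by (auto simp: coglue_def)
next
  fix A B i
  assume AB: "A \<in> coglue b \<rho> \<sigma>" "B \<in> coglue b \<rho> \<sigma>" and i: "i \<in> A" "i \<in> B"
  show "A = B"
    using \<rho> \<sigma> AB(1)
  proof (cases rule: coglue_cases)
    case A: (upper R)
    show ?thesis using \<rho> \<sigma> AB(2)
    proof (cases rule: coglue_cases)
      case (upper R')
      from i obtain j where "j \<in> R" "j \<in> R'" using A(2) upper(2) by auto
      then show ?thesis using A upper NC_same_block[OF \<sigma>, of R R' j] by simp
    next
      case (lower S)
      then show ?thesis using A(3)[OF i(1)] lower(3)[OF i(2)] by auto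
    qed
  next
    case A: (lower S)
    show ?thesis using \<rho> \<sigma> AB(2)
    proof (cases rule: coglue_cases)
      case (upper R')
      then show ?thesis using A(3)[OF i(1)] upper(3)[OF i(2)] by auto
    next
      case (lower S')
      have "S = S'"
      proof (cases "i = 1")
        case True
        then have "S = blk b \<rho>" "S' = blk b \<rho>" using A(3)[OF i(1)] lower(3)[OF i(2)] by auto
        then show ?thesis by simp
      next
        case False
        obtain j where "i = Suc j" "j \<in> S" "S \<in> \<rho>" using False A(3)[OF i(1)] by auto
        moreover from this have "j \<in> S'" "S' \<in> \<rho>" using False lower(3)[OF i(2)] by auto
        ultimately show ?thesis using NC_same_block[OF \<rho>, of S S' j] by simp
      qed
      then show ?thesis using A lower by simp
    qed
  qed
next
  fix A B w x y z
  assume AB: "A \<in> coglue b \<rho> \<sigma>" "B \<in> coglue b \<rho> \<sigma>" and lt: "w < x" "x < y" "y < z"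
    and i: "w \<in> A" "x \<in> B" "y \<in> A" "z \<in> B"
  show "A = B"
    using \<rho> \<sigma> AB(1)
  proof (cases rule: coglue_cases)
    case A: (upper R)
    show ?thesis using \<rho> \<sigma> AB(2)
    proof (cases rule: coglue_cases)
      case (upper R')
      then obtain w' x' y' z' where "w = Suc b + w'" "x = Suc b + x'" "y = Suc b + y'" "z = Suc b + z'"
        "w' \<in> R" "x' \<in> R'" "y' \<in> R" "z' \<in> R'" using A(2) i by auto
      then show ?thesis using A upper lt NC_crossing[OF \<sigma>, of R R' w' x' y' z'] by auto
    next
      case (lower S)
      then show ?thesis using A(3)[OF i(1)] A(3)[OF i(3)] lower(3)[OF i(2)] lt by auto
    qed
  next
    case A: (lower S)
    show ?thesis using \<rho> \<sigma> AB(2)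
    proof (cases rule: coglue_cases)
      case (upper R')
      then show ?thesis using A(3)[OF i(3)] upper(3)[OF i(2)] upper(3)[OF i(4)] lt by auto
    next
      case (lower S')
      have w: "1 \<le> w" using A(3)[OF i(1)] by auto
      obtain x' z' where xz: "x = Suc x'" "z = Suc z'" "x' \<in> S'" "z' \<in> S'" "S' \<in> \<rho>" "z' \<le> b"
        using lower(3)[OF i(2)] lower(3)[OF i(4)] w lt by auto
      obtain y' where y: "y = Suc y'" "y' \<in> S" "S \<in> \<rho>"
        using A(3)[OF i(3)] w lt by auto
      have "S = S'"
      proof (cases "S = blk b \<rho>")
        case True
        with y have "b \<in> S" using blk_memD(2)[OF \<rho>] by blast
        then show ?thesis
          \<comment> \<open>The last point \<open>b\<close> of \<open>\<rho>\<close> gives the crossing \<open>x' < y' < z' < b\<close> with the roles of the blocks exchanged.\<close>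
          using NC_crossing[OF \<rho>, of S' S x' y' z' b] NC_same_block[OF \<rho>, of S S' b] xz y lt
          by (cases "z' = b") auto
      next
        case False
        then obtain w' where "w = Suc w'" "w' \<in> S" using A(3)[OF i(1)] by auto
        then show ?thesis using NC_crossing[OF \<rho>, of S S' w' x' y' z'] xz y lt by auto
      qed
      then show ?thesis using A lower by simp
    qed
  qed
qed

lemma NC_subset_eq:
  assumes \<pi>: "\<pi> \<in> NC n" and \<sigma>: "\<sigma> \<in> NC n" and sub: "\<pi> \<subseteq> \<sigma>"
  shows "\<pi> = \<sigma>"
proof
  show "\<sigma> \<subseteq> \<pi>"
  proof
    fix B assume B: "B \<in> \<sigma>"
    then obtain i where i: "i \<in> B" using NC_block(3)[OF \<sigma>] by blast
    then have "i \<in> \<Union>\<pi>" using NC_elem[OF \<sigma> B] by (simp add: NC_D[OF \<pi>])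
    then obtain A where A: "A \<in> \<pi>" "i \<in> A" by blast
    then have "A = B" using NC_same_block[OF \<sigma>, of A B i] B i sub by blast
    then show "B \<in> \<pi>" using A by simp
  qed
qed (rule sub)

text \<open>
  Restricting to an interval and moving it to \<open>{1..m}\<close> recovers the two parts of a glued partition.
\<close>

definition restrict :: "nat \<Rightarrow> nat \<Rightarrow> nat set set \<Rightarrow> nat set set" where
  "restrict a m \<pi> = (\<lambda>X. {j \<in> {1..m}. a + j \<in> X}) ` \<pi> - {{}}"

lemma restrict_NC:
  assumes \<pi>: "\<pi> \<in> NC n" and "a + m \<le> n"
  shows "restrict a m \<pi> \<in> NC m"
proof (rule NC_I)
  fix i assume i: "1 \<le> i" "i \<le> m"
  from blk_in[OF \<pi>, of "a + i"] i assms(2)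
  show "\<exists>A\<in>restrict a m \<pi>. i \<in> A"
    unfolding restrict_def by (intro bexI[of _ "{j \<in> {1..m}. a + j \<in> blk (a + i) \<pi>}"]) auto
next
  fix A B i assume "A \<in> restrict a m \<pi>" "B \<in> restrict a m \<pi>" "i \<in> A" "i \<in> B"
  then show "A = B"
    using NC_same_block[OF \<pi>, of _ _ "a + i"] by (fastforce simp: restrict_def)
next
  fix A B w x y z
  assume AB: "A \<in> restrict a m \<pi>" "B \<in> restrict a m \<pi>" and lt: "w < x" "x < y" "y < z"
    and i: "w \<in> A" "x \<in> B" "y \<in> A" "z \<in> B"
  from AB obtain X X' where X: "X \<in> \<pi>" "X' \<in> \<pi>"
    "A = {j \<in> {1..m}. a + j \<in> X}" "B = {j \<in> {1..m}. a + j \<in> X'}" by (auto simp: restrict_def)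
  then have "X = X'"
    using NC_crossing[OF \<pi>, of X X' "a + w" "a + x" "a + y" "a + z"] i lt by auto
  then show "A = B" using X by simp
qed (auto simp: restrict_def)

lemma blk1_glue:
  assumes \<rho>: "\<rho> \<in> NC b" and \<sigma>: "\<sigma> \<in> NC m"
  shows "blk 1 (glue b \<rho> \<sigma>) = insert 1 (shift (Suc b) (blk 1 \<sigma>))"
  by (rule blk_eq[OF glue_NC[OF \<rho> \<sigma>]]) (auto simp: glue_def)

text \<open>
  The gap ends just before the second smallest element of the block of \<open>1\<close>, or at \<open>k + 1\<close> if there is none, so
  the partition determines its length.
\<close>

lemma glue_inj_gap:
  assumes "\<rho> \<in> NC b" "\<sigma> \<in> NC (k - b)" "\<rho>' \<in> NC b'" "\<sigma>' \<in> NC (k - b')"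
    and "b \<le> k" "b' \<le> k" and eq: "glue b \<rho> \<sigma> = glue b' \<rho>' \<sigma>'"
  shows "b' \<le> b"
proof (rule ccontr)
  assume "\<not> b' \<le> b"
  then have "1 \<in> blk 1 \<sigma>" using assms by (intro blk_in(2)[of _ "k - b"]) auto
  moreover have "insert 1 (shift (Suc b) (blk 1 \<sigma>)) = insert 1 (shift (Suc b') (blk 1 \<sigma>'))"
    using eq blk1_glue assms(1-4) by metis
  ultimately have "Suc b + 1 \<in> insert 1 (shift (Suc b') (blk 1 \<sigma>'))" by blast
  then obtain x where "x \<in> blk 1 \<sigma>'" "Suc b + 1 = Suc b' + x" by auto
  then show False using \<open>\<not> b' \<le> b\<close> blk_memD(3)[OF assms(4)] by fastforce
qed

lemma glue_inj_aux:
  assumes \<rho>: "\<rho> \<in> NC b" and \<sigma>: "\<sigma> \<in> NC m" and \<rho>': "\<rho>' \<in> NC b" and \<sigma>': "\<sigma>' \<in> NC m"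
    and eq: "glue b \<rho> \<sigma> = glue b \<rho>' \<sigma>'"
  shows "\<rho> \<subseteq> \<rho>'" "\<sigma> \<subseteq> \<sigma>'"
proof -
  have S: "inj Suc" by simp
  have inj: "inj ((+) (Suc b))" by simp
  show "\<rho> \<subseteq> \<rho>'"
  proof
    fix X assume X: "X \<in> \<rho>"
    then obtain i where i: "i \<in> X" "1 \<le> i" "i \<le> b" using NC_block(3)[OF \<rho>] NC_elem[OF \<rho>] by blast
    have "Suc ` X \<in> glue b \<rho>' \<sigma>'" using X eq[symmetric] by (auto simp: glue_def)
    with \<rho>' \<sigma>' show "X \<in> \<rho>'"
    proof (cases rule: glue_cases)
      case (lower R)
      then show ?thesis using inj_image_eq_iff[OF S] by simp
    next
      case (upper Y)
      have "Suc i \<in> Suc ` X" using i by simp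
      from upper(3)[OF this] show ?thesis using i by auto
    qed
  qed
  have blks: "blk 1 \<sigma> = blk 1 \<sigma>'"
  proof -
    have *: "insert 1 (shift (Suc b) (blk 1 \<sigma>)) = insert 1 (shift (Suc b) (blk 1 \<sigma>'))"
      using eq blk1_glue[OF \<rho> \<sigma>] blk1_glue[OF \<rho>' \<sigma>'] by simp
    have "1 \<notin> shift (Suc b) (blk 1 \<sigma>)" "1 \<notin> shift (Suc b) (blk 1 \<sigma>')"
      using blk_memD(3)[OF \<sigma>] blk_memD(3)[OF \<sigma>'] by fastforce+
    with * have "shift (Suc b) (blk 1 \<sigma>) = shift (Suc b) (blk 1 \<sigma>')" using insert_ident by metis
    then show ?thesis using inj_image_eq_iff[OF inj] by metis
  qed
  show "\<sigma> \<subseteq> \<sigma>'"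
  proof
    fix X assume X: "X \<in> \<sigma>"
    then obtain i where i: "i \<in> X" "1 \<le> i" using NC_block(3)[OF \<sigma>] NC_elem[OF \<sigma>] by blast
    show "X \<in> \<sigma>'"
    proof (cases "X = blk 1 \<sigma>")
      case True
      then show ?thesis using i blks blk_memD(1)[OF \<sigma>', of i 1] by simp
    next
      case False
      then have "shift (Suc b) X \<in> glue b \<rho>' \<sigma>'" using X eq[symmetric] by (auto simp: glue_def)
      with \<rho>' \<sigma>' show "X \<in> \<sigma>'"
      proof (cases rule: glue_cases)
        case (lower R)
        have "Suc b + i \<in> shift (Suc b) X" using i by simp
        from lower(3)[OF this] show ?thesis using i by auto
      next
        case (upper Y)
        have "1 \<notin> shift (Suc b) X" using NC_elem[OF \<sigma> X] by fastforce
        then have "Y \<noteq> blk 1 \<sigma>'" using upper(2) by (auto split: if_splits)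
        then show ?thesis using upper inj_image_eq_iff[OF inj] by simp
      qed
    qed
  qed
qed

text \<open>
  The gap ends at the second smallest element \<open>b + 2\<close> of the block of \<open>1\<close>.  No other block meets both
  sides of it, since it would cross the block of \<open>1\<close>.
\<close>

lemma glue_surj:
  assumes \<pi>: "\<pi> \<in> NC (Suc k)"
  obtains b \<rho> \<sigma> where "b \<le> k" "\<rho> \<in> NC b" "\<sigma> \<in> NC (k - b)" "\<pi> = glue b \<rho> \<sigma>"
proof -
  define A where "A = blk 1 \<pi>"
  have A: "A \<in> \<pi>" "1 \<in> A" using blk_in[OF \<pi>, of 1] by (simp_all add: A_def)
  \<comment> \<open>For the block \<open>{1}\<close> the gap is everything else, \<open>b = k\<close>.\<close>
  have "\<exists>b\<le>k. (\<forall>i\<in>A. i = 1 \<or> Suc b < i) \<and> (b < k \<longrightarrow> b + 2 \<in> A)"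
  proof (cases "A = {1}")
    case True
    then show ?thesis by (intro exI[of _ k]) auto
  next
    case False
    define s where "s = Min (A - {1})"
    have fin: "finite (A - {1})" "A - {1} \<noteq> {}"
      using NC_block(2)[OF \<pi> A(1)] False A(2) by auto
    have s: "s \<in> A" "s \<noteq> 1" using Min_in[OF fin] by (auto simp: s_def)
    have "2 \<le> s" "s \<le> Suc k" using NC_elem[OF \<pi> A(1) s(1)] s(2) by auto
    then obtain t where t: "s = t + 2" "t \<le> k" by (metis Suc_le_mono add_2_eq_Suc' add.commute le_Suc_ex Suc_leD)
    have "s \<le> i" if "i \<in> A" "i \<noteq> 1" for i
      using Min_le[OF fin(1), of i] that by (simp add: s_def)
    then have "\<forall>i\<in>A. i = 1 \<or> Suc t < i" using t by fastforce
    then show ?thesis using s t by blast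
  qed
  then obtain b where b: "b \<le> k" "\<And>i. i \<in> A \<Longrightarrow> i = 1 \<or> Suc b < i" "b < k \<Longrightarrow> b + 2 \<in> A" by blast
  have side: "(\<forall>i\<in>X. 1 < i \<and> i \<le> Suc b) \<or> (\<forall>i\<in>X. Suc b < i \<and> i \<le> Suc k)"
    if X: "X \<in> \<pi>" "X \<noteq> A" for X
  proof (rule ccontr)
    assume "\<not> ?thesis"
    moreover have "1 < i \<and> i \<le> Suc k" if "i \<in> X" for i
    proof -
      have "i \<noteq> 1" using NC_same_block[OF \<pi> X(1) A(1), of i] A(2) X(2) that by auto
      then show ?thesis using NC_elem[OF \<pi> X(1) that] by auto
    qed
    ultimately obtain i j where ij: "i \<in> X" "j \<in> X" "1 < i" "i \<le> Suc b" "Suc b < j" "j \<le> Suc k"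
      by (meson not_le)
    then have "b + 2 \<in> A" using b(3) by simp
    moreover have "j \<noteq> b + 2"
      using NC_same_block[OF \<pi> X(1) A(1), of j] X(2) ij \<open>b + 2 \<in> A\<close> by auto
    ultimately show False
      using NC_crossing[OF \<pi> A(1) X(1), of 1 i "b + 2" j] A(2) ij X(2) by auto
  qed
  define \<rho> where "\<rho> = restrict 1 b \<pi>"
  define \<sigma> where "\<sigma> = restrict (Suc b) (k - b) \<pi>"
  have \<rho>: "\<rho> \<in> NC b" using restrict_NC[OF \<pi>] b(1) by (simp add: \<rho>_def)
  have \<sigma>: "\<sigma> \<in> NC (k - b)" using restrict_NC[OF \<pi>] b(1) by (simp add: \<sigma>_def)
  let ?Y = "{j \<in> {1..k - b}. Suc b + j \<in> A}"
  have blk: "blk 1 \<sigma> = ?Y"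
  proof (cases "b < k")
    case True
    then have "1 \<in> ?Y" using b(3) by auto
    moreover from this have "?Y \<in> \<sigma>" unfolding \<sigma>_def restrict_def using A(1) by blast
    ultimately show ?thesis using blk_eq[OF \<sigma>] by simp
  next
    case False
    then show ?thesis using blk_outside[OF \<sigma>, of 1] by auto
  qed
  have "glue b \<rho> \<sigma> \<subseteq> \<pi>"
  proof
    fix Z assume "Z \<in> glue b \<rho> \<sigma>"
    then consider R where "R \<in> \<rho>" "Z = Suc ` R"
      | S where "S \<in> \<sigma>" "S \<noteq> ?Y" "Z = shift (Suc b) S"
      | "Z = insert 1 (shift (Suc b) ?Y)"
      unfolding glue_def blk by blast
    then show "Z \<in> \<pi>"
    proof cases
      case 1
      then obtain X where X: "X \<in> \<pi>" "R = {j \<in> {1..b}. 1 + j \<in> X}" "R \<noteq> {}"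
        by (auto simp: \<rho>_def restrict_def)
      then obtain j where j: "j \<ge> 1" "j \<le> b" "1 + j \<in> X" by auto
      then have "X \<noteq> A" using b(2) by fastforce
      then have "\<forall>i\<in>X. 1 < i \<and> i \<le> Suc b" using side[OF X(1)] j by fastforce
      then have "i \<in> Suc ` R" if "i \<in> X" for i
        unfolding X(2) using that by (intro image_eqI[of i Suc "i - 1"]) auto
      then have "Suc ` R = X" using X(2) by auto
      then show ?thesis using X(1) 1 by simp
    next
      case 2
      then obtain X where X: "X \<in> \<pi>" "S = {j \<in> {1..k-b}. Suc b + j \<in> X}" "S \<noteq> {}"
        by (auto simp: \<sigma>_def restrict_def)
      then obtain j where j: "j \<ge> 1" "Suc b + j \<in> X" by auto
      have "X \<noteq> A" using 2 X(2) by blast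
      then have "\<forall>i\<in>X. Suc b < i \<and> i \<le> Suc k" using side[OF X(1)] j by fastforce
      then have "i \<in> shift (Suc b) S" if "i \<in> X" for i
        unfolding X(2) using b(1) that by (intro image_eqI[of i _ "i - Suc b"]) auto
      then have "shift (Suc b) S = X" using X(2) by auto
      then show ?thesis using X(1) 2 by simp
    next
      case 3
      have "A \<subseteq> insert 1 (shift (Suc b) ?Y)"
      proof
        fix i assume i: "i \<in> A"
        show "i \<in> insert 1 (shift (Suc b) ?Y)"
        proof (cases "i = 1")
          case False
          then have "Suc b < i" "i \<le> Suc k" using b(2)[OF i] NC_elem[OF \<pi> A(1) i] by auto
          then have "i - Suc b \<in> ?Y" "i = Suc b + (i - Suc b)" using i by auto
          then show ?thesis by blast
        qed simp
      qed
      then have "Z = A" using 3 A(2) by auto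
      then show ?thesis using A(1) by simp
    qed
  qed
  then have "glue b \<rho> \<sigma> = \<pi>"
    using NC_subset_eq[OF _ \<pi>] glue_NC[OF \<rho> \<sigma>] b(1) by simp
  then show thesis using that b(1) \<rho> \<sigma> by metis
qed

text \<open>
  This is the recursion of the Catalan numbers.
\<close>

lemma bij_betw_glue:
  "bij_betw (\<lambda>(b, \<rho>, \<sigma>). glue b \<rho> \<sigma>) (SIGMA b:{..k}. NC b \<times> NC (k - b)) (NC (Suc k))"
proof (rule bij_betw_imageI)
  show "inj_on (\<lambda>(b, \<rho>, \<sigma>). glue b \<rho> \<sigma>) (SIGMA b:{..k}. NC b \<times> NC (k - b))"
  proof (rule inj_onI)
    fix p q
    assume p: "p \<in> (SIGMA b:{..k}. NC b \<times> NC (k - b))" and q: "q \<in> (SIGMA b:{..k}. NC b \<times> NC (k - b))"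
      and pq: "(\<lambda>(b, \<rho>, \<sigma>). glue b \<rho> \<sigma>) p = (\<lambda>(b, \<rho>, \<sigma>). glue b \<rho> \<sigma>) q"
    obtain b \<rho> \<sigma> where P: "p = (b, \<rho>, \<sigma>)" by (rule prod_cases3)
    obtain b' \<rho>' \<sigma>' where Q: "q = (b', \<rho>', \<sigma>')" by (rule prod_cases3)
    from p q have *: "b \<le> k" "\<rho> \<in> NC b" "\<sigma> \<in> NC (k - b)" "b' \<le> k" "\<rho>' \<in> NC b'" "\<sigma>' \<in> NC (k - b')"
      by (simp_all add: P Q)
    have eq: "glue b \<rho> \<sigma> = glue b' \<rho>' \<sigma>'" using pq by (simp add: P Q)
    have b: "b = b'"
      using glue_inj_gap[OF *(2,3,5,6,1,4) eq] glue_inj_gap[OF *(5,6,2,3,4,1) eq[symmetric]] by simp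
    note ** = *(5,6)[folded b] and eq' = eq[folded b]
    have "\<rho> = \<rho>'" "\<sigma> = \<sigma>'"
      using glue_inj_aux[OF *(2,3) ** eq'] glue_inj_aux[OF ** *(2,3) eq'[symmetric]] by blast+
    with b show "p = q" by (simp add: P Q)
  qed
  show "(\<lambda>(b, \<rho>, \<sigma>). glue b \<rho> \<sigma>) ` (SIGMA b:{..k}. NC b \<times> NC (k - b)) = NC (Suc k)"
  proof
    have "glue b \<rho> \<sigma> \<in> NC (Suc k)" if "b \<le> k" "\<rho> \<in> NC b" "\<sigma> \<in> NC (k - b)" for b \<rho> \<sigma>
      using glue_NC[OF that(2,3)] that(1) by simp
    then show "(\<lambda>(b, \<rho>, \<sigma>). glue b \<rho> \<sigma>) ` (SIGMA b:{..k}. NC b \<times> NC (k - b)) \<subseteq> NC (Suc k)"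
      by auto
    show "NC (Suc k) \<subseteq> (\<lambda>(b, \<rho>, \<sigma>). glue b \<rho> \<sigma>) ` (SIGMA b:{..k}. NC b \<times> NC (k - b))"
    proof
      fix \<pi> assume "\<pi> \<in> NC (Suc k)"
      then obtain b \<rho> \<sigma> where *: "b \<le> k" "\<rho> \<in> NC b" "\<sigma> \<in> NC (k - b)" "\<pi> = glue b \<rho> \<sigma>"
        by (rule glue_surj)
      then show "\<pi> \<in> (\<lambda>(b, \<rho>, \<sigma>). glue b \<rho> \<sigma>) ` (SIGMA b:{..k}. NC b \<times> NC (k - b))"
        by (intro image_eqI[of _ _ "(b, \<rho>, \<sigma>)"]) auto
    qed
  qed
qed

lemma sum_NC_Suc:
  "(\<Sum>\<pi>\<in>NC (Suc k). F \<pi>) = (\<Sum>b\<le>k. \<Sum>\<rho>\<in>NC b. \<Sum>\<sigma>\<in>NC (k - b). F (glue b \<rho> \<sigma>))"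
proof -
  have "(\<Sum>\<pi>\<in>NC (Suc k). F \<pi>) = (\<Sum>(b, p)\<in>(SIGMA b:{..k}. NC b \<times> NC (k - b)). F (glue b (fst p) (snd p)))"
    by (subst sum.reindex_bij_betw[OF bij_betw_glue, symmetric]) (simp add: case_prod_unfold)
  also have "\<dots> = (\<Sum>b\<le>k. \<Sum>p\<in>NC b \<times> NC (k - b). F (glue b (fst p) (snd p)))"
    by (rule sum.Sigma[symmetric]) auto
  also have "\<dots> = (\<Sum>b\<le>k. \<Sum>\<rho>\<in>NC b. \<Sum>\<sigma>\<in>NC (k - b). F (glue b \<rho> \<sigma>))"
    by (simp add: sum.cartesian_product case_prod_unfold)
  finally show ?thesis .
qed

section \<open>Kreweras complements of glued partitions\<close>

lemma cyc_succ_next: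
  assumes "finite A" "j \<in> A" "i < j"
  shows "cyc_succ A i = Min {j \<in> A. i < j}" "cyc_succ A i \<in> A" "i < cyc_succ A i" "cyc_succ A i \<le> j"
proof -
  show eq: "cyc_succ A i = Min {j \<in> A. i < j}" using assms by (auto simp: cyc_succ_def)
  have "Min {j \<in> A. i < j} \<in> {j \<in> A. i < j}" using assms by (intro Min_in) auto
  then show "cyc_succ A i \<in> A" "i < cyc_succ A i" by (simp_all add: eq)
  show "cyc_succ A i \<le> j" unfolding eq using assms by (intro Min_le) auto
qed

lemma cyc_succ_last: "\<not> (\<exists>j\<in>A. i < j) \<Longrightarrow> cyc_succ A i = Min A"
  by (simp add: cyc_succ_def)

lemma cyc_succ_in:
  assumes "finite A" "i \<in> A"
  shows "cyc_succ A i \<in> A"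
proof (cases "\<exists>j\<in>A. i < j")
  case True
  then show ?thesis using cyc_succ_next(2)[OF assms(1)] by blast
next
  case False
  have "Min A \<in> A" using assms by (intro Min_in) auto
  then show ?thesis by (simp only: cyc_succ_last[OF False])
qed

lemma cyc_succ_image:
  assumes f: "strict_mono f" and A: "finite A" "A \<noteq> {}"
  shows "cyc_succ (f ` A) (f i) = f (cyc_succ A i)"
proof (cases "\<exists>j\<in>A. i < j")
  case True
  then obtain j where j: "j \<in> A" "i < j" by blast
  then have fj: "f j \<in> f ` A" "f i < f j" using strict_mono_less[OF f] by auto
  have "{j \<in> f ` A. f i < j} = f ` {j \<in> A. i < j}"
    using strict_mono_less[OF f] by auto
  moreover have "f (Min {j \<in> A. i < j}) = Min (f ` {j \<in> A. i < j})"
    using A j by (intro mono_Min_commute strict_mono_mono[OF f]) auto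
  ultimately show ?thesis
    using cyc_succ_next(1)[OF A(1) j] cyc_succ_next(1)[OF finite_imageI[OF A(1)] fj] by simp
next
  case False
  then have "\<not> (\<exists>j\<in>f ` A. f i < j)" by (simp add: strict_mono_less[OF f])
  then show ?thesis
    using cyc_succ_last[OF False] cyc_succ_last mono_Min_commute[OF strict_mono_mono[OF f] A] by simp
qed

lemma cyc_succ_insert_1:
  assumes B: "finite B" "\<And>j. j \<in> B \<Longrightarrow> 1 < j"
  shows "1 < i \<Longrightarrow> cyc_succ (insert 1 B) i = (if \<exists>j\<in>B. i < j then cyc_succ B i else 1)"
    and "cyc_succ (insert 1 B) 1 = (if B = {} then 1 else Min B)"
proof -
  assume i: "1 < i"
  then have "{j \<in> insert 1 B. i < j} = {j \<in> B. i < j}" by auto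
  moreover have "Min (insert 1 B) = 1"
    using B by (intro Min_eqI) (auto simp: less_imp_le)
  ultimately show "cyc_succ (insert 1 B) i = (if \<exists>j\<in>B. i < j then cyc_succ B i else 1)"
    using i by (auto simp: cyc_succ_def)
next
  have set: "{j \<in> insert 1 B. 1 < j} = B" using B(2) by blast
  have ex: "(\<exists>j\<in>insert 1 B. 1 < j) \<longleftrightarrow> B \<noteq> {}" using B(2) by blast
  show "cyc_succ (insert 1 B) 1 = (if B = {} then 1 else Min B)"
    unfolding cyc_succ_def set ex by (cases "B = {}") simp_all
qed

lemma block_perm_in:
  assumes "\<pi> \<in> NC n" "A \<in> \<pi>" "i \<in> A"
  shows "block_perm \<pi> i = cyc_succ A i"
proof -
  have "(THE A. A \<in> \<pi> \<and> i \<in> A) = A"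
  proof (rule the_equality)
    show "A \<in> \<pi> \<and> i \<in> A" using assms by simp
    show "B = A" if "B \<in> \<pi> \<and> i \<in> B" for B
      using NC_same_block[OF assms(1) _ assms(2) _ assms(3)] that by metis
  qed
  moreover have "i \<in> \<Union>\<pi>" using assms(2,3) by (rule UnionI)
  ultimately show ?thesis by (simp only: block_perm_def cyc_succ_def Let_def if_True)
qed

lemma block_perm_mem:
  assumes "\<pi> \<in> NC n" "A \<in> \<pi>" "i \<in> A"
  shows "block_perm \<pi> i \<in> A"
  using block_perm_in[OF assms] cyc_succ_in[OF NC_block(2)[OF assms(1,2)] assms(3)] by simp

lemma block_perm_blk:
  assumes "\<pi> \<in> NC n" "1 \<le> i" "i \<le> n"
  shows "block_perm \<pi> i = cyc_succ (blk i \<pi>) i"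
  using block_perm_in[OF assms(1) blk_in[OF assms]] .

lemma block_perm_out:
  assumes "\<pi> \<in> NC n" "\<not> (1 \<le> i \<and> i \<le> n)"
  shows "block_perm \<pi> i = i"
proof -
  have "i \<notin> \<Union>\<pi>" using NC_D(1)[OF assms(1)] assms(2) by simp
  then show ?thesis unfolding block_perm_def by (rule if_not_P)
qed

lemma block_perm_range:
  assumes "\<pi> \<in> NC n" "1 \<le> i" "i \<le> n"
  shows "1 \<le> block_perm \<pi> i" "block_perm \<pi> i \<le> n"
  using NC_elem[OF assms(1) blk_in(1)[OF assms] block_perm_mem[OF assms(1) blk_in[OF assms]]] by simp_all

lemma block_perm_top:
  "block_perm {{1..n}} i = (if 1 \<le> i \<and> i < n then Suc i else if 1 \<le> i \<and> i = n then 1 else i)"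
proof (cases "1 \<le> i \<and> i \<le> n")
  case True
  have the: "(THE A. A \<in> {{1..n}} \<and> i \<in> A) = {1..n}" by (rule the_equality) (use True in auto)
  have "Min {1..n} = 1" using True by (intro Min_eqI) auto
  moreover have "Min {j \<in> {1..n}. i < j} = Suc i" if "i < n"
    using True that by (intro Min_eqI) auto
  moreover have "(\<exists>j\<in>{1..n}. i < j) \<longleftrightarrow> i < n" using True by auto
  ultimately show ?thesis using True unfolding block_perm_def the Let_def by auto
next
  case False
  then show ?thesis by (auto simp: block_perm_def)
qed

lemma inj_block_perm:
  assumes \<pi>: "\<pi> \<in> NC n"
  shows "inj (block_perm \<pi>)"
proof -
  have no: False if eq: "block_perm \<pi> i = block_perm \<pi> j" and "i < j" for i j
  proof (cases "1 \<le> i \<and> i \<le> n")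
    case False
    then have i: "block_perm \<pi> i = i" using block_perm_out[OF \<pi>] by blast
    then show False
      using eq \<open>i < j\<close> False block_perm_out[OF \<pi>, of j] block_perm_range[OF \<pi>, of j] by (cases "1 \<le> j \<and> j \<le> n") auto
  next
    case True
    then have i: "1 \<le> i" "i \<le> n" by auto
    note A = blk_in[OF \<pi> i]
    have j: "1 \<le> j" "j \<le> n"
      using block_perm_out[OF \<pi>, of j] eq block_perm_range[OF \<pi> i] \<open>i < j\<close> by auto
    note B = blk_in[OF \<pi> j]
    have "blk i \<pi> = blk j \<pi>"
      using NC_same_block[OF \<pi> A(1) B(1)] block_perm_mem[OF \<pi> A] block_perm_mem[OF \<pi> B] eq by metis
    then have j': "j \<in> blk i \<pi>" and eq': "cyc_succ (blk i \<pi>) i = cyc_succ (blk i \<pi>) j"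
      using B block_perm_blk[OF \<pi> i] block_perm_blk[OF \<pi> j] eq by simp_all
    have fin: "finite (blk i \<pi>)" using NC_block(2)[OF \<pi> A(1)] .
    have *: "i < cyc_succ (blk i \<pi>) i" "cyc_succ (blk i \<pi>) i \<le> j" using cyc_succ_next(3,4)[OF fin j' \<open>i < j\<close>] by auto
    show False
    proof (cases "\<exists>l\<in>blk i \<pi>. j < l")
      case True
      then obtain l where "l \<in> blk i \<pi>" "j < l" by blast
      from cyc_succ_next(3)[OF fin this] show False using * eq' by simp
    next
      case False
      then have "cyc_succ (blk i \<pi>) j \<le> i" using cyc_succ_last[of "blk i \<pi>" j] Min_le[OF fin A(2)] by simp
      then show False using * eq' by simp
    qed
  qed
  show ?thesis
    by (rule injI) (use no in \<open>metis linorder_neqE_nat\<close>)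
qed

text \<open>
  A block is the orbit of its minimum, so a set that contains the minimum and is closed under the
  permutation contains the whole block.
\<close>

lemma block_perm_orbit:
  assumes \<pi>: "\<pi> \<in> NC n" and A: "A \<in> \<pi>" and S: "Min A \<in> S" "\<And>i. i \<in> S \<Longrightarrow> block_perm \<pi> i \<in> S"
  shows "A \<subseteq> S"
proof
  fix j assume "j \<in> A"
  then show "j \<in> S"
  proof (induction j rule: less_induct)
    case (less j)
    note fin = NC_block(2)[OF \<pi> A]
    show ?case
    proof (cases "{x \<in> A. x < j} = {}")
      case True
      then have "Min A = j" using less.prems fin by (intro Min_eqI) (auto simp: not_less)
      then show ?thesis using S by simp
    next
      case False
      define p where "p = Max {x \<in> A. x < j}"
      have p: "p \<in> A" "p < j" using Max_in[of "{x \<in> A. x < j}"] False fin by (auto simp: p_def)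
      have "Min {x \<in> A. p < x} = j"
      proof (rule Min_eqI)
        fix y assume y: "y \<in> {x \<in> A. p < x}"
        show "j \<le> y"
        proof (rule ccontr)
          assume "\<not> j \<le> y"
          then have "y \<le> p" unfolding p_def using y fin by (intro Max_ge) auto
          then show False using y by simp
        qed
      qed (use fin p less.prems in auto)
      then have "block_perm \<pi> p = j"
        using block_perm_in[OF \<pi> A p(1)] p less.prems by (auto simp: cyc_succ_def)
      then show ?thesis using S(2) less.IH[OF p(2,1)] by blast
    qed
  qed
qed

text \<open>
  By the previous lemma each block of \<open>\<pi>\<close> is contained in a block of \<open>\<sigma>\<close> and conversely; disjointness
  then forces equality.  This is the uniqueness in the definition of the Kreweras complement.
\<close>

lemma block_perm_inject:
  assumes \<pi>: "\<pi> \<in> NC n" and \<sigma>: "\<sigma> \<in> NC n" and eq: "block_perm \<pi> = block_perm \<sigma>"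
  shows "\<pi> = \<sigma>"
proof -
  have sub: "\<exists>B\<in>\<sigma>. A \<subseteq> B" if \<pi>: "\<pi> \<in> NC n" and \<sigma>: "\<sigma> \<in> NC n" and eq: "block_perm \<pi> = block_perm \<sigma>" and A: "A \<in> \<pi>"
    for \<pi> \<sigma> A
  proof -
    have M: "Min A \<in> A" using NC_block[OF \<pi> A] by simp
    then have i: "1 \<le> Min A" "Min A \<le> n" using NC_elem[OF \<pi> A] by auto
    note B = blk_in[OF \<sigma> i]
    have "A \<subseteq> blk (Min A) \<sigma>"
      by (rule block_perm_orbit[OF \<pi> A]) (use B block_perm_mem[OF \<sigma> B(1)] eq in auto)
    with B(1) show ?thesis by blast
  qed
  have "A \<in> \<sigma>" if A: "A \<in> \<pi>" for A
  proof -
    obtain B where B: "B \<in> \<sigma>" "A \<subseteq> B" using sub[OF \<pi> \<sigma> eq A] by blast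
    obtain A' where A': "A' \<in> \<pi>" "B \<subseteq> A'" using sub[OF \<sigma> \<pi> eq[symmetric] B(1)] by blast
    obtain i where "i \<in> A" using NC_block(3)[OF \<pi> A] by blast
    then have "A = A'" using NC_same_block[OF \<pi> A A'(1), of i] B A' by blast
    then show ?thesis using A' B by auto
  qed
  then show ?thesis using NC_subset_eq[OF \<pi> \<sigma>] by blast
qed

lemma strict_mono_shift: "strict_mono ((+) a :: nat \<Rightarrow> nat)"
  by (simp add: strict_mono_def)

lemma strict_mono_Suc': "strict_mono Suc"
  by (simp add: strict_mono_def)

context
  fixes b m \<rho> \<sigma>
  assumes \<rho>: "\<rho> \<in> NC b" and \<sigma>: "\<sigma> \<in> NC m"
begin

lemma block_perm_glue_lower:
  assumes i: "1 \<le> i" "i \<le> b"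
  shows "block_perm (glue b \<rho> \<sigma>) (Suc i) = Suc (block_perm \<rho> i)"
proof -
  note R = blk_in[OF \<rho> i]
  have "block_perm (glue b \<rho> \<sigma>) (Suc i) = cyc_succ (Suc ` blk i \<rho>) (Suc i)"
    by (rule block_perm_in[OF glue_NC[OF \<rho> \<sigma>]]) (use R in \<open>auto simp: glue_def\<close>)
  also have "\<dots> = Suc (cyc_succ (blk i \<rho>) i)"
    using NC_block[OF \<rho> R(1)] by (intro cyc_succ_image strict_mono_Suc') auto
  finally show ?thesis using block_perm_blk[OF \<rho> i] by simp
qed

lemma block_perm_glue_upper:
  assumes i: "1 \<le> i" "i \<le> m"
  shows "block_perm (glue b \<rho> \<sigma>) (Suc b + i) =
    (if block_perm \<sigma> i = 1 then 1 else Suc b + block_perm \<sigma> i)"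
proof -
  note S = blk_in[OF \<sigma> i]
  note fin = NC_block(2,3)[OF \<sigma> S(1)]
  have img: "cyc_succ (shift (Suc b) (blk i \<sigma>)) (Suc b + i) = Suc b + cyc_succ (blk i \<sigma>) i"
    by (rule cyc_succ_image[OF strict_mono_shift fin])
  have m: "1 \<le> m" using i by simp
  show ?thesis
  proof (cases "blk i \<sigma> = blk 1 \<sigma>")
    case False
    have "block_perm (glue b \<rho> \<sigma>) (Suc b + i) = cyc_succ (shift (Suc b) (blk i \<sigma>)) (Suc b + i)"
      by (rule block_perm_in[OF glue_NC[OF \<rho> \<sigma>]]) (use S False glue_I(2) in auto)
    moreover have "block_perm \<sigma> i \<noteq> 1"
      using False block_perm_mem[OF \<sigma> S] blk_eq[OF \<sigma> S(1), of 1] by auto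
    ultimately show ?thesis using img block_perm_blk[OF \<sigma> i] by simp
  next
    case True
    have 1: "1 \<in> blk i \<sigma>" using True blk_in(2)[OF \<sigma> _ m] by simp
    have "block_perm (glue b \<rho> \<sigma>) (Suc b + i) = cyc_succ (insert 1 (shift (Suc b) (blk i \<sigma>))) (Suc b + i)"
      by (rule block_perm_in[OF glue_NC[OF \<rho> \<sigma>]]) (use S glue_I(3) True in auto)
    also have "\<dots> = (if \<exists>j\<in>shift (Suc b) (blk i \<sigma>). Suc b + i < j then cyc_succ (shift (Suc b) (blk i \<sigma>)) (Suc b + i) else 1)"
      by (rule cyc_succ_insert_1) (use fin(1) NC_elem[OF \<sigma> S(1)] i in fastforce)+
    also have "(\<exists>j\<in>shift (Suc b) (blk i \<sigma>). Suc b + i < j) \<longleftrightarrow> (\<exists>j\<in>blk i \<sigma>. i < j)" by auto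
    finally have *: "block_perm (glue b \<rho> \<sigma>) (Suc b + i) = (if \<exists>j\<in>blk i \<sigma>. i < j then Suc b + cyc_succ (blk i \<sigma>) i else 1)"
      by (simp only: img)
    show ?thesis
    proof (cases "\<exists>j\<in>blk i \<sigma>. i < j")
      case True
      then have "cyc_succ (blk i \<sigma>) i > i" using cyc_succ_next(3)[OF fin(1)] by blast
      then show ?thesis using * True i block_perm_blk[OF \<sigma> i] by simp
    next
      case False
      have "Min (blk i \<sigma>) = 1"
        using fin 1 NC_elem[OF \<sigma> S(1)] by (intro Min_eqI) auto
      then have "block_perm \<sigma> i = 1" using block_perm_blk[OF \<sigma> i] cyc_succ_last[OF False] by simp
      then show ?thesis using * False by simp
    qed
  qed
qed

lemma block_perm_glue_1:
  "block_perm (glue b \<rho> \<sigma>) 1 = (if m = 0 then 1 else b + 2)"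
proof -
  have "block_perm (glue b \<rho> \<sigma>) 1 = cyc_succ (insert 1 (shift (Suc b) (blk 1 \<sigma>))) 1"
    by (rule block_perm_in[OF glue_NC[OF \<rho> \<sigma>] glue_I(3)]) simp
  also have "\<dots> = (if shift (Suc b) (blk 1 \<sigma>) = {} then 1 else Min (shift (Suc b) (blk 1 \<sigma>)))"
  proof (rule cyc_succ_insert_1(2))
    show "finite (shift (Suc b) (blk 1 \<sigma>))"
      using blk_empty_or_mem[OF \<sigma>, of 1] NC_block(2)[OF \<sigma>, of "blk 1 \<sigma>"] by auto
  qed (auto dest: blk_memD(3)[OF \<sigma>])
  also have "\<dots> = (if m = 0 then 1 else b + 2)"
  proof (cases "m = 0")
    case True
    then show ?thesis using blk_outside[OF \<sigma>, of 1] by simp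
  next
    case False
    then have m: "1 \<le> m" by simp
    note S = blk_in[OF \<sigma> le_refl m]
    have "Min (shift (Suc b) (blk 1 \<sigma>)) = b + 2"
    proof (rule Min_eqI)
      show "finite (shift (Suc b) (blk 1 \<sigma>))" using NC_block(2)[OF \<sigma> S(1)] by simp
      show "b + 2 \<in> shift (Suc b) (blk 1 \<sigma>)" using S(2) by (intro image_eqI[of _ _ 1]) auto
      fix y assume "y \<in> shift (Suc b) (blk 1 \<sigma>)"
      then show "b + 2 \<le> y" using blk_memD(3)[OF \<sigma>] by fastforce
    qed
    then show ?thesis using False S(2) by auto
  qed
  finally show ?thesis .
qed

lemma block_perm_coglue_upper:
  assumes i: "1 \<le> i" "i \<le> m"
  shows "block_perm (coglue b \<rho> \<sigma>) (Suc b + i) = Suc b + block_perm \<sigma> i"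
proof -
  note S = blk_in[OF \<sigma> i]
  have "block_perm (coglue b \<rho> \<sigma>) (Suc b + i) = cyc_succ (shift (Suc b) (blk i \<sigma>)) (Suc b + i)"
    by (rule block_perm_in[OF coglue_NC[OF \<rho> \<sigma>] coglue_I(2)]) (use S in auto)
  also have "\<dots> = Suc b + cyc_succ (blk i \<sigma>) i"
    using NC_block[OF \<sigma> S(1)] by (intro cyc_succ_image strict_mono_shift) auto
  finally show ?thesis using block_perm_blk[OF \<sigma> i] by simp
qed

lemma block_perm_coglue_lower:
  assumes i: "1 \<le> i" "i \<le> b"
  shows "block_perm (coglue b \<rho> \<sigma>) (Suc i) = (if i = b then 1 else Suc (block_perm \<rho> i))"
proof -
  note R = blk_in[OF \<rho> i]
  note fin = NC_block(2,3)[OF \<rho> R(1)]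
  have img: "cyc_succ (Suc ` blk i \<rho>) (Suc i) = Suc (cyc_succ (blk i \<rho>) i)"
    by (rule cyc_succ_image[OF strict_mono_Suc' fin])
  have b: "1 \<le> b" using i by simp
  show ?thesis
  proof (cases "blk i \<rho> = blk b \<rho>")
    case False
    have "block_perm (coglue b \<rho> \<sigma>) (Suc i) = cyc_succ (Suc ` blk i \<rho>) (Suc i)"
      by (rule block_perm_in[OF coglue_NC[OF \<rho> \<sigma>] coglue_I(1)]) (use R False in auto)
    then show ?thesis using img block_perm_blk[OF \<rho> i] False by auto
  next
    case True
    have bb: "b \<in> blk i \<rho>" using True blk_in(2)[OF \<rho> b] by simp
    have "block_perm (coglue b \<rho> \<sigma>) (Suc i) = cyc_succ (insert 1 (Suc ` blk i \<rho>)) (Suc i)"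
      by (rule block_perm_in[OF coglue_NC[OF \<rho> \<sigma>]]) (use R coglue_I(3) True in auto)
    also have "\<dots> = (if \<exists>j\<in>Suc ` blk i \<rho>. Suc i < j then cyc_succ (Suc ` blk i \<rho>) (Suc i) else 1)"
      by (rule cyc_succ_insert_1) (use fin(1) NC_elem[OF \<rho> R(1)] i in fastforce)+
    also have "(\<exists>j\<in>Suc ` blk i \<rho>. Suc i < j) \<longleftrightarrow> i \<noteq> b"
      using bb i(2) NC_elem[OF \<rho> R(1)] by (auto intro!: bexI[of _ b]) fastforce
    finally show ?thesis using img block_perm_blk[OF \<rho> i] by simp
  qed
qed

lemma block_perm_coglue_1:
  "block_perm (coglue b \<rho> \<sigma>) 1 = (if b = 0 then 1 else Suc (block_perm \<rho> b))"
proof -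
  have "block_perm (coglue b \<rho> \<sigma>) 1 = cyc_succ (insert 1 (Suc ` blk b \<rho>)) 1"
    by (rule block_perm_in[OF coglue_NC[OF \<rho> \<sigma>] coglue_I(3)]) simp
  also have "\<dots> = (if Suc ` blk b \<rho> = {} then 1 else Min (Suc ` blk b \<rho>))"
  proof (rule cyc_succ_insert_1(2))
    show "finite (Suc ` blk b \<rho>)"
      using blk_empty_or_mem[OF \<rho>, of b] NC_block(2)[OF \<rho>, of "blk b \<rho>"] by auto
  qed (use blk_memD(3)[OF \<rho>] in fastforce)
  also have "\<dots> = (if b = 0 then 1 else Suc (block_perm \<rho> b))"
  proof (cases "b = 0")
    case True
    then show ?thesis using blk_outside[OF \<rho>, of b] by simp
  next
    case False
    then have b: "1 \<le> b" by simp
    note R = blk_in[OF \<rho> b le_refl]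
    have "\<not> (\<exists>j\<in>blk b \<rho>. b < j)" using NC_elem[OF \<rho> R(1)] by fastforce
    then have "block_perm \<rho> b = Min (blk b \<rho>)"
      using block_perm_blk[OF \<rho> b le_refl] cyc_succ_last by simp
    moreover have "Min (Suc ` blk b \<rho>) = Suc (Min (blk b \<rho>))"
      using mono_Min_commute[OF strict_mono_mono[OF strict_mono_Suc'], of "blk b \<rho>"] NC_block[OF \<rho> R(1)] by simp
    ultimately show ?thesis using False R(2) by auto
  qed
  finally show ?thesis .
qed

end

text \<open>
  For \<open>m \<ge> 1\<close>, composing with the transposition of \<open>1\<close> and \<open>b+2\<close> splits both the permutation of the glued
  partition and the long cycle into permutations of \<open>{1..b+1}\<close> and \<open>{b+2..b+m+1}\<close>, and the identity holds on
  each part: on the first one, inserting \<open>1\<close> after \<open>b+1\<close> turns the cycle on \<open>{2..b+1}\<close> into the one on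
  \<open>{1..b+1}\<close>.  The proof evaluates both sides pointwise.
\<close>

lemma glue_coglue_compose:
  assumes \<rho>: "\<rho> \<in> NC b" and \<sigma>: "\<sigma> \<in> NC m" and \<rho>': "\<rho>' \<in> NC b" and \<sigma>': "\<sigma>' \<in> NC m"
    and 1: "block_perm \<rho> \<circ> block_perm \<rho>' = block_perm {{1..b}}"
    and 2: "block_perm \<sigma> \<circ> block_perm \<sigma>' = block_perm {{1..m}}"
  shows "block_perm (glue b \<rho> \<sigma>) \<circ> block_perm (coglue b \<rho>' \<sigma>') = block_perm {{1..Suc (b + m)}}"
proof
  fix i
  have r: "block_perm \<rho> (block_perm \<rho>' j) = block_perm {{1..b}} j" for j
    using fun_cong[OF 1, of j] by simp
  have s: "block_perm \<sigma> (block_perm \<sigma>' j) = block_perm {{1..m}} j" for j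
    using fun_cong[OF 2, of j] by simp
  consider "\<not> (1 \<le> i \<and> i \<le> Suc (b + m))" | "i = 1" | j where "i = Suc j" "1 \<le> j" "j \<le> b"
    | j where "i = Suc b + j" "1 \<le> j" "j \<le> m"
  proof -
    assume a: "\<not> (1 \<le> i \<and> i \<le> Suc (b + m)) \<Longrightarrow> thesis" "i = 1 \<Longrightarrow> thesis"
      "\<And>j. i = Suc j \<Longrightarrow> 1 \<le> j \<Longrightarrow> j \<le> b \<Longrightarrow> thesis" "\<And>j. i = Suc b + j \<Longrightarrow> 1 \<le> j \<Longrightarrow> j \<le> m \<Longrightarrow> thesis"
    show thesis
      using a(1,2) a(3)[of "i - 1"] a(4)[of "i - Suc b"] by (cases "i \<le> Suc b") fastforce+
  qed
  then show "(block_perm (glue b \<rho> \<sigma>) \<circ> block_perm (coglue b \<rho>' \<sigma>')) i = block_perm {{1..Suc (b + m)}} i"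
  proof cases
    case 1
    then show ?thesis
      using block_perm_out[OF glue_NC[OF \<rho> \<sigma>]] block_perm_out[OF coglue_NC[OF \<rho>' \<sigma>']]
      by (auto simp: block_perm_top block_perm_top[unfolded One_nat_def])
  next
    case 2
    show ?thesis
    proof (cases "b = 0")
      case True
      then show ?thesis
        using 2 block_perm_coglue_1[OF \<rho>' \<sigma>'] block_perm_glue_1[OF \<rho> \<sigma>] by (auto simp: block_perm_top block_perm_top[unfolded One_nat_def])
    next
      case False
      then have "1 \<le> b" by simp
      then show ?thesis
        using 2 False block_perm_coglue_1[OF \<rho>' \<sigma>'] r[of b]
          block_perm_glue_lower[OF \<rho> \<sigma> block_perm_range[OF \<rho>' \<open>1 \<le> b\<close> le_refl]]
        by (simp add: block_perm_top block_perm_top[unfolded One_nat_def])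
    qed
  next
    case (3 j)
    show ?thesis
    proof (cases "j = b")
      case True
      then show ?thesis
        using 3 block_perm_coglue_lower[OF \<rho>' \<sigma>' 3(2,3)] block_perm_glue_1[OF \<rho> \<sigma>]
        by (auto simp: block_perm_top block_perm_top[unfolded One_nat_def])
    next
      case False
      then show ?thesis
        using 3 block_perm_coglue_lower[OF \<rho>' \<sigma>' 3(2,3)] r[of j]
          block_perm_glue_lower[OF \<rho> \<sigma> block_perm_range[OF \<rho>' 3(2,3)]]
        by (simp add: block_perm_top block_perm_top[unfolded One_nat_def])
    qed
  next
    case (4 j)
    have "block_perm (coglue b \<rho>' \<sigma>') i = Suc b + block_perm \<sigma>' j"
      using block_perm_coglue_upper[OF \<rho>' \<sigma>' 4(2,3)] 4(1) by simp
    then have "(block_perm (glue b \<rho> \<sigma>) \<circ> block_perm (coglue b \<rho>' \<sigma>')) i =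
        (if block_perm {{1..m}} j = 1 then 1 else Suc b + block_perm {{1..m}} j)"
      using block_perm_glue_upper[OF \<rho> \<sigma> block_perm_range[OF \<sigma>' 4(2,3)]] s[of j] by simp
    then show ?thesis using 4 by (auto simp: block_perm_top block_perm_top[unfolded One_nat_def])
  qed
qed

text \<open>
  Injectivity of \<open>P\<^sub>\<pi>\<close> moves it to the other side of the defining equation, which removes the inverse.
\<close>

lemma kreweras_eqI:
  assumes \<pi>: "\<pi> \<in> NC n" and \<sigma>: "\<sigma> \<in> NC n"
    and eq: "block_perm \<pi> \<circ> block_perm \<sigma> = block_perm {{1..n}}"
  shows "kreweras n \<pi> = \<sigma>"
proof -
  have "inv (block_perm \<pi>) \<circ> block_perm {{1..n}} = block_perm \<sigma>"
    unfolding eq[symmetric] using inj_block_perm[OF \<pi>] by (simp add: fun_eq_iff)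
  then show ?thesis
    unfolding kreweras_def using \<sigma> block_perm_inject[OF _ \<sigma>] by (intro the_equality) auto
qed

lemma kreweras_exists:
  "\<pi> \<in> NC n \<Longrightarrow> \<exists>\<sigma>\<in>NC n. block_perm \<pi> \<circ> block_perm \<sigma> = block_perm {{1..n}}"
proof (induction n arbitrary: \<pi> rule: less_induct)
  case (less n)
  show ?case
  proof (cases n)
    case 0
    then show ?thesis using less.prems by (auto simp: block_perm_def fun_eq_iff)
  next
    case (Suc k)
    then obtain b \<rho> \<sigma> where *: "b \<le> k" "\<rho> \<in> NC b" "\<sigma> \<in> NC (k - b)" "\<pi> = glue b \<rho> \<sigma>"
      using less.prems glue_surj by metis
    obtain \<rho>' where r: "\<rho>' \<in> NC b" "block_perm \<rho> \<circ> block_perm \<rho>' = block_perm {{1..b}}"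
      using less.IH[OF _ *(2)] *(1) Suc by (meson le_imp_less_Suc)
    obtain \<sigma>' where s: "\<sigma>' \<in> NC (k - b)" "block_perm \<sigma> \<circ> block_perm \<sigma>' = block_perm {{1..k - b}}"
      using less.IH[OF _ *(3)] *(1) Suc by (meson diff_le_self le_imp_less_Suc)
    have "Suc (b + (k - b)) = n" using *(1) Suc by simp
    then show ?thesis
      using glue_coglue_compose[OF *(2,3) r(1) s(1) r(2) s(2)] coglue_NC[OF r(1) s(1)] *(4)
      by (intro bexI[of _ "coglue b \<rho>' \<sigma>'"]) simp_all
  qed
qed

lemma kreweras_props:
  assumes "\<pi> \<in> NC n"
  shows "kreweras n \<pi> \<in> NC n" "block_perm \<pi> \<circ> block_perm (kreweras n \<pi>) = block_perm {{1..n}}"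
  using kreweras_exists[OF assms] kreweras_eqI[OF assms] by auto

lemma kreweras_glue:
  assumes "\<rho> \<in> NC b" "\<sigma> \<in> NC m"
  shows "kreweras (Suc (b + m)) (glue b \<rho> \<sigma>) = coglue b (kreweras b \<rho>) (kreweras m \<sigma>)"
  using kreweras_props[OF assms(1)] kreweras_props[OF assms(2)] assms
  by (intro kreweras_eqI glue_NC coglue_NC glue_coglue_compose)

section \<open>Recursions for weighted sums over non-crossing partitions\<close>

definition rest_weight :: "(nat \<Rightarrow> 'a::comm_semiring_1) \<Rightarrow> nat \<Rightarrow> nat set set \<Rightarrow> 'a" where
  "rest_weight f i \<pi> = (\<Prod>A\<in>\<pi> - {blk i \<pi>}. f (card A))"

text \<open>
  All blocks are weighted by \<open>f\<close>, except that the block of \<open>1\<close> has a weight \<open>x\<close> of its own.  The weight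
  \<open>x\<close> is a parameter because cutting a partition shrinks this block by one point, which changes \<open>x\<close> to
  \<open>x \<circ> Suc\<close>.
\<close>

definition root_sum :: "(nat \<Rightarrow> 'a::comm_semiring_1) \<Rightarrow> nat \<Rightarrow> (nat \<Rightarrow> 'a) \<Rightarrow> 'a" where
  "root_sum f n x = (\<Sum>\<pi>\<in>NC n. x (card (blk 1 \<pi>)) * rest_weight f 1 \<pi>)"

text \<open>
  The blocks of \<open>\<pi>\<close> are weighted by \<open>f\<close> and those of its Kreweras complement by \<open>g\<close>, with special
  weights \<open>x\<close> for the block of \<open>1\<close> in \<open>\<pi>\<close> and \<open>w\<close> for the block of \<open>n\<close> in the complement.  These are the
  two blocks that gluing alters.
\<close>

definition birooted_sum ::
  "(nat \<Rightarrow> 'a::comm_semiring_1) \<Rightarrow> (nat \<Rightarrow> 'a) \<Rightarrow> nat \<Rightarrow> (nat \<Rightarrow> 'a) \<Rightarrow> (nat \<Rightarrow> 'a) \<Rightarrow> 'a" where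
  "birooted_sum f g n x w = (\<Sum>\<pi>\<in>NC n.
     (x (card (blk 1 \<pi>)) * rest_weight f 1 \<pi>) *
     (w (card (blk n (kreweras n \<pi>))) * rest_weight g n (kreweras n \<pi>)))"

text \<open>
  The normalisation \<open>f 0 = 1\<close> covers points \<open>i\<close> outside the underlying set, whose block is empty.
\<close>

lemma prod_blocks:
  assumes "\<pi> \<in> NC n" "f 0 = 1"
  shows "(\<Prod>A\<in>\<pi>. f (card A)) = f (card (blk i \<pi>)) * rest_weight f i \<pi>"
  using blk_empty_or_mem[OF assms(1), of i]
proof
  assume e: "blk i \<pi> = {}"
  then have "\<pi> - {blk i \<pi>} = \<pi>" using NC_D(2)[OF assms(1)] by simp
  then show ?thesis using e assms(2) by (simp add: rest_weight_def)
next
  assume "blk i \<pi> \<in> \<pi> \<and> i \<in> blk i \<pi>"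
  then show ?thesis
    unfolding rest_weight_def using prod.remove[OF finite_NC_member[OF assms(1)]] by blast
qed

lemma prod_image_blocks:
  assumes "inj h"
  shows "(\<Prod>A\<in>(`) h ` \<pi>. f (card A)) = (\<Prod>A\<in>\<pi>. f (card A))"
proof -
  have "inj_on ((`) h) \<pi>" using assms by (intro inj_onI) (simp add: inj_image_eq_iff)
  moreover have "card (h ` A) = card A" for A
    using assms by (intro card_image) (auto simp: inj_on_def)
  ultimately show ?thesis by (simp add: prod.reindex)
qed

lemma prod_Suc_shift_blocks:
  assumes \<rho>: "\<rho> \<in> NC b" and \<sigma>: "\<sigma> \<in> NC m" and sub: "\<rho>0 \<subseteq> \<rho>" "\<sigma>0 \<subseteq> \<sigma>"
  shows "(\<Prod>A\<in>(`) Suc ` \<rho>0 \<union> shift (Suc b) ` \<sigma>0. f (card A)) =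
    (\<Prod>A\<in>\<rho>0. f (card A)) * (\<Prod>A\<in>\<sigma>0. f (card A))"
proof -
  have "(`) Suc ` \<rho>0 \<inter> shift (Suc b) ` \<sigma>0 = {}"
  proof (rule ccontr)
    assume "\<not> ?thesis"
    then obtain R S where *: "R \<in> \<rho>" "S \<in> \<sigma>" "Suc ` R = shift (Suc b) S" using sub by auto
    obtain i where i: "i \<in> R" "i \<le> b" using NC_block(3)[OF \<rho> *(1)] NC_elem[OF \<rho> *(1)] by blast
    then have "Suc i \<in> shift (Suc b) S" using *(3) by blast
    then show False using NC_elem[OF \<sigma> *(2)] i by fastforce
  qed
  moreover have "finite \<rho>0" "finite \<sigma>0"
    using sub finite_NC_member[OF \<rho>] finite_NC_member[OF \<sigma>] finite_subset by auto
  ultimately show ?thesis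
    by (simp only: prod.union_disjoint finite_imageI prod_image_blocks inj_Suc inj_on_add)
qed

lemma one_notin_Suc_shift:
  assumes \<rho>: "\<rho> \<in> NC b" and \<sigma>: "\<sigma> \<in> NC m" and "A \<in> (`) Suc ` \<rho> \<union> shift (Suc b) ` \<sigma>"
  shows "1 \<notin> A"
  using assms(3) NC_elem[OF \<rho>] NC_elem[OF \<sigma>] by fastforce

lemma card_blk1_glue:
  assumes \<rho>: "\<rho> \<in> NC b" and \<sigma>: "\<sigma> \<in> NC m"
  shows "card (blk 1 (glue b \<rho> \<sigma>)) = Suc (card (blk 1 \<sigma>))"
proof -
  have "finite (blk 1 \<sigma>)" using blk_empty_or_mem[OF \<sigma>, of 1] NC_block(2)[OF \<sigma>, of "blk 1 \<sigma>"] by auto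
  moreover have "1 \<notin> shift (Suc b) (blk 1 \<sigma>)" using blk_memD(3)[OF \<sigma>] by fastforce
  moreover have "card (shift (Suc b) (blk 1 \<sigma>)) = card (blk 1 \<sigma>)" by (intro card_image) simp
  ultimately show ?thesis unfolding blk1_glue[OF \<rho> \<sigma>] by simp
qed

lemma rest_weight_glue:
  assumes \<rho>: "\<rho> \<in> NC b" and \<sigma>: "\<sigma> \<in> NC m"
  shows "rest_weight f 1 (glue b \<rho> \<sigma>) = (\<Prod>A\<in>\<rho>. f (card A)) * rest_weight f 1 \<sigma>"
proof -
  have "insert 1 (shift (Suc b) (blk 1 \<sigma>)) \<notin> (`) Suc ` \<rho> \<union> shift (Suc b) ` (\<sigma> - {blk 1 \<sigma>})"
    using one_notin_Suc_shift[OF \<rho> \<sigma>] by blast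
  then have "glue b \<rho> \<sigma> - {blk 1 (glue b \<rho> \<sigma>)} = (`) Suc ` \<rho> \<union> shift (Suc b) ` (\<sigma> - {blk 1 \<sigma>})"
    unfolding blk1_glue[OF \<rho> \<sigma>] by (auto simp: glue_def)
  then show ?thesis
    unfolding rest_weight_def by (simp only: prod_Suc_shift_blocks[OF \<rho> \<sigma> subset_refl Diff_subset])
qed

lemma card_new_block_coglue:
  assumes \<rho>: "\<rho> \<in> NC b"
  shows "card (insert 1 (Suc ` blk b \<rho>)) = Suc (card (blk b \<rho>))"
proof -
  have "finite (blk b \<rho>)" using blk_empty_or_mem[OF \<rho>, of b] NC_block(2)[OF \<rho>, of "blk b \<rho>"] by auto
  moreover have "1 \<notin> Suc ` blk b \<rho>" using blk_memD(3)[OF \<rho>] by fastforce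
  moreover have "card (Suc ` blk b \<rho>) = card (blk b \<rho>)" by (intro card_image) simp
  ultimately show ?thesis by simp
qed

text \<open>
  If \<open>\<sigma>\<close> is not empty, the last point lies in a block inherited from \<open>\<sigma>\<close>, and the enlarged block of
  \<open>\<rho>\<close> becomes an ordinary block with one more point.
\<close>

lemma coglue_last:
  assumes \<rho>: "\<rho> \<in> NC b" and \<sigma>: "\<sigma> \<in> NC m" and m: "1 \<le> m"
  shows "card (blk (Suc (b + m)) (coglue b \<rho> \<sigma>)) = card (blk m \<sigma>)"
    and "rest_weight g (Suc (b + m)) (coglue b \<rho> \<sigma>) =
      g (Suc (card (blk b \<rho>))) * rest_weight g b \<rho> * rest_weight g m \<sigma>"
proof -
  note S = blk_in[OF \<sigma> m le_refl]
  have blk: "blk (Suc (b + m)) (coglue b \<rho> \<sigma>) = shift (Suc b) (blk m \<sigma>)"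
    by (rule blk_eq[OF coglue_NC[OF \<rho> \<sigma>] coglue_I(2)]) (use S in auto)
  show "card (blk (Suc (b + m)) (coglue b \<rho> \<sigma>)) = card (blk m \<sigma>)"
    unfolding blk by (intro card_image) simp
  let ?N = "insert 1 (Suc ` blk b \<rho>)"
  let ?U = "(`) Suc ` (\<rho> - {blk b \<rho>}) \<union> shift (Suc b) ` (\<sigma> - {blk m \<sigma>})"
  have N: "?N \<notin> ?U" "?N \<noteq> shift (Suc b) (blk m \<sigma>)"
    using one_notin_Suc_shift[OF \<rho> \<sigma>] S(1) by blast+
  have "shift (Suc b) (blk m \<sigma>) \<notin> (`) Suc ` (\<rho> - {blk b \<rho>})"
  proof
    assume "shift (Suc b) (blk m \<sigma>) \<in> (`) Suc ` (\<rho> - {blk b \<rho>})"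
    then obtain R where R: "R \<in> \<rho>" "shift (Suc b) (blk m \<sigma>) = Suc ` R" by blast
    have "Suc b + m \<in> Suc ` R" using S(2) R(2) by blast
    then show False using NC_elem[OF \<rho> R(1)] m by fastforce
  qed
  moreover have "shift (Suc b) ` \<sigma> - {shift (Suc b) (blk m \<sigma>)} = shift (Suc b) ` (\<sigma> - {blk m \<sigma>})"
  proof -
    have "inj ((+) (Suc b))" by simp
    then have "inj ((`) ((+) (Suc b)))" by (intro injI) (simp only: inj_image_eq_iff)
    from image_set_diff[OF this, of \<sigma> "{blk m \<sigma>}"] show ?thesis by (simp only: image_insert image_empty)
  qed
  moreover have "(A \<union> B \<union> {N}) - {S} = insert N (A \<union> C)"
    if "S \<notin> A" "B - {S} = C" "N \<noteq> S" for A B C and N S :: "nat set"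
    using that by blast
  ultimately have "coglue b \<rho> \<sigma> - {shift (Suc b) (blk m \<sigma>)} = insert ?N ?U"
    using N(2) unfolding coglue_def by metis
  moreover have "finite ?U" using finite_NC_member[OF \<rho>] finite_NC_member[OF \<sigma>] by simp
  ultimately have "rest_weight g (Suc (b + m)) (coglue b \<rho> \<sigma>) = g (card ?N) * (\<Prod>A\<in>?U. g (card A))"
    unfolding rest_weight_def blk using N(1) by simp
  also have "(\<Prod>A\<in>?U. g (card A)) = rest_weight g b \<rho> * rest_weight g m \<sigma>"
    unfolding rest_weight_def by (rule prod_Suc_shift_blocks[OF \<rho> \<sigma>]) auto
  finally show "rest_weight g (Suc (b + m)) (coglue b \<rho> \<sigma>) =
      g (Suc (card (blk b \<rho>))) * rest_weight g b \<rho> * rest_weight g m \<sigma>"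
    by (simp only: card_new_block_coglue[OF \<rho>] mult.assoc)
qed

text \<open>
  If \<open>\<sigma>\<close> is empty, the enlarged block of \<open>\<rho>\<close> is itself the block of the last point.
\<close>

lemma coglue_empty_last:
  assumes \<rho>: "\<rho> \<in> NC b"
  shows "card (blk (Suc b) (coglue b \<rho> {})) = Suc (card (blk b \<rho>))"
    and "rest_weight g (Suc b) (coglue b \<rho> {}) = rest_weight g b \<rho>"
proof -
  have E: "{} \<in> NC 0" by simp
  let ?N = "insert 1 (Suc ` blk b \<rho>)"
  have "Suc b \<in> ?N"
  proof (cases "b = 0")
    case False
    then have "b \<in> blk b \<rho>" using blk_in(2)[OF \<rho>, of b] by simp
    then show ?thesis by simp
  qed simp
  then have blk: "blk (Suc b) (coglue b \<rho> {}) = ?N"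
    using blk_eq[OF coglue_NC[OF \<rho> E] coglue_I(3)] by simp
  show "card (blk (Suc b) (coglue b \<rho> {})) = Suc (card (blk b \<rho>))"
    unfolding blk by (rule card_new_block_coglue[OF \<rho>])
  have "?N \<notin> (`) Suc ` (\<rho> - {blk b \<rho>})"
    using one_notin_Suc_shift[OF \<rho> E] by blast
  then have "coglue b \<rho> {} - {?N} = (`) Suc ` (\<rho> - {blk b \<rho>})"
    unfolding coglue_def by blast
  then show "rest_weight g (Suc b) (coglue b \<rho> {}) = rest_weight g b \<rho>"
    unfolding rest_weight_def blk by (simp add: prod_image_blocks)
qed

lemma root_sum_0: "root_sum f 0 x = x 0"
  by (simp add: root_sum_def rest_weight_def blk_def)

lemma root_sum_Suc:
  assumes "f 0 = 1"
  shows "root_sum f (Suc k) x = (\<Sum>b\<le>k. root_sum f b f * root_sum f (k - b) (x \<circ> Suc))"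
  unfolding root_sum_def sum_NC_Suc sum_product
  using assms by (intro sum.cong refl) (simp add: card_blk1_glue rest_weight_glue prod_blocks[where i = 1] mult_ac del: One_nat_def)

lemma sum_NC_prod_eq_root_sum:
  "f 0 = 1 \<Longrightarrow> (\<Sum>\<pi>\<in>NC n. \<Prod>A\<in>\<pi>. f (card A)) = root_sum f n f"
  unfolding root_sum_def by (intro sum.cong refl prod_blocks)

lemma kreweras_0 [simp]: "kreweras 0 {} = {}"
  using kreweras_props(1)[of "{}" 0] by simp

lemma birooted_sum_0: "birooted_sum f g 0 x w = x 0 * w 0"
  by (simp add: birooted_sum_def rest_weight_def blk_def)

text \<open>
  The summand outside the sum over \<open>b\<close> comes from the partitions with singleton block \<open>{1}\<close>, for which the
  gap is everything else.
\<close>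

lemma birooted_sum_Suc:
  assumes f: "f 0 = 1"
  shows "birooted_sum f g (Suc k) x w =
    x 1 * birooted_sum f g k f (w \<circ> Suc) +
    (\<Sum>b<k. birooted_sum f g b f (g \<circ> Suc) * birooted_sum f g (k - b) (x \<circ> Suc) w)"
proof -
  let ?F = "\<lambda>\<pi>. (x (card (blk 1 \<pi>)) * rest_weight f 1 \<pi>) *
     (w (card (blk (Suc k) (kreweras (Suc k) \<pi>))) * rest_weight g (Suc k) (kreweras (Suc k) \<pi>))"
  have "birooted_sum f g (Suc k) x w = (\<Sum>b\<le>k. \<Sum>\<rho>\<in>NC b. \<Sum>\<sigma>\<in>NC (k - b). ?F (glue b \<rho> \<sigma>))"
    unfolding birooted_sum_def by (rule sum_NC_Suc)
  also have "\<dots> = (\<Sum>\<rho>\<in>NC k. ?F (glue k \<rho> {})) +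
      (\<Sum>b<k. \<Sum>\<rho>\<in>NC b. \<Sum>\<sigma>\<in>NC (k - b). ?F (glue b \<rho> \<sigma>))"
    by (simp add: lessThan_Suc_atMost[symmetric] add.commute del: One_nat_def)
  also have "(\<Sum>\<rho>\<in>NC k. ?F (glue k \<rho> {})) = x 1 * birooted_sum f g k f (w \<circ> Suc)"
    unfolding birooted_sum_def sum_distrib_left
  proof (intro sum.cong refl)
    fix \<rho> assume \<rho>: "\<rho> \<in> NC k"
    have E: "{} \<in> NC 0" by simp
    have K: "kreweras (Suc k) (glue k \<rho> {}) = coglue k (kreweras k \<rho>) {}"
      using kreweras_glue[OF \<rho> E] by simp
    have "blk 1 ({} :: nat set set) = {}" by (simp add: blk_def)
    then have [simp]: "card (blk 1 (glue k \<rho> {})) = 1" "rest_weight f 1 {} = 1"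
      using card_blk1_glue[OF \<rho> E] by (simp_all add: rest_weight_def)
    show "?F (glue k \<rho> {}) = x 1 * (f (card (blk 1 \<rho>)) * rest_weight f 1 \<rho> *
        ((w \<circ> Suc) (card (blk k (kreweras k \<rho>))) * rest_weight g k (kreweras k \<rho>)))"
      by (simp add: K coglue_empty_last[OF kreweras_props(1)[OF \<rho>]] rest_weight_glue[OF \<rho> E] prod_blocks[where f = f and i = 1, OF \<rho> f] mult_ac del: One_nat_def)
  qed
  also have "(\<Sum>b<k. \<Sum>\<rho>\<in>NC b. \<Sum>\<sigma>\<in>NC (k - b). ?F (glue b \<rho> \<sigma>)) =
      (\<Sum>b<k. birooted_sum f g b f (g \<circ> Suc) * birooted_sum f g (k - b) (x \<circ> Suc) w)"
    unfolding birooted_sum_def sum_product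
  proof (intro sum.cong refl)
    fix b \<rho> \<sigma> assume "b \<in> {..<k}" and \<rho>: "\<rho> \<in> NC b" and \<sigma>: "\<sigma> \<in> NC (k - b)"
    then have b: "1 \<le> k - b" "Suc (b + (k - b)) = Suc k" by auto
    note K = kreweras_glue[OF \<rho> \<sigma>, unfolded b(2)]
    note L = coglue_last[OF kreweras_props(1)[OF \<rho>] kreweras_props(1)[OF \<sigma>] b(1), unfolded b(2)]
    show "?F (glue b \<rho> \<sigma>) = f (card (blk 1 \<rho>)) * rest_weight f 1 \<rho> *
        ((g \<circ> Suc) (card (blk b (kreweras b \<rho>))) * rest_weight g b (kreweras b \<rho>)) *
        ((x \<circ> Suc) (card (blk 1 \<sigma>)) * rest_weight f 1 \<sigma> *
        (w (card (blk (k - b) (kreweras (k - b) \<sigma>))) * rest_weight g (k - b) (kreweras (k - b) \<sigma>)))"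
      by (simp add: K L card_blk1_glue[OF \<rho> \<sigma>] rest_weight_glue[OF \<rho> \<sigma>] prod_blocks[where f = f and i = 1, OF \<rho> f] mult_ac
        del: One_nat_def)
  qed
  finally show ?thesis .
qed

lemma sum_NC_kreweras_eq_birooted_sum:
  assumes "f 0 = 1" "g 0 = 1"
  shows "(\<Sum>\<pi>\<in>NC n. (\<Prod>A\<in>\<pi>. f (card A)) * (\<Prod>B\<in>kreweras n \<pi>. g (card B))) = birooted_sum f g n f g"
  unfolding birooted_sum_def
proof (intro sum.cong refl)
  fix \<pi> assume "\<pi> \<in> NC n"
  then show "(\<Prod>A\<in>\<pi>. f (card A)) * (\<Prod>B\<in>kreweras n \<pi>. g (card B)) =
      f (card (blk 1 \<pi>)) * rest_weight f 1 \<pi> *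
      (g (card (blk n (kreweras n \<pi>))) * rest_weight g n (kreweras n \<pi>))"
    using prod_blocks[of \<pi> n f 1] prod_blocks[OF kreweras_props(1), of \<pi> n g n] assms by simp
qed

section \<open>Substitution of power series over commutative rings\<close>

unbundle fps_syntax


text \<open>
  Every member of the family is divisible by all powers of \<open>u\<close>.  Applied to the difference of two
  families that satisfy the same recursion, this shows that they agree; it replaces induction on
  coefficients in most of what follows.
\<close>

lemma fps_contraction_zero:
  fixes D :: "'i \<Rightarrow> 'a::comm_ring_1 fps"
  assumes u: "u $ 0 = 0" and D: "\<And>i. D i = u * D (s i)"
  shows "D i = 0"
proof (rule fps_ext)
  fix n
  show "D i $ n = 0 $ n"
  proof (induction n arbitrary: i rule: less_induct)
    case (less n)
    have "D i $ n = (\<Sum>k=0..n. u $ k * D (s i) $ (n - k))"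
      by (subst D) (simp add: fps_mult_nth)
    also have "\<dots> = 0"
    proof (rule sum.neutral, clarify)
      fix k assume "k \<in> {0..n}"
      then show "u $ k * D (s i) $ (n - k) = 0"
        using u less.IH[of "n - k" "s i"] by (cases "k = 0") auto
    qed
    finally show ?case by simp
  qed
qed

lemma fps_compose_X_mult:
  fixes a b :: "'a::comm_ring_1 fps"
  assumes b: "b $ 0 = 0"
  shows "(fps_X * a) oo b = b * (a oo b)"
proof (rule fps_ext)
  fix n
  have tail: "(b ^ i) $ m = 0" if "m < i" for i m
    using startsby_zero_power_prefix[OF b] that by blast
  have "(b * (a oo b)) $ n = (\<Sum>k=0..n. \<Sum>i=0..n - k. a $ i * (b $ k * (b ^ i) $ (n - k)))"
    by (simp add: fps_mult_nth fps_compose_nth sum_distrib_left mult_ac)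
  also have "\<dots> = (\<Sum>k=0..n. \<Sum>i=0..n. a $ i * (b $ k * (b ^ i) $ (n - k)))"
    by (intro sum.cong refl sum.mono_neutral_left) (auto simp: tail)
  also have "\<dots> = (\<Sum>i=0..n. a $ i * (\<Sum>k=0..n. b $ k * (b ^ i) $ (n - k)))"
    by (subst sum.swap) (simp add: sum_distrib_left)
  also have "\<dots> = (\<Sum>i=0..n. a $ i * (b ^ Suc i) $ n)"
    by (simp add: fps_mult_nth)
  also have "\<dots> = (\<Sum>i=Suc 0..Suc n. (fps_X * a) $ i * (b ^ i) $ n)"
    by (simp only: sum.atLeast_Suc_atMost_Suc_shift) simp
  also have "\<dots> = (\<Sum>i=0..Suc n. (fps_X * a) $ i * (b ^ i) $ n)"
    by (rule sum.mono_neutral_left) auto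
  also have "\<dots> = (\<Sum>i=0..n. (fps_X * a) $ i * (b ^ i) $ n)"
    using tail[of n "Suc n"] by simp
  finally show "((fps_X * a) oo b) $ n = (b * (a oo b)) $ n"
    by (simp add: fps_compose_nth)
qed

lemma fps_head_tail: "a = fps_const (a $ 0) + fps_X * fps_shift 1 (a :: 'a::comm_ring_1 fps)"
  by (rule fps_ext) (auto simp: fps_X_mult_nth)

lemma fps_const_mult_compose:
  "(fps_const k * a) oo b = fps_const k * (a oo (b :: 'a::comm_ring_1 fps))"
  by (rule fps_ext) (simp add: fps_compose_nth sum_distrib_left mult.assoc)

lemma fps_compose_step:
  fixes a b :: "'a::comm_ring_1 fps"
  assumes b: "b $ 0 = 0"
  shows "a oo b = fps_const (a $ 0) + b * (fps_shift 1 a oo b)"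
proof -
  have "a oo b = (fps_const (a $ 0) + fps_X * fps_shift 1 a) oo b"
    by (subst fps_head_tail[of a]) (rule refl)
  also have "\<dots> = (fps_const (a $ 0) * 1 oo b) + b * (fps_shift 1 a oo b)"
    using fps_compose_X_mult[OF b] by (simp add: fps_compose_add_distrib)
  finally show ?thesis by (simp only: fps_const_mult_compose) simp
qed

text \<open>
  Splitting off the constant term of \<open>a\<close> shows that both sides obey the same recursion in \<open>a\<close>.  This
  argument is valid over every commutative ring; the coefficients will be power series in infinitely
  many variables.
\<close>

lemma fps_compose_mult:
  fixes a b c :: "'a::comm_ring_1 fps"
  assumes b: "b $ 0 = 0"
  shows "(a * c) oo b = (a oo b) * (c oo b)"
proof -
  have "((a * c) oo b) - (a oo b) * (c oo b) = 0"
  proof (rule fps_contraction_zero[OF b, of "\<lambda>a. ((a * c) oo b) - (a oo b) * (c oo b)" "fps_shift 1"])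
    fix a
    have "a * c = fps_const (a $ 0) * c + fps_X * (fps_shift 1 a * c)"
      by (subst fps_head_tail[of a]) (simp add: algebra_simps)
    then have "(a * c) oo b = fps_const (a $ 0) * (c oo b) + b * ((fps_shift 1 a * c) oo b)"
      by (simp only: fps_compose_add_distrib fps_compose_X_mult[OF b] fps_const_mult_compose)
    then show "((a * c) oo b) - (a oo b) * (c oo b) =
        b * (((fps_shift 1 a * c) oo b) - (fps_shift 1 a oo b) * (c oo b))"
      by (simp only: fps_compose_step[OF b, of a]) (simp add: algebra_simps)
  qed
  then show ?thesis by simp
qed

lemma fps_compose_assoc':
  fixes e f u :: "'a::comm_ring_1 fps"
  assumes f: "f $ 0 = 0" and u: "u $ 0 = 0"
  shows "(e oo f) oo u = e oo (f oo u)"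
proof -
  have fu: "(f oo u) $ 0 = 0" using f by simp
  have "((e oo f) oo u) - (e oo (f oo u)) = 0"
  proof (rule fps_contraction_zero[OF fu, of "\<lambda>e. ((e oo f) oo u) - (e oo (f oo u))" "fps_shift 1"])
    fix e
    have "(e oo f) oo u = fps_const (e $ 0) + (f oo u) * ((fps_shift 1 e oo f) oo u)"
      by (subst fps_compose_step[OF f]) (simp add: fps_compose_add_distrib fps_compose_mult[OF u])
    moreover have "e oo (f oo u) = fps_const (e $ 0) + (f oo u) * (fps_shift 1 e oo (f oo u))"
      by (rule fps_compose_step[OF fu])
    ultimately show "((e oo f) oo u) - (e oo (f oo u)) =
        (f oo u) * (((fps_shift 1 e oo f) oo u) - (fps_shift 1 e oo (f oo u)))"
      by (simp add: algebra_simps)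
  qed
  then show ?thesis by simp
qed

lemma fps_mult_left_cancel_unit:
  fixes a b c :: "'a::comm_ring_1 fps"
  assumes "c $ 0 = 1" "c * a = c * b"
  shows "a = b"
proof -
  have "(1 - c) $ 0 = 0" using assms(1) by simp
  moreover have "a - b = (1 - c) * (a - b)" using assms(2) by (simp add: algebra_simps)
  ultimately have "a - b = 0"
    by (rule fps_contraction_zero[where D = "\<lambda>_. a - b" and i = "()" and s = id])
  then show ?thesis by simp
qed

text \<open>
  Up to degree \<open>n\<close> the right-hand side \<open>z E(h)\<close> only depends on \<open>h\<close> up to degree \<open>n - 1\<close>.
\<close>

lemma fps_fixpoint_unique:
  fixes E h k :: "'a::comm_ring_1 fps"
  assumes h: "h = fps_X * (E oo h)" and k: "k = fps_X * (E oo k)"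
  shows "h = k"
proof -
  have "\<forall>m\<le>n. h $ m = k $ m" for n
  proof (induction n)
    case 0
    have "h $ 0 = 0" "k $ 0 = 0" by (subst h, simp) (subst k, simp)
    then show ?case by simp
  next
    case (Suc n)
    have "\<forall>m\<le>n. (h ^ i) $ m = (k ^ i) $ m" for i
      by (induction i) (use Suc.IH in \<open>auto simp: fps_mult_nth intro!: sum.cong\<close>)
    then have "(E oo h) $ n = (E oo k) $ n" by (simp add: fps_compose_nth)
    then have "h $ Suc n = k $ Suc n" by (subst h, subst k) simp
    with Suc.IH show ?case by (auto simp: le_Suc_eq)
  qed
  then show ?thesis by (intro fps_ext) blast
qed

section \<open>Moments and their multiplicativity\<close>

text \<open>
  If \<open>e\<close> is the sequence of free cumulants, this is the moment of order \<open>n - 1\<close>; the index is shifted to match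
  \<open>y_sym\<close>.
\<close>

definition moment :: "(nat \<Rightarrow> 'a::comm_ring_1) \<Rightarrow> nat \<Rightarrow> 'a" where
  "moment e n = (\<Sum>\<pi>\<in>NC (n - 1). \<Prod>A\<in>\<pi>. e (card A))"

definition moment_fps :: "(nat \<Rightarrow> 'a::comm_ring_1) \<Rightarrow> 'a fps" where
  "moment_fps e = Abs_fps (\<lambda>n. if n = 0 then 0 else moment e n)"

lemma moment_0 [simp]: "moment e 0 = 1" and moment_1 [simp]: "moment e (Suc 0) = 1"
  by (simp_all add: moment_def)

text \<open>
  In terms of \<open>Q x = \<Sum> root_sum e n x z\<^sup>n\<close> and \<open>F = z Q e\<close>, the recursion of the rooted sums reads
  \<open>Q x = x 0 + F Q (x \<circ> Suc)\<close>.  It unfolds to \<open>Q x = \<Sum> x i F\<^sup>i\<close>, and \<open>x = e\<close> is the claim.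
\<close>

lemma moment_fps_fixpoint:
  fixes e :: "nat \<Rightarrow> 'a::comm_ring_1"
  assumes e: "e 0 = 1"
  shows "moment_fps e = fps_X * (Abs_fps e oo moment_fps e)"
proof -
  define Q where "Q x = Abs_fps (\<lambda>n. root_sum e n x)" for x
  define F where "F = fps_X * Q e"
  have F0: "F $ 0 = 0" by (simp add: F_def)
  have Q_rec: "Q x = fps_const (x 0) + F * Q (x \<circ> Suc)" for x
  proof (rule fps_ext)
    fix n
    show "Q x $ n = (fps_const (x 0) + F * Q (x \<circ> Suc)) $ n"
    proof (cases n)
      case 0
      then show ?thesis by (simp add: Q_def F0 root_sum_0)
    next
      case (Suc k)
      have "(F * Q (x \<circ> Suc)) $ Suc k = (Q e * Q (x \<circ> Suc)) $ k"
        unfolding F_def mult.assoc fps_X_mult_nth by simp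
      also have "\<dots> = root_sum e (Suc k) x"
        by (simp add: Q_def fps_mult_nth root_sum_Suc[of e, OF e] atLeast0AtMost)
      finally show ?thesis by (simp add: Suc) (simp add: Q_def)
    qed
  qed
  have "Q x - (Abs_fps x oo F) = 0" for x
  proof (rule fps_contraction_zero[OF F0, of "\<lambda>x. Q x - (Abs_fps x oo F)" "\<lambda>x. x \<circ> Suc"])
    fix x :: "nat \<Rightarrow> 'a"
    have "fps_shift 1 (Abs_fps x) = Abs_fps (x \<circ> Suc)" by (rule fps_ext) simp
    then have "Abs_fps x oo F = fps_const (x 0) + F * (Abs_fps (x \<circ> Suc) oo F)"
      using fps_compose_step[OF F0, of "Abs_fps x"] by simp
    then show "Q x - (Abs_fps x oo F) = F * (Q (x \<circ> Suc) - (Abs_fps (x \<circ> Suc) oo F))"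
      by (simp only: Q_rec[of x]) (simp add: algebra_simps)
  qed
  then have "Q e = Abs_fps e oo F" by simp
  moreover have "F = moment_fps e"
    by (rule fps_ext)
      (auto simp: F_def Q_def moment_fps_def moment_def fps_X_mult_nth sum_NC_prod_eq_root_sum[of e, OF e])
  ultimately show ?thesis using F_def by simp
qed

text \<open>
  With \<open>W x w = \<Sum> birooted_sum n x w z\<^sup>n\<close> over \<open>n \<ge> 1\<close>, the recursion of the birooted sums reads
  \<open>W x w = x 1 S w + u W (x \<circ> Suc) w\<close>, where \<open>S w\<close> is the part with singleton block \<open>{1}\<close> and \<open>u = S g\<close>.  Unfolding
  it in \<open>x\<close>, and then once more in \<open>w\<close> for \<open>x = f\<close>, gives the two expressions for \<open>h = W f g\<close> as compositions
  with \<open>u\<close> and with \<open>v = c z\<close>.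
\<close>

theorem moment_multiplicative_convolution:
  fixes e g :: "nat \<Rightarrow> 'a::comm_ring_1"
  assumes e: "e 0 = 1" and g: "g 0 = 1" and n: "1 \<le> n"
  shows "(\<Sum>\<pi>\<in>NC n. (\<Prod>A\<in>\<pi>. moment e (card A)) * (\<Prod>B\<in>kreweras n \<pi>. moment g (card B))) =
    moment (\<lambda>k. \<Sum>i\<le>k. e i * g (k - i)) n"
proof -
  let ?f = "moment e" and ?g = "moment g"
  define conv where "conv = (\<lambda>k. \<Sum>i\<le>k. e i * g (k - i))"
  define W where "W x w = Abs_fps (\<lambda>n. if n = 0 then 0 else birooted_sum ?f ?g n x w)" for x w
  define S where "S w = fps_X * (fps_const (w 1) + W ?f (w \<circ> Suc))" for w :: "nat \<Rightarrow> 'a"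
  define P where "P x = Abs_fps (\<lambda>n. x (Suc n))" for x :: "nat \<Rightarrow> 'a"
  define u where "u = S ?g"
  have S_nth: "S w $ 0 = 0" "S w $ Suc k = birooted_sum ?f ?g k ?f (w \<circ> Suc)" for w k
    by (simp_all add: S_def W_def birooted_sum_0)
  have u0: "u $ 0 = 0" by (simp add: u_def S_nth)
  have P_step: "P x oo b = fps_const (x 1) + b * (P (x \<circ> Suc) oo b)" if "b $ 0 = 0" for x b
  proof -
    have "fps_shift 1 (P x) = P (x \<circ> Suc)" by (rule fps_ext) (simp add: P_def)
    then show ?thesis using fps_compose_step[OF that, of "P x"] by (simp add: P_def)
  qed
  have W_rec: "W x w = fps_const (x 1) * S w + u * W (x \<circ> Suc) w" for x w
  proof (rule fps_ext)
    fix n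
    show "W x w $ n = (fps_const (x 1) * S w + u * W (x \<circ> Suc) w) $ n"
    proof (cases n)
      case 0
      then show ?thesis by (simp add: W_def S_nth)
    next
      case (Suc k)
      have "(u * W (x \<circ> Suc) w) $ Suc k = (\<Sum>i\<le>k. u $ Suc i * W (x \<circ> Suc) w $ (k - i))"
        unfolding fps_mult_nth sum.atLeast0_atMost_Suc_shift by (simp add: u0 atLeast0AtMost)
      also have "\<dots> = (\<Sum>b<k. birooted_sum ?f ?g b ?f (?g \<circ> Suc) * birooted_sum ?f ?g (k - b) (x \<circ> Suc) w)"
        by (simp add: lessThan_Suc_atMost[symmetric] u_def S_nth W_def)
      finally show ?thesis
        using birooted_sum_Suc[of ?f ?g k x w] by (simp add: Suc S_nth) (simp add: W_def)
    qed
  qed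
  \<comment> \<open>Unfolding in \<open>x\<close>: \<open>W x w = (x 1 + x 2 u + x 3 u\<^sup>2 + \<dots>) S w\<close>.\<close>
  have W_eq: "W x w = (P x oo u) * S w" for x w
  proof -
    have "W x w - (P x oo u) * S w = 0"
    proof (rule fps_contraction_zero[OF u0, of "\<lambda>x. W x w - (P x oo u) * S w" "\<lambda>x. x \<circ> Suc"])
      fix x
      show "W x w - (P x oo u) * S w = u * (W (x \<circ> Suc) w - (P (x \<circ> Suc) oo u) * S w)"
        unfolding W_rec[of x w] P_step[OF u0, of x] by (simp add: algebra_simps)
    qed
    then show ?thesis by simp
  qed
  define c where "c = P ?f oo u"
  define v where "v = c * fps_X"
  define h where "h = W ?f ?g"
  have v0: "v $ 0 = 0" by (simp add: v_def)
  have c0: "c $ 0 = 1" by (simp add: c_def P_def)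
  \<comment> \<open>For \<open>x = f\<close> the factor \<open>c\<close> closes the recursion in \<open>w\<close>, since \<open>S w\<close> is built from \<open>W f (w \<circ> Suc)\<close>.\<close>
  have Wf_rec: "W ?f w = v * (fps_const (w 1) + W ?f (w \<circ> Suc))" for w
    using W_eq[of ?f w] by (simp add: c_def v_def S_def mult.assoc)
  have "W ?f w - v * (P w oo v) = 0" for w
  proof (rule fps_contraction_zero[OF v0, of "\<lambda>w. W ?f w - v * (P w oo v)" "\<lambda>w. w \<circ> Suc"])
    fix w
    show "W ?f w - v * (P w oo v) = v * (W ?f (w \<circ> Suc) - v * (P (w \<circ> Suc) oo v))"
      unfolding Wf_rec[of w] P_step[OF v0, of w] by (simp add: algebra_simps)
  qed
  then have h_v: "h = v * (P ?g oo v)" by (simp add: h_def)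
  have h_u: "h = u * (P ?f oo u)" using W_eq[of ?f ?g] by (simp add: h_def u_def mult.commute)
  \<comment> \<open>Substituting \<open>b\<close> into \<open>F = z A(F)\<close> gives \<open>h = b A(h)\<close> whenever \<open>h = F(b)\<close>.\<close>
  have h_fix: "h = b * (Abs_fps a oo h)" if a: "a 0 = 1" and b: "b $ 0 = 0" and hb: "h = b * (P (moment a) oo b)" for a b
  proof -
    have F: "moment_fps a = fps_X * P (moment a)"
      by (rule fps_ext) (auto simp: moment_fps_def P_def fps_X_mult_nth)
    have hF: "h = moment_fps a oo b" unfolding F fps_compose_X_mult[OF b] by (rule hb)
    have "moment_fps a oo b = b * ((Abs_fps a oo moment_fps a) oo b)"
      by (subst moment_fps_fixpoint[of a, OF a]) (rule fps_compose_X_mult[OF b])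
    also have "(Abs_fps a oo moment_fps a) oo b = Abs_fps a oo (moment_fps a oo b)"
      by (rule fps_compose_assoc'[OF _ b]) (simp add: moment_fps_def)
    finally show ?thesis by (simp only: hF[symmetric])
  qed
  have h0: "h $ 0 = 0" by (simp add: h_def W_def)
  \<comment> \<open>Both sides are \<open>h\<close>, because \<open>h = c u\<close> and \<open>h = v G(h)\<close> with \<open>v = c z\<close>.\<close>
  have "c * u = c * (fps_X * (Abs_fps g oo h))"
    using h_fix[of g v, OF g v0 h_v] h_u by (simp add: c_def v_def mult_ac)
  then have "u = fps_X * (Abs_fps g oo h)" by (rule fps_mult_left_cancel_unit[OF c0])
  then have "h = fps_X * ((Abs_fps e * Abs_fps g) oo h)"
    using h_fix[of e u, OF e u0 h_u] fps_compose_mult[OF h0, of "Abs_fps e" "Abs_fps g"] by (simp add: mult_ac)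
  moreover have "Abs_fps e * Abs_fps g = Abs_fps conv"
    by (rule fps_ext) (simp add: fps_mult_nth conv_def atLeast0AtMost)
  moreover have "conv 0 = 1" by (simp add: conv_def e g)
  ultimately have "h = moment_fps conv"
    using fps_fixpoint_unique[of h "Abs_fps conv"] moment_fps_fixpoint[of conv] by simp
  then have "h $ n = moment_fps conv $ n" by simp
  then show ?thesis
    using n sum_NC_kreweras_eq_birooted_sum[of ?f ?g n]
    by (simp add: h_def W_def moment_fps_def conv_def)
qed

section \<open>Finitely supported functions\<close>

abbreviation lookup :: "('a \<Rightarrow>\<^sub>0 'b::zero) \<Rightarrow> 'a \<Rightarrow> 'b" where "lookup \<equiv> Poly_Mapping.lookup"
abbreviation keys :: "('a \<Rightarrow>\<^sub>0 'b::zero) \<Rightarrow> 'a set" where "keys \<equiv> Poly_Mapping.keys"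
abbreviation single :: "'a \<Rightarrow> 'b::zero \<Rightarrow> 'a \<Rightarrow>\<^sub>0 'b" where "single \<equiv> Poly_Mapping.single"
abbreviation map_key :: "('a \<Rightarrow> 'b) \<Rightarrow> ('b \<Rightarrow>\<^sub>0 'c::zero) \<Rightarrow> 'a \<Rightarrow>\<^sub>0 'c" where "map_key \<equiv> Poly_Mapping.map_key"

lemma poly_mapping_sum_singles: "p = (\<Sum>m\<in>keys p. single m (lookup p m))"
proof (rule poly_mapping_eqI)
  fix k
  have "lookup (\<Sum>m\<in>keys p. single m (lookup p m)) k = (\<Sum>m\<in>keys p. if m = k then lookup p m else 0)"
    by (simp add: lookup_sum lookup_single when_def)
  also have "\<dots> = lookup p k" by (simp add: sum.delta in_keys_iff)
  finally show "lookup p k = lookup (\<Sum>m\<in>keys p. single m (lookup p m)) k" by simp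
qed

lemma poly_mapping_additive_induct [case_names single add]:
  fixes p :: "'a \<Rightarrow>\<^sub>0 'b::comm_monoid_add"
  assumes single: "\<And>m c. P (single m c)" and add: "\<And>p q. P p \<Longrightarrow> P q \<Longrightarrow> P (p + q)"
  shows "P p"
proof -
  have "P (\<Sum>m\<in>A. single m (lookup p m))" if "finite A" for A
    using that
  proof (induction A rule: finite_induct)
    case empty
    show ?case using single[of undefined 0] by simp
  qed (simp add: single add)
  from this[of "keys p"] show ?thesis by (simp only: finite_keys poly_mapping_sum_singles[symmetric])
qed

lemma single_prod: "finite A \<Longrightarrow> (\<Prod>i\<in>A. single (a i) (1::'c::comm_semiring_1)) = single (\<Sum>i\<in>A. a i :: 'm::comm_monoid_add) 1"
  by (induction A rule: finite_induct) (simp_all add: mult_single)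

lemma single_power: "single a (1::'c::comm_semiring_1) ^ n = single (\<Sum>_<n. a :: 'm::comm_monoid_add) 1"
  by (induction n) (simp_all add: mult_single add.commute)

lemma sum_const_single: "(\<Sum>_<n. single i (1::nat)) = single i n"
  by (induction n) (simp_all add: single_add[symmetric])

section \<open>Weighted degrees\<close>

text \<open>
  Degrees in \<open>Sym\<close> and in \<open>\<Y>\<^sup>(\<^sup>1\<^sup>)\<close>, as well as the statistics that order monomials in the triangularity
  arguments, are weighted degrees.  Those arguments rest on their additivity.
\<close>

definition wdeg :: "('v \<Rightarrow> nat) \<Rightarrow> ('v \<Rightarrow>\<^sub>0 nat) \<Rightarrow> nat" where
  "wdeg w m = (\<Sum>i\<in>keys m. w i * lookup m i)"

lemma wdeg_0 [simp]: "wdeg w 0 = 0"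
  by (simp add: wdeg_def)

lemma wdeg_add [simp]: "wdeg w (a + b) = wdeg w a + wdeg w b"
  unfolding wdeg_def by (rule setsum_keys_plus_distrib) (simp_all add: algebra_simps)

lemma wdeg_single [simp]: "wdeg w (single i n) = w i * n"
  by (simp add: wdeg_def)

lemma wdeg_sum: "finite A \<Longrightarrow> wdeg w (\<Sum>i\<in>A. f i) = (\<Sum>i\<in>A. wdeg w (f i))"
  by (induction A rule: finite_induct) simp_all

lemma mdeg_eq_wdeg: "mdeg = wdeg (\<lambda>_. 1)"
  by (simp add: mdeg_def wdeg_def fun_eq_iff)

lemma y_grade_eq_wdeg: "y_grade d = {p. \<forall>m\<in>keys p. wdeg Suc m = d}"
  by (simp add: y_grade_def wdeg_def)

section \<open>Homomorphisms out of the polynomial algebra\<close>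

lemma Y_Suc_Suc: "Y (i + 2) = single (single i 1) 1"
  by (simp add: Y_def)

lemma Y_monomial: "single m (c::complex) = single 0 c * (\<Prod>i\<in>keys m. Y (i + 2) ^ lookup m i)"
proof -
  have "(\<Prod>i\<in>keys m. Y (i + 2) ^ lookup m i) = (\<Prod>i\<in>keys m. single (single i (lookup m i)) 1)"
    by (simp only: Y_Suc_Suc single_power sum_const_single)
  also have "\<dots> = single m 1"
    by (simp add: single_prod poly_mapping_sum_singles[symmetric])
  finally show ?thesis by (simp add: mult_single)
qed

definition y_monomial :: "(nat \<Rightarrow> 'r) \<Rightarrow> mono \<Rightarrow> 'r::comm_ring_1" where
  "y_monomial v m = (\<Prod>i\<in>keys m. v (i + 2) ^ lookup m i)"

lemma y_monomial_superset:
  "finite A \<Longrightarrow> keys m \<subseteq> A \<Longrightarrow> y_monomial v m = (\<Prod>i\<in>A. v (i + 2) ^ lookup m i)"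
  unfolding y_monomial_def by (rule prod.mono_neutral_left) (auto simp: in_keys_iff)

lemma y_monomial_0 [simp]: "y_monomial v 0 = 1"
  by (simp add: y_monomial_def)

lemma y_monomial_add: "y_monomial v (a + b) = y_monomial v a * y_monomial v b"
proof -
  let ?A = "keys a \<union> keys b"
  have "keys (a + b) \<subseteq> ?A" by (rule keys_add)
  then show ?thesis
    using y_monomial_superset[of ?A "a + b" v] y_monomial_superset[of ?A a v] y_monomial_superset[of ?A b v]
    by (simp add: lookup_add power_add prod.distrib)
qed

definition ring_hom :: "('a::comm_ring_1 \<Rightarrow> 'b::comm_ring_1) \<Rightarrow> bool" where
  "ring_hom H \<longleftrightarrow> H 1 = 1 \<and> (\<forall>p q. H (p + q) = H p + H q) \<and> (\<forall>p q. H (p * q) = H p * H q)"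

lemma ring_homD:
  assumes "ring_hom H"
  shows "H 1 = 1" "H (p + q) = H p + H q" "H (p * q) = H p * H q"
  using assms by (simp_all add: ring_hom_def)

lemma ring_hom_0: "ring_hom H \<Longrightarrow> H 0 = 0"
  using ring_homD(2)[of H 0 0] by simp

lemma ring_hom_diff:
  assumes "ring_hom H" shows "H (p - q) = H p - H q"
proof -
  have "H p = H (p - q) + H q" using ring_homD(2)[OF assms, of "p - q" q] by simp
  then show ?thesis by simp
qed

lemma ring_hom_sum: "ring_hom H \<Longrightarrow> H (\<Sum>i\<in>A. f i) = (\<Sum>i\<in>A. H (f i))"
  by (induction A rule: infinite_finite_induct) (simp_all add: ring_homD ring_hom_0)

lemma ring_hom_prod: "ring_hom H \<Longrightarrow> H (\<Prod>i\<in>A. f i) = (\<Prod>i\<in>A. H (f i))"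
  by (induction A rule: infinite_finite_induct) (simp_all add: ring_homD)

lemma ring_hom_power: "ring_hom H \<Longrightarrow> H (a ^ n) = H a ^ n"
  by (induction n) (simp_all add: ring_homD)

lemma ring_hom_comp: "ring_hom H \<Longrightarrow> ring_hom G \<Longrightarrow> ring_hom (\<lambda>p. H (G p))"
  by (simp add: ring_hom_def)

lemma ring_hom_single: "ring_hom (single 0 :: 'c::comm_ring_1 \<Rightarrow> 'm::{cancel_comm_monoid_add} \<Rightarrow>\<^sub>0 'c)"
  by (simp add: ring_hom_def single_add mult_single)

lemma y_eval_single:
  assumes "ring_hom emb"
  shows "y_eval emb v (single m c) = emb c * y_monomial v m"
  using ring_hom_0[OF assms] by (simp add: y_eval_def y_monomial_def)

lemma y_eval_add:
  assumes "ring_hom emb"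
  shows "y_eval emb v (p + q) = y_eval emb v p + y_eval emb v q"
  unfolding y_eval_def y_monomial_def[symmetric]
  by (rule setsum_keys_plus_distrib) (simp_all add: ring_hom_0[OF assms] ring_homD[OF assms] distrib_right)

lemma ring_hom_y_eval:
  assumes emb: "ring_hom emb"
  shows "ring_hom (y_eval emb v)"
proof -
  note simps = y_eval_single[OF emb] y_eval_add[OF emb] ring_homD[OF emb]
  have "y_eval emb v (p * q) = y_eval emb v p * y_eval emb v q" for p q
  proof (induction p rule: poly_mapping_additive_induct)
    case (single m c)
    show ?case
    proof (induction q rule: poly_mapping_additive_induct)
      case (single m c)
      show ?case by (simp add: simps mult_single y_monomial_add mult_ac)
    qed (simp add: simps distrib_left)
  qed (simp add: simps distrib_right)
  moreover have "y_eval emb v 1 = 1"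
    using y_eval_single[OF emb, of v 0 1] by (simp add: simps)
  ultimately show ?thesis by (simp add: ring_hom_def simps)
qed

lemma y_eval_Y:
  assumes "ring_hom emb"
  shows "y_eval emb v (Y n) = (if n \<le> 1 then 1 else v n)"
proof (cases "n \<le> 1")
  case True
  then show ?thesis using ring_homD(1)[OF ring_hom_y_eval[OF assms]] by (simp add: Y_def)
next
  case False
  then obtain i where n: "n = i + 2" by (metis add.commute le_add_diff_inverse not_less_eq_eq numeral_2_eq_2 One_nat_def)
  have "y_monomial v (single i 1) = v (i + 2)" by (simp add: y_monomial_def)
  then show ?thesis
    unfolding n Y_Suc_Suc using y_eval_single[OF assms, of v "single i 1" 1] ring_homD(1)[OF assms] by simp
qed

lemma ring_hom_eq_y_eval:
  assumes H: "ring_hom H" and emb: "\<And>c. H (single 0 c) = emb c" "ring_hom emb" and v: "\<And>i. H (Y (i + 2)) = v (i + 2)"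
  shows "H p = y_eval emb v p"
proof (induction p rule: poly_mapping_additive_induct)
  case (single m c)
  have "H (single m c) = H (single 0 c) * (\<Prod>i\<in>keys m. H (Y (i + 2)) ^ lookup m i)"
    by (subst Y_monomial) (simp only: ring_homD[OF H] ring_hom_prod[OF H] ring_hom_power[OF H])
  then show ?case by (simp only: emb(1) v y_eval_single[OF emb(2)] y_monomial_def)
qed (simp add: ring_homD[OF H] y_eval_add[OF emb(2)])

text \<open>
  Agreement on scalars and generators suffices; both sides are evaluations of polynomials.
\<close>

lemma ring_hom_y_ext:
  assumes H: "ring_hom H" and G: "ring_hom G"
    and "\<And>c. H (single 0 c) = G (single 0 c)" "\<And>n. n \<ge> 2 \<Longrightarrow> H (Y n) = G (Y n)"
  shows "H p = (G p :: 'r::comm_ring_1)"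
proof -
  have emb: "ring_hom (\<lambda>c. G (single 0 c))" by (rule ring_hom_comp[OF G ring_hom_single])
  have "H p = y_eval (\<lambda>c. G (single 0 c)) (\<lambda>n. G (Y n)) p"
    by (rule ring_hom_eq_y_eval[OF H _ emb]) (simp_all add: assms)
  also have "\<dots> = G p"
    by (rule ring_hom_eq_y_eval[OF G _ emb, symmetric]) simp_all
  finally show ?thesis .
qed

section \<open>Power series\<close>

lemma mcoeff_0 [simp]: "mcoeff 0 m = 0"
  and mcoeff_1: "mcoeff 1 m = (if m = 0 then 1 else 0)"
  and mcoeff_add [simp]: "mcoeff (f + g) m = mcoeff f m + mcoeff g m"
  and mcoeff_diff [simp]: "mcoeff (f - g) m = mcoeff f m - mcoeff g m"
  and mcoeff_mult: "mcoeff (f * g) m = (\<Sum>(a, b) | a + b = m. mcoeff f a * mcoeff g b)"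
  and mcoeff_mscale [simp]: "mcoeff (mscale c f) m = c * mcoeff f m"
  by (simp_all add: zero_mser_def one_mser_def plus_mser_def minus_mser_def times_mser_def mscale_def)

lemma mcoeff_sum: "mcoeff (\<Sum>i\<in>A. f i) m = (\<Sum>i\<in>A. mcoeff (f i) m)"
  by (induction A rule: infinite_finite_induct) simp_all

lemma mcoeff_mult_nonzero:
  assumes "mcoeff (f * g) m \<noteq> 0"
  obtains a b where "a + b = m" "mcoeff f a \<noteq> 0" "mcoeff g b \<noteq> 0"
proof -
  from assms obtain x where "x \<in> {(a, b). a + b = m}" "(case x of (a, b) \<Rightarrow> mcoeff f a * mcoeff g b) \<noteq> 0"
    unfolding mcoeff_mult by (rule sum.not_neutral_contains_not_neutral)
  then show thesis using that by auto
qed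

lemma mscale_mult_left: "mscale c f * g = mscale c (f * g)"
  by (rule mser_eqI) (simp add: mcoeff_mult sum_distrib_left case_prod_unfold mult.assoc)

lemma mscale_eq_mult: "mscale c f = mscale c 1 * f"
  by (simp add: mscale_mult_left)

lemma ring_hom_mscale: "ring_hom (\<lambda>c. mscale c (1 :: 'v mser))"
proof -
  have "mscale (a * b) 1 = mscale a 1 * mscale b (1 :: 'v mser)" for a b
    by (rule mser_eqI) (simp add: mscale_mult_left mult.assoc)
  moreover have "mscale (a + b) 1 = mscale a 1 + mscale b (1 :: 'v mser)" for a b
    by (rule mser_eqI) (simp add: distrib_right)
  moreover have "mscale 1 1 = (1 :: 'v mser)" by (rule mser_eqI) simp
  ultimately show ?thesis by (simp add: ring_hom_def)
qed

section \<open>Renaming variables in power series\<close>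

lemma lookup_map_key: "inj s \<Longrightarrow> lookup (map_key s m) i = lookup m (s i)"
  by (simp add: Poly_Mapping.map_key.rep_eq)

lemma map_key_inverse:
  assumes "bij s"
  shows "map_key s (map_key (inv s) a) = a" "map_key (inv s) (map_key s b) = b"
proof -
  have inj: "inj s" "inj (inv s)" using assms by (simp_all add: bij_is_inj bij_imp_bij_inv)
  show "map_key s (map_key (inv s) a) = a" "map_key (inv s) (map_key s b) = b"
    using assms by (auto intro!: poly_mapping_eqI simp: lookup_map_key inj bij_is_inj bij_is_surj surj_f_inv_f)
qed

definition relabel :: "('u \<Rightarrow> 'v) \<Rightarrow> 'u mser \<Rightarrow> 'v mser" where
  "relabel s f = Abs_mser (\<lambda>m. mcoeff f (map_key s m))"

lemma mcoeff_relabel [simp]: "mcoeff (relabel s f) m = mcoeff f (map_key s m)"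
  by (simp add: relabel_def)

lemma ring_hom_relabel:
  fixes s :: "'u \<Rightarrow> 'v"
  assumes s: "bij s"
  shows "ring_hom (relabel s)"
proof -
  have inj: "inj s" "inj (inv s)" using s by (simp_all add: bij_is_inj bij_imp_bij_inv)
  have "relabel s (f * g) = relabel s f * relabel s g" for f g
  proof (rule mser_eqI)
    fix m
    have "(\<Sum>(a, b) | a + b = map_key s m. mcoeff f a * mcoeff g b) =
        (\<Sum>(a, b) | a + b = m. mcoeff f (map_key s a) * mcoeff g (map_key s b))"
      by (rule sum.reindex_bij_witness[of _ "\<lambda>(a, b). (map_key s a, map_key s b)"
            "\<lambda>(a, b). (map_key (inv s) a, map_key (inv s) b)"])
        (auto simp: map_key_inverse[OF s] map_key_plus[OF inj(1), symmetric] map_key_plus[OF inj(2), symmetric])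
    then show "mcoeff (relabel s (f * g)) m = mcoeff (relabel s f * relabel s g) m"
      by (simp add: mcoeff_mult)
  qed
  moreover have "map_key s m = 0 \<longleftrightarrow> m = 0" for m :: "'v \<Rightarrow>\<^sub>0 nat"
    using map_key_inverse(2)[OF s, of m] map_key_zero[OF inj(1)] map_key_zero[OF inj(2)] by metis
  then have "relabel s 1 = 1" by (auto intro!: mser_eqI simp: mcoeff_1)
  moreover have "relabel s (f + g) = relabel s f + relabel s g" for f g
    by (rule mser_eqI) simp
  ultimately show ?thesis by (simp add: ring_hom_def)
qed

lemma relabel_mscale: "relabel s (mscale c f) = mscale c (relabel s f)"
  by (rule mser_eqI) simp

section \<open>Symmetric functions\<close>

definition bounded_deg :: "nat \<Rightarrow> 'v mser \<Rightarrow> bool" where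
  "bounded_deg d f \<longleftrightarrow> (\<forall>m. mcoeff f m \<noteq> 0 \<longrightarrow> mdeg m \<le> d)"

lemma bounded_degD: "bounded_deg d f \<Longrightarrow> mcoeff f m \<noteq> 0 \<Longrightarrow> mdeg m \<le> d"
  by (simp add: bounded_deg_def)

lemma Sym_iff: "f \<in> Sym \<longleftrightarrow> (\<exists>d. bounded_deg d f) \<and> (\<forall>s. bij s \<longrightarrow> relabel s f = f)"
proof -
  have "(relabel s f = f) \<longleftrightarrow> (\<forall>m. mcoeff f (map_key s m) = mcoeff f m)" for s
    by (metis mcoeff_relabel mser_eqI)
  then show ?thesis unfolding Sym_def bounded_deg_def by auto
qed

lemma bounded_deg_mono: "bounded_deg d f \<Longrightarrow> d \<le> e \<Longrightarrow> bounded_deg e f"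
  unfolding bounded_deg_def using le_trans by blast

lemma bounded_deg_add: "bounded_deg d f \<Longrightarrow> bounded_deg d g \<Longrightarrow> bounded_deg d (f + g)"
  unfolding bounded_deg_def by (metis add.right_neutral mcoeff_add)

lemma bounded_deg_mult:
  assumes f: "bounded_deg d f" and g: "bounded_deg e g"
  shows "bounded_deg (d + e) (f * g)"
  unfolding bounded_deg_def
proof (intro allI impI)
  fix m assume "mcoeff (f * g) m \<noteq> 0"
  then obtain a b where "a + b = m" "mcoeff f a \<noteq> 0" "mcoeff g b \<noteq> 0" by (rule mcoeff_mult_nonzero)
  then show "mdeg m \<le> d + e"
    using bounded_degD[OF f] bounded_degD[OF g] by (auto simp: mdeg_eq_wdeg intro!: add_mono)
qed

lemma bounded_deg_mscale: "bounded_deg d f \<Longrightarrow> bounded_deg d (mscale c f)"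
  by (auto simp: bounded_deg_def)

lemma Sym_add:
  assumes "f \<in> Sym" "g \<in> Sym"
  shows "f + g \<in> Sym"
proof -
  obtain d e where "bounded_deg d f" "bounded_deg e g" using assms by (auto simp: Sym_iff)
  then have "bounded_deg (max d e) (f + g)"
    by (intro bounded_deg_add) (erule bounded_deg_mono, simp)+
  then show ?thesis using assms by (auto simp: Sym_iff ring_homD(2)[OF ring_hom_relabel])
qed

lemma Sym_mult:
  assumes "f \<in> Sym" "g \<in> Sym"
  shows "f * g \<in> Sym"
  using assms by (auto simp: Sym_iff ring_homD(3)[OF ring_hom_relabel] intro: bounded_deg_mult)

lemma Sym_mscale: "f \<in> Sym \<Longrightarrow> mscale c f \<in> Sym"
  by (auto simp: Sym_iff relabel_mscale intro: bounded_deg_mscale)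

lemma Sym_1: "1 \<in> Sym"
proof -
  have "bounded_deg 0 (1 :: nat mser)" by (simp add: bounded_deg_def mcoeff_1 mdeg_def)
  then show ?thesis by (auto simp: Sym_iff ring_homD(1)[OF ring_hom_relabel])
qed

lemma Sym_0: "0 \<in> Sym"
  using Sym_mscale[OF Sym_1, of 0] by (metis mcoeff_0 mcoeff_mscale mser_eqI mult_zero_left)

lemma Sym_diff: "f \<in> Sym \<Longrightarrow> g \<in> Sym \<Longrightarrow> f - g \<in> Sym"
proof -
  assume "f \<in> Sym" "g \<in> Sym"
  then have "f + mscale (-1) g \<in> Sym" by (intro Sym_add Sym_mscale)
  also have "f + mscale (-1) g = f - g" by (rule mser_eqI) simp
  finally show ?thesis .
qed

lemma Sym_sum: "(\<And>i. i \<in> A \<Longrightarrow> f i \<in> Sym) \<Longrightarrow> (\<Sum>i\<in>A. f i) \<in> Sym"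
  by (induction A rule: infinite_finite_induct) (auto intro: Sym_add Sym_0)

lemma Sym_prod: "(\<And>i. i \<in> A \<Longrightarrow> f i \<in> Sym) \<Longrightarrow> (\<Prod>i\<in>A. f i) \<in> Sym"
  by (induction A rule: infinite_finite_induct) (auto intro: Sym_mult Sym_1)

lemma Sym_power: "f \<in> Sym \<Longrightarrow> f ^ n \<in> Sym"
  by (induction n) (auto intro: Sym_mult Sym_1)

lemma mcoeff_esym:
  "mcoeff (esym n) m = (if (\<forall>i. lookup m i \<le> 1) \<and> card (keys m) = n then 1 else 0)"
  by (simp add: esym_def)

definition homogeneous :: "nat \<Rightarrow> 'v mser \<Rightarrow> bool" where
  "homogeneous d f \<longleftrightarrow> (\<forall>m. mcoeff f m \<noteq> 0 \<longrightarrow> mdeg m = d)"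

lemma homogeneousD: "homogeneous d f \<Longrightarrow> mcoeff f m \<noteq> 0 \<Longrightarrow> mdeg m = d"
  by (simp add: homogeneous_def)

lemma homogeneous_bounded: "homogeneous d f \<Longrightarrow> bounded_deg d f"
  by (auto simp: homogeneous_def bounded_deg_def)

lemma homogeneous_1: "homogeneous 0 1"
  by (simp add: homogeneous_def mcoeff_1 mdeg_def)

lemma homogeneous_mult:
  assumes f: "homogeneous d f" and g: "homogeneous e g"
  shows "homogeneous (d + e) (f * g)"
  unfolding homogeneous_def
proof (intro allI impI)
  fix m assume "mcoeff (f * g) m \<noteq> 0"
  then obtain a b where "a + b = m" "mcoeff f a \<noteq> 0" "mcoeff g b \<noteq> 0" by (rule mcoeff_mult_nonzero)
  then show "mdeg m = d + e" using homogeneousD[OF f] homogeneousD[OF g] by (auto simp: mdeg_eq_wdeg)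
qed

lemma homogeneous_prod:
  "finite A \<Longrightarrow> (\<And>i. i \<in> A \<Longrightarrow> homogeneous (d i) (f i)) \<Longrightarrow> homogeneous (\<Sum>i\<in>A. d i) (\<Prod>i\<in>A. f i)"
  by (induction A rule: finite_induct) (auto intro: homogeneous_mult homogeneous_1)

lemma homogeneous_power: "homogeneous d f \<Longrightarrow> homogeneous (n * d) (f ^ n)"
  by (induction n) (auto intro: homogeneous_mult homogeneous_1)

lemma homogeneous_sum:
  assumes "\<And>i. i \<in> A \<Longrightarrow> homogeneous d (f i)"
  shows "homogeneous d (\<Sum>i\<in>A. f i)"
  unfolding homogeneous_def mcoeff_sum
proof (intro allI impI)
  fix m assume "(\<Sum>i\<in>A. mcoeff (f i) m) \<noteq> 0"
  then obtain i where "i \<in> A" "mcoeff (f i) m \<noteq> 0" by (rule sum.not_neutral_contains_not_neutral)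
  then show "mdeg m = d" using homogeneousD[OF assms] by blast
qed

lemma homogeneous_esym: "homogeneous n (esym n)"
  unfolding homogeneous_def mcoeff_esym
proof (intro allI impI)
  fix m :: "nat \<Rightarrow>\<^sub>0 nat"
  assume "(if (\<forall>i. lookup m i \<le> 1) \<and> card (keys m) = n then 1 else (0::complex)) \<noteq> 0"
  then have m: "\<And>i. lookup m i \<le> 1" "card (keys m) = n" by (auto split: if_splits)
  have "mdeg m = (\<Sum>i\<in>keys m. 1)"
    unfolding mdeg_def using m(1) by (intro sum.cong refl) (metis in_keys_iff le_antisym less_one linorder_not_le)
  then show "mdeg m = n" using m(2) by simp
qed

lemma esym_Sym: "esym n \<in> Sym"
proof -
  have "relabel s (esym n) = esym n" if s: "bij s" for s
  proof (rule mser_eqI)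
    fix m :: "nat \<Rightarrow>\<^sub>0 nat"
    have inj: "inj s" using s by (rule bij_is_inj)
    have "keys (map_key s m) = s -` keys m" by (rule keys_map_key[OF inj])
    then have "card (keys (map_key s m)) = card (keys m)"
      using s by (simp add: card_vimage_inj bij_is_inj bij_is_surj)
    moreover have "(\<forall>i. lookup m (s i) \<le> 1) \<longleftrightarrow> (\<forall>i. lookup m i \<le> 1)"
      using bij_is_surj[OF s] by (metis surj_def)
    ultimately show "mcoeff (relabel s (esym n)) m = mcoeff (esym n) m"
      by (simp add: mcoeff_esym lookup_map_key[OF inj])
  qed
  then show ?thesis using homogeneous_bounded[OF homogeneous_esym[of n]] by (auto simp: Sym_iff)
qed

lemma esym_0 [simp]: "esym 0 = 1"
proof (rule mser_eqI)
  fix m :: "nat \<Rightarrow>\<^sub>0 nat"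
  have "card (keys m) = 0 \<longleftrightarrow> m = 0" by simp
  then show "mcoeff (esym 0) m = mcoeff 1 m" by (auto simp: mcoeff_esym mcoeff_1)
qed

lemma y_sym_Sym: "y_sym n \<in> Sym"
  unfolding y_sym_def by (intro Sym_sum Sym_prod esym_Sym)

lemma homogeneous_y_sym: "homogeneous (n - 1) (y_sym n)"
  unfolding y_sym_def
proof (rule homogeneous_sum)
  fix \<pi> assume "\<pi> \<in> NC (n - 1)"
  then have part: "partition_on {1..n - 1} \<pi>" by (simp add: NC_def)
  then have fin: "finite \<pi>" using finite_elements by blast
  have "finite A" if "A \<in> \<pi>" for A
    using partition_onD1[OF part] that finite_subset[of A "{1..n - 1}"] by blast
  then have "(\<Sum>A\<in>\<pi>. card A) = n - 1"
    using product_partition[OF part] by simp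
  moreover have "homogeneous (\<Sum>A\<in>\<pi>. card A) (\<Prod>A\<in>\<pi>. esym (card A))"
    by (rule homogeneous_prod[OF fin homogeneous_esym])
  ultimately show "homogeneous (n - 1) (\<Prod>A\<in>\<pi>. esym (card A))" by simp
qed

section \<open>Leading monomials\<close>

text \<open>
  The leading monomial is the one of least weighted degree.  It has to be the least one: a power series
  in infinitely many variables need not have a monomial of greatest weight.
\<close>

definition leads :: "('v \<Rightarrow> nat) \<Rightarrow> 'v mser \<Rightarrow> ('v \<Rightarrow>\<^sub>0 nat) \<Rightarrow> bool" where
  "leads w f l \<longleftrightarrow> mcoeff f l = 1 \<and> (\<forall>m. mcoeff f m \<noteq> 0 \<longrightarrow> m \<noteq> l \<longrightarrow> wdeg w l < wdeg w m)"

lemma leads_1: "leads w 1 0"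
  by (simp add: leads_def mcoeff_1)

text \<open>
  By additivity of the weight, a product of a monomial of \<open>f\<close> and one of \<open>g\<close> has weight
  \<open>wdeg w k + wdeg w l\<close> only if both factors lead, so the leading term of the product does not cancel.
\<close>

lemma leads_mult:
  assumes f: "leads w f k" and g: "leads w g l"
  shows "leads w (f * g) (k + l)"
proof -
  have both: "a = k \<and> b = l \<or> wdeg w (k + l) < wdeg w (a + b)" if "mcoeff f a \<noteq> 0" "mcoeff g b \<noteq> 0" for a b
  proof (cases "a = k \<and> b = l")
    case False
    have "a = k \<or> wdeg w k < wdeg w a" "b = l \<or> wdeg w l < wdeg w b"
      using f g that by (auto simp: leads_def)
    with False show ?thesis by auto
  qed simp
  have "mcoeff (f * g) (k + l) = (\<Sum>(a, b)\<in>{(k, l)}. mcoeff f a * mcoeff g b)"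
    unfolding mcoeff_mult
  proof (rule sum.mono_neutral_right[OF finite_decomp])
    show "\<forall>x\<in>{(a, b). a + b = k + l} - {(k, l)}. (case x of (a, b) \<Rightarrow> mcoeff f a * mcoeff g b) = 0"
    proof
      fix x assume x: "x \<in> {(a, b). a + b = k + l} - {(k, l)}"
      obtain a b where ab: "x = (a, b)" by (rule prod.exhaust)
      have "a + b = k + l" "\<not> (a = k \<and> b = l)" using x by (simp_all add: ab)
      then have "\<not> (mcoeff f a \<noteq> 0 \<and> mcoeff g b \<noteq> 0)" using both[of a b] by (metis less_irrefl)
      then show "(case x of (a, b) \<Rightarrow> mcoeff f a * mcoeff g b) = 0" by (auto simp: ab)
    qed
  qed simp
  then have "mcoeff (f * g) (k + l) = 1" using f g by (simp add: leads_def)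
  moreover have "wdeg w (k + l) < wdeg w m" if nz: "mcoeff (f * g) m \<noteq> 0" and "m \<noteq> k + l" for m
  proof -
    obtain a b where "a + b = m" "mcoeff f a \<noteq> 0" "mcoeff g b \<noteq> 0"
      using nz by (rule mcoeff_mult_nonzero)
    then show ?thesis using both[of a b] that(2) by blast
  qed
  ultimately show ?thesis by (simp add: leads_def)
qed

lemma leads_power: "leads w f l \<Longrightarrow> leads w (f ^ n) (\<Sum>_<n. l)"
  by (induction n) (simp_all add: leads_1 leads_mult add.commute)

lemma leads_prod:
  "finite A \<Longrightarrow> (\<And>i. i \<in> A \<Longrightarrow> leads w (f i) (l i)) \<Longrightarrow> leads w (\<Prod>i\<in>A. f i) (\<Sum>i\<in>A. l i)"
  by (induction A rule: finite_induct) (auto intro: leads_mult leads_1)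

lemma sum_less_initial_segment:
  fixes K :: "nat set"
  assumes "finite K" "card K = n" "K \<noteq> {..<n}"
  shows "\<Sum>{..<n} < \<Sum>K"
  using assms
proof (induction n arbitrary: K)
  case (Suc n)
  define x where "x = Max K"
  have x: "x \<in> K" using Suc.prems by (auto simp: x_def intro: Max_in)
  have "K \<subseteq> {..x}" using Suc.prems by (auto simp: x_def)
  then have "card K \<le> Suc x" using card_mono[of "{..x}" K] by simp
  then have nx: "n \<le> x" using Suc.prems by simp
  have sum: "\<Sum>K = x + \<Sum>(K - {x})" using x Suc.prems by (simp add: sum.remove)
  show ?case
  proof (cases "K - {x} = {..<n}")
    case True
    then have "x \<noteq> n" using Suc.prems(3) x by (auto simp: lessThan_Suc)
    then show ?thesis using sum True nx by simp
  next
    case False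
    then have "\<Sum>{..<n} < \<Sum>(K - {x})" using Suc.prems x by (intro Suc.IH) auto
    then show ?thesis using sum nx by simp
  qed
qed simp

definition staircase :: "nat \<Rightarrow> nat \<Rightarrow>\<^sub>0 nat" where
  "staircase n = (\<Sum>j<n. single j 1)"

lemma lookup_staircase: "lookup (staircase n) j = (if j < n then 1 else 0)"
  by (simp add: staircase_def lookup_sum lookup_single when_def)

text \<open>
  The sum of \<open>n\<close> distinct indices is least for \<open>0, \<dots>, n - 1\<close>.
\<close>

lemma leads_esym: "leads id (esym n) (staircase n)"
proof -
  have keys: "keys (staircase n) = {..<n}" by (auto simp: in_keys_iff lookup_staircase split: if_splits)
  have wdeg: "wdeg id m = \<Sum>(keys m)" if "\<And>i. lookup m i \<le> 1" for m :: "nat \<Rightarrow>\<^sub>0 nat"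
    unfolding wdeg_def using that
    by (intro sum.cong refl) (metis in_keys_iff le_antisym less_one linorder_not_le id_apply mult.right_neutral)
  have "wdeg id (staircase n) < wdeg id m" if m: "mcoeff (esym n) m \<noteq> 0" "m \<noteq> staircase n" for m
  proof -
    have m': "\<And>i. lookup m i \<le> 1" "card (keys m) = n" using m(1) by (auto simp: mcoeff_esym split: if_splits)
    have "keys m \<noteq> {..<n}"
    proof
      assume k: "keys m = {..<n}"
      have "lookup m i = lookup (staircase n) i" for i
      proof (cases "i < n")
        case True
        then have "i \<in> keys m" using k by simp
        then have "lookup m i \<noteq> 0" by (simp only: in_keys_iff not_False_eq_True)
        then have "lookup m i = 1" using m'(1)[of i] by linarith
        then show ?thesis using True by (simp add: lookup_staircase)
      next
        case False
        then have "i \<notin> keys m" using k by simp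
        then have "lookup m i = 0" by (simp only: not_in_keys_iff_lookup_eq_zero)
        then show ?thesis using False by (simp add: lookup_staircase)
      qed
      then show False using m(2) poly_mapping_eqI by blast
    qed
    then have "\<Sum>{..<n} < \<Sum>(keys m)" using m'(2) by (intro sum_less_initial_segment) auto
    then show ?thesis using wdeg[of m] wdeg[of "staircase n"] m'(1) keys by (simp add: lookup_staircase)
  qed
  then show ?thesis by (auto simp: leads_def mcoeff_esym keys lookup_staircase)
qed

section \<open>Elementary symmetric functions are polynomial generators\<close>

abbreviation mconst :: "complex \<Rightarrow> 'v mser" where "mconst c \<equiv> mscale c 1"

lemma mcoeff_y_eval:
  "mcoeff (y_eval mconst v p) \<mu> = (\<Sum>m\<in>keys p. lookup p m * mcoeff (y_monomial v m) \<mu>)"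
  unfolding y_eval_def y_monomial_def[symmetric] mcoeff_sum
  by (simp add: mscale_eq_mult[symmetric])

lemma y_eval_single_mscale: "y_eval mconst v (single m c) = mscale c (y_monomial v m)"
  unfolding y_eval_single[OF ring_hom_mscale] by (simp add: mscale_eq_mult[symmetric])

lemma homogeneous_y_monomial:
  assumes "\<And>n. homogeneous (n - 1) (v n)"
  shows "homogeneous (wdeg Suc m) (y_monomial v m)"
proof -
  have "homogeneous (\<Sum>i\<in>keys m. lookup m i * (i + 2 - 1)) (y_monomial v m)"
    unfolding y_monomial_def by (intro homogeneous_prod homogeneous_power assms) simp
  also have "(\<Sum>i\<in>keys m. lookup m i * (i + 2 - 1)) = wdeg Suc m"
    unfolding wdeg_def by (intro sum.cong) auto
  finally show ?thesis .
qed

lemma y_eval_Sym: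
  assumes "\<And>n. v n \<in> Sym"
  shows "y_eval mconst v p \<in> Sym"
  unfolding y_eval_def
  by (intro Sym_sum Sym_mult Sym_prod Sym_power Sym_mscale Sym_1 assms)

text \<open>
  The elementary symmetric functions as values for the generators \<open>Y\<^sub>n\<close>, which represent degree \<open>n - 1\<close>.
\<close>

definition e_gen :: "nat \<Rightarrow> nat mser" where
  "e_gen n = esym (n - 1)"

lemma e_gen_Sym: "e_gen n \<in> Sym"
  by (simp add: e_gen_def esym_Sym)

lemma homogeneous_e_gen: "homogeneous (n - 1) (e_gen n)"
  unfolding e_gen_def by (rule homogeneous_esym)

text \<open>
  A monomial in the \<open>e\<^sub>k\<close> is a partition whose parts are the indices \<open>k\<close>.  The product of the leading
  monomials \<open>x\<^sub>0 \<dots> x\<^bsub>k-1\<^esub>\<close> has as exponents the parts of the conjugate partition.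
\<close>

definition conjugate_exp :: "mono \<Rightarrow> mono" where
  "conjugate_exp m = (\<Sum>i\<in>keys m. \<Sum>_<lookup m i. staircase (i + 1))"

lemma leads_e_monomial: "leads id (y_monomial e_gen m) (conjugate_exp m)"
  unfolding y_monomial_def conjugate_exp_def
proof (rule leads_prod)
  fix i
  have "leads id (e_gen (i + 2)) (staircase (i + 1))" using leads_esym[of "i + 1"] by (simp add: e_gen_def)
  then show "leads id (e_gen (i + 2) ^ lookup m i) (\<Sum>_<lookup m i. staircase (i + 1))"
    by (rule leads_power)
qed simp

lemma lookup_conjugate_exp: "lookup (conjugate_exp m) j = (\<Sum>i\<in>keys m. if j \<le> i then lookup m i else 0)"
  unfolding conjugate_exp_def lookup_sum lookup_staircase by (intro sum.cong refl) auto

text \<open>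
  The multiplicity of \<open>e\<^bsub>j+1\<^esub>\<close> is the drop of the conjugate partition at \<open>j\<close>, which makes conjugation
  invertible.
\<close>

lemma conjugate_exp_step: "lookup (conjugate_exp m) j = lookup m j + lookup (conjugate_exp m) (Suc j)"
proof -
  have "lookup (conjugate_exp m) j =
      (\<Sum>i\<in>keys m. (if i = j then lookup m i else 0) + (if Suc j \<le> i then lookup m i else 0))"
    unfolding lookup_conjugate_exp by (intro sum.cong refl) auto
  also have "\<dots> = (\<Sum>i\<in>keys m. if i = j then lookup m i else 0) + lookup (conjugate_exp m) (Suc j)"
    by (simp add: sum.distrib lookup_conjugate_exp)
  also have "(\<Sum>i\<in>keys m. if i = j then lookup m i else 0) = lookup m j"
    by (simp add: sum.delta' in_keys_iff)
  finally show ?thesis .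
qed

lemma inj_conjugate_exp: "inj conjugate_exp"
proof (rule injI)
  fix m n assume "conjugate_exp m = conjugate_exp n"
  then have "lookup m j = lookup n j" for j
    using conjugate_exp_step[of m j] conjugate_exp_step[of n j] by simp
  then show "m = n" by (rule poly_mapping_eqI)
qed

definition decreasing_exp :: "mono \<Rightarrow> bool" where
  "decreasing_exp k \<longleftrightarrow> (\<forall>j. lookup k (Suc j) \<le> lookup k j)"

lemma poly_mapping_eventually_0:
  fixes k :: "nat \<Rightarrow>\<^sub>0 'a::zero"
  obtains N where "\<And>j. N \<le> j \<Longrightarrow> lookup k j = 0"
proof -
  have "lookup k j = 0" if "Suc (Max (insert 0 (keys k))) \<le> j" for j
  proof (rule ccontr)
    assume "lookup k j \<noteq> 0"
    then have "j \<in> keys k" by (simp only: in_keys_iff not_False_eq_True)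
    then have "j \<le> Max (insert 0 (keys k))" by (intro Max_ge) auto
    then show False using that by simp
  qed
  then show thesis using that by blast
qed

text \<open>
  The exponents are recovered by downward induction from an index beyond which both sides vanish.
\<close>

lemma conjugate_exp_surj:
  assumes k: "decreasing_exp k"
  shows "\<exists>m. conjugate_exp m = k"
proof -
  define m where "m = Abs_poly_mapping (\<lambda>j. lookup k j - lookup k (Suc j))"
  have "finite {j. lookup k j - lookup k (Suc j) \<noteq> 0}"
    by (rule finite_subset[of _ "keys k"]) (auto simp: in_keys_iff)
  then have m: "lookup m j = lookup k j - lookup k (Suc j)" for j by (simp add: m_def)
  obtain N where N: "\<And>j. N \<le> j \<Longrightarrow> lookup k j = 0" using poly_mapping_eventually_0[of k] by blast
  obtain M where M: "\<And>j. M \<le> j \<Longrightarrow> lookup (conjugate_exp m) j = 0" using poly_mapping_eventually_0 by blast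
  have "lookup (conjugate_exp m) j = lookup k j" for j
  proof -
    define L where "L = max j (max M N)"
    have "j \<le> L" by (simp add: L_def)
    then show ?thesis
    proof (induction rule: inc_induct)
      case base
      show ?case using N[of L] M[of L] by (simp add: L_def)
    next
      case (step n)
      have "lookup k (Suc n) \<le> lookup k n" using k by (simp add: decreasing_exp_def)
      then show ?case using conjugate_exp_step[of m n] step.IH by (simp add: m)
    qed
  qed
  then show ?thesis by (blast intro: poly_mapping_eqI)
qed

text \<open>
  Exponents are sorted by adjacent transpositions: exchanging \<open>m\<^sub>j < m\<^bsub>j+1\<^esub>\<close> lowers the weight \<open>\<Sum> j m\<^sub>j\<close> and
  does not change the coefficient in a symmetric function.
\<close>

lemma Sym_zero_if_decreasing_zero:
  assumes f: "f \<in> Sym" and dec: "\<And>k. decreasing_exp k \<Longrightarrow> mcoeff f k = 0"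
  shows "f = 0"
proof (rule mser_eqI)
  fix m
  show "mcoeff f m = mcoeff 0 m"
  proof (induction "wdeg id m" arbitrary: m rule: less_induct)
    case less
    show ?case
    proof (cases "decreasing_exp m")
      case True
      then show ?thesis by (simp add: dec)
    next
      case False
      then obtain j where j: "lookup m j < lookup m (Suc j)" by (auto simp: decreasing_exp_def not_le)
      let ?a = "lookup m j" and ?b = "lookup m (Suc j)"
      define s where "s = (\<lambda>i. if i = j then Suc j else if i = Suc j then j else i)"
      define r where "r = m - single j ?a - single (Suc j) ?b"
      have bij: "bij s" by (rule involuntory_imp_bij) (auto simp: s_def)
      have m_eq: "m = r + single j ?a + single (Suc j) ?b"
        by (rule poly_mapping_eqI) (auto simp: r_def lookup_add lookup_minus lookup_single when_def)
      have m'_eq: "map_key s m = r + single j ?b + single (Suc j) ?a"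
        by (rule poly_mapping_eqI)
          (simp only: lookup_map_key[OF bij_is_inj[OF bij]],
            auto simp: r_def lookup_add lookup_minus lookup_single when_def s_def)
      have "wdeg id m = wdeg id r + j * ?a + Suc j * ?b"
        by (subst m_eq) simp
      moreover have "wdeg id (map_key s m) = wdeg id r + j * ?b + Suc j * ?a"
        by (subst m'_eq) simp
      ultimately have "wdeg id (map_key s m) < wdeg id m" using j by simp
      then have "mcoeff f (map_key s m) = 0" using less.hyps by simp
      then show ?thesis using f bij by (simp add: Sym_def)
    qed
  qed
qed

text \<open>
  The leading monomial of least weight among those of the terms of \<open>p\<close> cannot be cancelled, because distinct
  monomials in the \<open>e\<^sub>k\<close> have distinct leading monomials.
\<close>

lemma e_eval_inj:
  assumes "y_eval mconst e_gen p = 0"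
  shows "p = 0"
proof (rule ccontr)
  assume "p \<noteq> 0"
  then have ne: "keys p \<noteq> {}" by simp
  define m where "m = arg_min_on (\<lambda>m. wdeg id (conjugate_exp m)) (keys p)"
  have m: "m \<in> keys p" unfolding m_def by (rule arg_min_if_finite(1)[OF finite_keys ne])
  have min: "wdeg id (conjugate_exp m) \<le> wdeg id (conjugate_exp m')" if "m' \<in> keys p" for m'
    unfolding m_def by (rule arg_min_least[OF finite_keys ne that])
  have zero: "mcoeff (y_monomial e_gen m') (conjugate_exp m) = 0" if "m' \<in> keys p" "m' \<noteq> m" for m'
  proof (rule ccontr)
    assume nz: "mcoeff (y_monomial e_gen m') (conjugate_exp m) \<noteq> 0"
    have "conjugate_exp m \<noteq> conjugate_exp m'" using that(2) inj_conjugate_exp by (auto dest: injD)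
    then have "wdeg id (conjugate_exp m') < wdeg id (conjugate_exp m)"
      using leads_e_monomial[of m'] nz by (simp add: leads_def)
    then show False using min[OF that(1)] by simp
  qed
  have "0 = mcoeff (y_eval mconst e_gen p) (conjugate_exp m)" using assms by simp
  also have "\<dots> = (\<Sum>m'\<in>{m}. lookup p m' * mcoeff (y_monomial e_gen m') (conjugate_exp m))"
    unfolding mcoeff_y_eval by (rule sum.mono_neutral_right) (use m zero in auto)
  also have "\<dots> = lookup p m" using leads_e_monomial[of m] by (simp add: leads_def)
  finally show False using m by (simp add: in_keys_iff)
qed

lemma decreasing_exp_antimono:
  assumes k: "decreasing_exp k" and "i \<le> j"
  shows "lookup k j \<le> lookup k i"
  by (rule lift_Suc_antimono_le[of "lookup k", OF _ assms(2)]) (use k in \<open>simp only: decreasing_exp_def\<close>)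

text \<open>
  A decreasing exponent that involves a variable involves all earlier ones.
\<close>

lemma decreasing_exp_keys:
  assumes k: "decreasing_exp k" and d: "mdeg k \<le> d"
  shows "keys k \<subseteq> {..<d}"
proof
  fix j assume j: "j \<in> keys k"
  have "{..j} \<subseteq> keys k"
  proof
    fix i assume "i \<in> {..j}"
    then have "lookup k j \<le> lookup k i" using decreasing_exp_antimono[OF k] by simp
    then show "i \<in> keys k" using j by (auto simp: in_keys_iff)
  qed
  then have "card {..j} \<le> card (keys k)" by (rule card_mono[OF finite_keys])
  also have "\<dots> = (\<Sum>i\<in>keys k. 1)" by simp
  also have "\<dots> \<le> mdeg k" unfolding mdeg_def by (rule sum_mono) (auto simp: in_keys_iff)
  finally show "j \<in> {..<d}" using d by simp
qed

lemma lookup_le_mdeg: "lookup k i \<le> mdeg k"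
proof (cases "i \<in> keys k")
  case True
  then show ?thesis unfolding mdeg_def by (intro member_le_sum) auto
next
  case False
  then have "lookup k i = 0" by (simp only: not_in_keys_iff_lookup_eq_zero)
  then show ?thesis by simp
qed

lemma finite_decreasing_exp: "finite {k. decreasing_exp k \<and> mdeg k \<le> d}"
proof -
  let ?F = "{f. \<forall>i. (i \<in> {..<d} \<longrightarrow> f i \<in> {..d}) \<and> (i \<notin> {..<d} \<longrightarrow> f i = (0::nat))}"
  have "lookup k \<in> ?F" if k: "decreasing_exp k" "mdeg k \<le> d" for k
  proof -
    have "lookup k i = 0" if "i \<notin> {..<d}" for i
    proof -
      have "i \<notin> keys k" using decreasing_exp_keys[OF k] that by blast
      then show ?thesis by (simp only: not_in_keys_iff_lookup_eq_zero)
    qed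
    moreover have "lookup k i \<le> d" for i using lookup_le_mdeg[of k i] k(2) by simp
    ultimately show ?thesis by simp
  qed
  then have "lookup ` {k. decreasing_exp k \<and> mdeg k \<le> d} \<subseteq> ?F" by (intro image_subsetI) simp
  moreover have "finite ?F" by (rule finite_set_of_finite_funs) auto
  ultimately have "finite (lookup ` {k. decreasing_exp k \<and> mdeg k \<le> d})" by (rule finite_subset)
  then show ?thesis by (rule finite_imageD) (simp add: inj_on_def)
qed

lemma decreasing_exp_wdeg_le:
  assumes k: "decreasing_exp k" and d: "mdeg k \<le> d"
  shows "wdeg id k \<le> d * d"
proof -
  have "wdeg id k \<le> (\<Sum>i\<in>keys k. d * lookup k i)"
    unfolding wdeg_def using decreasing_exp_keys[OF k d] by (intro sum_mono mult_le_mono) auto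
  also have "\<dots> = d * mdeg k" by (simp add: mdeg_def sum_distrib_left)
  also have "\<dots> \<le> d * d" using d by simp
  finally show ?thesis .
qed

lemma mdeg_conjugate_exp: "mdeg (conjugate_exp m) = wdeg Suc m"
proof -
  have "mcoeff (y_monomial e_gen m) (conjugate_exp m) \<noteq> 0"
    using leads_e_monomial[of m] by (simp add: leads_def)
  moreover have "homogeneous (wdeg Suc m) (y_monomial e_gen m)"
    by (rule homogeneous_y_monomial) (rule homogeneous_e_gen)
  ultimately show ?thesis by (rule homogeneousD[rotated])
qed

text \<open>
  The coefficients at decreasing exponents of the least weight \<open>N\<close> are removed by subtracting the corresponding
  products of the \<open>e\<^sub>k\<close>.  This stops, since the weight of a decreasing exponent of degree at most \<open>d\<close> is at most
  \<open>d * d\<close>.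
\<close>

lemma e_eval_surj:
  assumes "f \<in> Sym"
  shows "\<exists>p. y_eval mconst e_gen p = f"
proof -
  note hom = ring_hom_y_eval[OF ring_hom_mscale, where v = e_gen]
  obtain d where d: "bounded_deg d f" using assms by (auto simp: Sym_iff)
  have "\<exists>p. y_eval mconst e_gen p = f"
    if "f \<in> Sym" "bounded_deg d f" "\<And>k. decreasing_exp k \<Longrightarrow> mcoeff f k \<noteq> 0 \<Longrightarrow> N \<le> wdeg id k" for f N
    using that
  proof (induction "Suc (d * d) - N" arbitrary: f N)
    case 0
    have "mcoeff f k = 0" if "decreasing_exp k" for k
    proof (rule ccontr)
      assume nz: "mcoeff f k \<noteq> 0"
      have "N \<le> wdeg id k" "wdeg id k \<le> d * d"
        using 0(4)[OF that nz] decreasing_exp_wdeg_le[OF that bounded_degD[OF 0(3) nz]] .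
      then show False using 0(1) by linarith
    qed
    then have "f = 0" by (rule Sym_zero_if_decreasing_zero[OF 0(2)])
    then show ?case using ring_hom_0[OF hom] by blast
  next
    case (Suc x)
    define D where "D = {k. decreasing_exp k \<and> mdeg k \<le> d \<and> wdeg id k = N}"
    have finD: "finite D" by (rule finite_subset[OF _ finite_decreasing_exp[of d]]) (auto simp: D_def)
    define c where "c = (\<lambda>k. inv conjugate_exp k)"
    have c: "conjugate_exp (c k) = k" if "k \<in> D" for k
      using conjugate_exp_surj[of k] that by (auto simp: D_def c_def intro: f_inv_into_f)
    define q where "q = (\<Sum>k\<in>D. single (c k) (mcoeff f k))"
    define g where "g = f - y_eval mconst e_gen q"
    have eval_q: "y_eval mconst e_gen q = (\<Sum>k\<in>D. mscale (mcoeff f k) (y_monomial e_gen (c k)))"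
      unfolding q_def by (simp only: ring_hom_sum[OF hom] y_eval_single_mscale)
    have lead: "leads id (y_monomial e_gen (c k)) k" if "k \<in> D" for k
      using leads_e_monomial[of "c k"] c[OF that] by simp
    have "g \<in> Sym" unfolding g_def by (intro Sym_diff Suc.prems(1) y_eval_Sym e_gen_Sym)
    moreover have "bounded_deg d g"
      unfolding bounded_deg_def
    proof (intro allI impI)
      fix m assume "mcoeff g m \<noteq> 0"
      then consider "mcoeff f m \<noteq> 0" | "mcoeff (y_eval mconst e_gen q) m \<noteq> 0" by (fastforce simp: g_def)
      then show "mdeg m \<le> d"
      proof cases
        case 1
        then show ?thesis using bounded_degD[OF Suc.prems(2)] by blast
      next
        case 2
        then have "(\<Sum>k\<in>D. mcoeff f k * mcoeff (y_monomial e_gen (c k)) m) \<noteq> 0"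
          by (simp add: eval_q mcoeff_sum)
        then obtain k where k: "k \<in> D" "mcoeff f k * mcoeff (y_monomial e_gen (c k)) m \<noteq> 0"
          by (rule sum.not_neutral_contains_not_neutral)
        have "homogeneous (wdeg Suc (c k)) (y_monomial e_gen (c k))"
          by (rule homogeneous_y_monomial) (rule homogeneous_e_gen)
        then have "mdeg m = wdeg Suc (c k)" using k(2) by (simp add: homogeneous_def)
        also have "\<dots> = mdeg k" using mdeg_conjugate_exp[of "c k"] c[OF k(1)] by simp
        finally show ?thesis using k(1) by (simp add: D_def)
      qed
    qed
    moreover have "Suc N \<le> wdeg id k" if k: "decreasing_exp k" "mcoeff g k \<noteq> 0" for k
    proof (rule ccontr)
      assume "\<not> ?thesis"
      then have le: "wdeg id k \<le> N" by simp
      have other: "mcoeff (y_monomial e_gen (c k')) k = 0" if "k' \<in> D" "k' \<noteq> k" for k'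
        using lead[OF that(1)] that le by (auto simp: leads_def D_def)
      have q: "mcoeff (y_eval mconst e_gen q) k = (\<Sum>k'\<in>D. mcoeff f k' * mcoeff (y_monomial e_gen (c k')) k)"
        by (simp add: eval_q mcoeff_sum)
      show False
      proof (cases "k \<in> D")
        case True
        have "mcoeff (y_eval mconst e_gen q) k = (\<Sum>k'\<in>{k}. mcoeff f k' * mcoeff (y_monomial e_gen (c k')) k)"
          unfolding q by (rule sum.mono_neutral_right[OF finD]) (use True other in auto)
        also have "\<dots> = mcoeff f k" using lead[OF True] by (simp add: leads_def)
        finally show False using k(2) by (simp add: g_def)
      next
        case False
        then have "mcoeff (y_eval mconst e_gen q) k = 0"
          unfolding q by (intro sum.neutral) (use other in auto)
        then have "mcoeff f k \<noteq> 0" using k(2) by (simp add: g_def)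
        then have "N \<le> wdeg id k" "mdeg k \<le> d"
          using Suc.prems(3)[OF k(1)] bounded_degD[OF Suc.prems(2)] by auto
        then show False using False le k(1) by (simp add: D_def)
      qed
    qed
    moreover have "x = Suc (d * d) - Suc N" using Suc.hyps(2) by linarith
    ultimately obtain p where "y_eval mconst e_gen p = g"
      using Suc.hyps(1)[of "Suc N" g] by blast
    then have "y_eval mconst e_gen (p + q) = f" by (simp add: ring_homD[OF hom] g_def)
    then show ?case by blast
  qed
  from this[of f 0] show ?thesis using assms d by simp
qed

section \<open>A triangular change of generators\<close>

text \<open>
  Here the leading monomial is the one of greatest weight: a polynomial has only finitely many monomials.
\<close>

definition monic_in :: "('v \<Rightarrow> nat) \<Rightarrow> ('v \<Rightarrow>\<^sub>0 nat) \<Rightarrow> (('v \<Rightarrow>\<^sub>0 nat) \<Rightarrow>\<^sub>0 complex) \<Rightarrow> bool" where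
  "monic_in w m f \<longleftrightarrow> (\<exists>r. f = single m 1 + r \<and> (\<forall>k\<in>keys r. wdeg w k < wdeg w m))"

lemma monic_in_1: "monic_in w 0 1"
  unfolding monic_in_def by (intro exI[of _ 0]) simp

lemma monic_in_mult:
  assumes "monic_in w m f" "monic_in w n g"
  shows "monic_in w (m + n) (f * g)"
proof -
  obtain r where r: "f = single m 1 + r" "\<And>k. k \<in> keys r \<Longrightarrow> wdeg w k < wdeg w m"
    using assms(1) by (auto simp: monic_in_def)
  obtain s where s: "g = single n 1 + s" "\<And>k. k \<in> keys s \<Longrightarrow> wdeg w k < wdeg w n"
    using assms(2) by (auto simp: monic_in_def)
  let ?t = "single m 1 * s + (r * single n 1 + r * s)"
  have "f * g = single (m + n) 1 + ?t"
    by (simp add: r(1) s(1) mult_single algebra_simps)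
  moreover have "wdeg w k < wdeg w (m + n)" if "k \<in> keys ?t" for k
  proof -
    have lt: "wdeg w k < wdeg w (m + n)"
      if k: "k \<in> keys (x * y)" and x: "\<And>k. k \<in> keys x \<Longrightarrow> wdeg w k \<le> wdeg w m"
        and y: "\<And>k. k \<in> keys y \<Longrightarrow> wdeg w k \<le> wdeg w n"
        and strict: "(\<forall>k\<in>keys x. wdeg w k < wdeg w m) \<or> (\<forall>k\<in>keys y. wdeg w k < wdeg w n)"
      for x y :: "('a \<Rightarrow>\<^sub>0 nat) \<Rightarrow>\<^sub>0 complex"
    proof -
      obtain a b where "k = a + b" "a \<in> keys x" "b \<in> keys y" using k keys_mult[of x y] by blast
      then show ?thesis using strict x[of a] y[of b] by fastforce
    qed
    from that keys_add[of "single m 1 * s" "r * single n 1 + r * s"] keys_add[of "r * single n 1" "r * s"]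
    consider "k \<in> keys (single m 1 * s)" | "k \<in> keys (r * single n 1)" | "k \<in> keys (r * s)" by blast
    then show ?thesis
      by cases (erule lt; use r(2) s(2) in \<open>auto simp: less_imp_le\<close>)+
  qed
  ultimately show ?thesis unfolding monic_in_def by blast
qed

lemma monic_in_power: "monic_in w m f \<Longrightarrow> monic_in w (\<Sum>_<n. m) (f ^ n)"
  by (induction n) (simp_all add: monic_in_1 monic_in_mult add.commute)

lemma monic_in_prod:
  "finite A \<Longrightarrow> (\<And>i. i \<in> A \<Longrightarrow> monic_in w (m i) (f i)) \<Longrightarrow> monic_in w (\<Sum>i\<in>A. m i) (\<Prod>i\<in>A. f i)"
  by (induction A rule: finite_induct) (auto intro: monic_in_mult monic_in_1)

text \<open>
  Injectivity looks at a monomial of greatest weight in the argument; surjectivity is an induction on the weight.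
\<close>

lemma unitriangular_bij:
  fixes T :: "(('v \<Rightarrow>\<^sub>0 nat) \<Rightarrow>\<^sub>0 complex) \<Rightarrow> ('v \<Rightarrow>\<^sub>0 nat) \<Rightarrow>\<^sub>0 complex"
  assumes add: "\<And>p q. T (p + q) = T p + T q"
    and tri: "\<And>m c. \<exists>r. T (single m c) = single m c + r \<and> (\<forall>k\<in>keys r. wdeg w k < wdeg w m)"
  shows "bij T"
proof -
  have T0: "T 0 = 0" using add[of 0 0] by simp
  have diff: "T (p - q) = T p - T q" for p q using add[of "p - q" q] by simp
  have sum: "T (\<Sum>i\<in>A. f i) = (\<Sum>i\<in>A. T (f i))" for A :: "'i set" and f
    by (induction A rule: infinite_finite_induct) (simp_all add: add T0)
  have inj0: "p = 0" if "T p = 0" for p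
  proof (rule ccontr)
    assume "p \<noteq> 0"
    then have ne: "keys p \<noteq> {}" by simp
    have "Max (wdeg w ` keys p) \<in> wdeg w ` keys p" using ne by (intro Max_in) auto
    then obtain m where m: "m \<in> keys p" "wdeg w m = Max (wdeg w ` keys p)" by auto
    have max: "wdeg w k \<le> wdeg w m" if "k \<in> keys p" for k using that by (simp add: m(2))
    have zero: "lookup (T (single k (lookup p k))) m = 0" if k: "k \<in> keys p" "k \<noteq> m" for k
    proof -
      obtain r where r: "T (single k (lookup p k)) = single k (lookup p k) + r" "\<forall>j\<in>keys r. wdeg w j < wdeg w k"
        using tri by blast
      then have "m \<notin> keys r" using max[OF k(1)] by auto
      then show ?thesis using k(2) by (simp add: r(1) lookup_add lookup_single in_keys_iff)
    qed
    obtain r where r: "T (single m (lookup p m)) = single m (lookup p m) + r" "\<forall>j\<in>keys r. wdeg w j < wdeg w m"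
      using tri by blast
    then have "m \<notin> keys r" by auto
    then have diag: "lookup (T (single m (lookup p m))) m = lookup p m" by (simp add: r(1) lookup_add in_keys_iff)
    have "0 = lookup (T (\<Sum>k\<in>keys p. single k (lookup p k))) m"
      using that by (simp add: poly_mapping_sum_singles[symmetric])
    also have "\<dots> = (\<Sum>k\<in>keys p. lookup (T (single k (lookup p k))) m)" by (simp add: sum lookup_sum)
    also have "\<dots> = (\<Sum>k\<in>{m}. lookup (T (single k (lookup p k))) m)"
      by (rule sum.mono_neutral_right) (use m(1) zero in auto)
    finally show False using m(1) diag by (simp add: in_keys_iff)
  qed
  have "inj T"
  proof (rule injI)
    fix p q assume "T p = T q"
    then have "T (p - q) = 0" by (simp add: diff)
    then show "p = q" using inj0 by fastforce
  qed
  moreover have surj1: "\<exists>p. T p = single m c" for m c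
  proof (induction "wdeg w m" arbitrary: m c rule: less_induct)
    case less
    obtain r where r: "T (single m c) = single m c + r" "\<forall>k\<in>keys r. wdeg w k < wdeg w m"
      using tri by blast
    have "\<forall>k\<in>keys r. \<exists>p. T p = single k (lookup r k)" using less.hyps r(2) by blast
    then obtain P where P: "\<And>k. k \<in> keys r \<Longrightarrow> T (P k) = single k (lookup r k)" by metis
    have "T (\<Sum>k\<in>keys r. P k) = (\<Sum>k\<in>keys r. single k (lookup r k))"
      unfolding sum by (intro sum.cong refl P)
    then have "T (\<Sum>k\<in>keys r. P k) = r" by (simp only: poly_mapping_sum_singles[symmetric])
    then have "T (single m c - (\<Sum>k\<in>keys r. P k)) = single m c" by (simp add: diff r(1))
    then show ?case by blast
  qed
  have "\<exists>p. T p = q" for q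
  proof (induction q rule: poly_mapping_additive_induct)
    case (add p q)
    then show ?case using assms(1) by metis
  qed (rule surj1)
  then have "surj T" by (metis surjI)
  ultimately show ?thesis by (simp add: bij_def)
qed

text \<open>
  Giving \<open>e\<^sub>k\<close> the weight \<open>k - 1\<close> instead of its degree \<open>k\<close> makes a product of several factors lighter than
  the single generator of the same degree.
\<close>

lemma wdeg_block_sizes:
  assumes \<pi>: "\<pi> \<in> NC (Suc i)" and ne: "\<pi> \<noteq> {{1..Suc i}}"
  shows "(\<Sum>A\<in>\<pi>. card A - 1) < i"
proof -
  have part: "partition_on {1..Suc i} \<pi>" using \<pi> by (simp add: NC_def)
  have fin: "finite \<pi>" by (rule finite_NC_member[OF \<pi>])
  have "(\<Sum>A\<in>\<pi>. card A) = Suc i"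
    using product_partition[OF part] NC_block(2)[OF \<pi>] by simp
  moreover have "(\<Sum>A\<in>\<pi>. card A) = (\<Sum>A\<in>\<pi>. card A - 1) + card \<pi>"
  proof -
    have "card A = (card A - 1) + 1" if "A \<in> \<pi>" for A
    proof -
      have "0 < card A" using NC_block(2,3)[OF \<pi> that] by (simp add: card_gt_0_iff)
      then show ?thesis by simp
    qed
    then have "(\<Sum>A\<in>\<pi>. card A) = (\<Sum>A\<in>\<pi>. (card A - 1) + 1)" by (intro sum.cong refl)
    also have "\<dots> = (\<Sum>A\<in>\<pi>. card A - 1) + card \<pi>" by (simp only: sum.distrib card_eq_sum)
    finally show ?thesis .
  qed
  moreover have "2 \<le> card \<pi>"
  proof (rule ccontr)
    assume "\<not> 2 \<le> card \<pi>"
    then consider "card \<pi> = 0" | "card \<pi> = 1" by linarith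
    then show False
    proof cases
      case 1
      then have "\<pi> = {}" using fin by simp
      then show False using NC_D(1)[OF \<pi>] by auto
    next
      case 2
      then obtain A where "\<pi> = {A}" by (auto simp: card_1_singleton_iff)
      then show False using NC_D(1)[OF \<pi>] ne by auto
    qed
  qed
  ultimately show ?thesis by linarith
qed

text \<open>
  The element \<open>y\<^sub>n\<close> written in \<open>\<Y>\<^sup>(\<^sup>1\<^sup>)\<close>, with \<open>Y\<^bsub>k+1\<^esub>\<close> in the role of \<open>e\<^sub>k\<close>.
\<close>

definition y_moment :: "nat \<Rightarrow> yalg" where
  "y_moment = moment (\<lambda>k. Y (Suc k))"

lemma top_NC: "{{1..Suc i}} \<in> NC (Suc i)"
  by (auto simp: NC_def partition_on_def noncrossing_def)

text \<open>
  The one-block partition contributes \<open>Y\<^bsub>i+2\<^esub>\<close>, and the other partitions contribute products of smaller weight.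
\<close>

lemma monic_y_moment: "monic_in id (single i 1) (y_moment (i + 2))"
proof -
  let ?w = "\<lambda>\<pi>. \<Prod>A\<in>\<pi>. Y (Suc (card A))"
  have "y_moment (i + 2) = (\<Sum>\<pi>\<in>NC (Suc i). ?w \<pi>)" by (simp add: y_moment_def moment_def)
  also have "\<dots> = ?w {{1..Suc i}} + (\<Sum>\<pi>\<in>NC (Suc i) - {{{1..Suc i}}}. ?w \<pi>)"
    using top_NC by (rule sum.remove[OF finite_NC])
  also have "?w {{1..Suc i}} = single (single i 1) 1" using Y_Suc_Suc[of i] by simp
  finally have eq: "y_moment (i + 2) = single (single i 1) 1 + (\<Sum>\<pi>\<in>NC (Suc i) - {{{1..Suc i}}}. ?w \<pi>)" .
  have "wdeg id k < wdeg id (single i 1)" if k: "k \<in> keys (\<Sum>\<pi>\<in>NC (Suc i) - {{{1..Suc i}}}. ?w \<pi>)" for k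
  proof -
    obtain \<pi> where \<pi>: "\<pi> \<in> NC (Suc i)" "\<pi> \<noteq> {{1..Suc i}}" "k \<in> keys (?w \<pi>)"
      using k keys_sum[of ?w "NC (Suc i) - {{{1..Suc i}}}"] by blast
    have "Y (Suc (card A)) = single (single (card A - 1) 1) 1" if "A \<in> \<pi>" for A
    proof -
      have "0 < card A" using NC_block(2,3)[OF \<pi>(1) that] by (simp add: card_gt_0_iff)
      then have "Suc (card A) = (card A - 1) + 2" by simp
      then show ?thesis using Y_Suc_Suc by metis
    qed
    then have "?w \<pi> = (\<Prod>A\<in>\<pi>. single (single (card A - 1) 1) 1)" by (intro prod.cong refl)
    also have "\<dots> = single (\<Sum>A\<in>\<pi>. single (card A - 1) 1) 1"
      by (rule single_prod[OF finite_NC_member[OF \<pi>(1)]])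
    finally have "k = (\<Sum>A\<in>\<pi>. single (card A - 1) 1)" using \<pi>(3) by simp
    then have "wdeg id k = (\<Sum>A\<in>\<pi>. card A - 1)"
      by (simp add: wdeg_sum[OF finite_NC_member[OF \<pi>(1)]])
    then show ?thesis using wdeg_block_sizes[OF \<pi>(1,2)] by simp
  qed
  then show ?thesis unfolding monic_in_def using eq by blast
qed

lemma bij_y_moment_eval: "bij (y_eval (single 0) y_moment :: yalg \<Rightarrow> yalg)"
proof (rule unitriangular_bij[where w = id])
  fix m :: mono and c :: complex
  have "monic_in id (\<Sum>i\<in>keys m. \<Sum>_<lookup m i. single i 1) (y_monomial y_moment m)"
    unfolding y_monomial_def by (intro monic_in_prod monic_in_power monic_y_moment) simp
  then have "monic_in id m (y_monomial y_moment m)"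
    by (simp only: sum_const_single poly_mapping_sum_singles[symmetric])
  then obtain r where r: "y_monomial y_moment m = single m 1 + r" "\<forall>k\<in>keys r. wdeg id k < wdeg id m"
    by (auto simp: monic_in_def)
  have "y_eval (single 0) y_moment (single m c) = single m c + single 0 c * r"
    by (simp add: y_eval_single[OF ring_hom_single] r(1) distrib_left mult_single)
  moreover have "keys (single 0 c * r) \<subseteq> keys r" using keys_mult[of "single 0 c" r] by (auto split: if_splits)
  ultimately show "\<exists>r. y_eval (single 0) y_moment (single m c) = single m c + r \<and> (\<forall>k\<in>keys r. wdeg id k < wdeg id m)"
    using r(2) by blast
qed (rule y_eval_add[OF ring_hom_single])

section \<open>Bijectivity and degrees\<close>

definition \<Phi>_hom :: "yalg \<Rightarrow> nat mser" where
  "\<Phi>_hom = y_eval mconst y_sym"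

lemma y_sym_eq_moment: "y_sym n = moment esym n"
  by (simp add: y_sym_def moment_def)

lemma ring_hom_\<Phi>: "ring_hom \<Phi>_hom"
  unfolding \<Phi>_hom_def by (rule ring_hom_y_eval[OF ring_hom_mscale])

lemma \<Phi>_single: "\<Phi>_hom (single m c) = mscale c (y_monomial y_sym m)"
  unfolding \<Phi>_hom_def by (rule y_eval_single_mscale)

lemma \<Phi>_Y: "\<Phi>_hom (Y n) = y_sym n"
proof -
  have "n = 0 \<or> n = 1" if "n \<le> 1" using that by auto
  then show ?thesis unfolding \<Phi>_hom_def y_eval_Y[OF ring_hom_mscale] by (auto simp: y_sym_eq_moment)
qed

lemma \<Phi>_Sym: "\<Phi>_hom p \<in> Sym"
  unfolding \<Phi>_hom_def by (rule y_eval_Sym) (rule y_sym_Sym)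

text \<open>
  Moments are polynomial expressions in the cumulants, so the homomorphism \<open>Y\<^bsub>k+1\<^esub> \<mapsto> e\<^sub>k\<close> takes the moments
  with cumulants \<open>Y\<^bsub>k+1\<^esub>\<close> to those with cumulants \<open>e\<^sub>k\<close>.
\<close>

lemma \<Phi>_factor: "\<Phi>_hom p = y_eval mconst e_gen (y_eval (single 0) y_moment p)"
proof -
  note hom = ring_hom_y_eval[OF ring_hom_mscale, where v = e_gen]
  note hom' = ring_hom_y_eval[OF ring_hom_single, where v = y_moment]
  have gen: "y_eval mconst e_gen (Y (Suc k)) = esym k" for k
    by (cases k) (simp_all add: y_eval_Y[OF ring_hom_mscale] e_gen_def)
  show ?thesis
  proof (rule ring_hom_y_ext[OF ring_hom_\<Phi> ring_hom_comp[OF hom hom']])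
    fix c
    show "\<Phi>_hom (single 0 c) = y_eval mconst e_gen (y_eval (single 0) y_moment (single 0 c))"
      unfolding \<Phi>_single y_eval_single[OF ring_hom_single] by (simp add: y_eval_single_mscale)
  next
    fix n :: nat assume "2 \<le> n"
    then have "y_eval (single 0) y_moment (Y n) = y_moment n" by (simp add: y_eval_Y[OF ring_hom_single])
    then have "y_eval mconst e_gen (y_eval (single 0) y_moment (Y n)) = moment esym n"
      by (simp add: y_moment_def moment_def ring_hom_sum[OF hom] ring_hom_prod[OF hom] gen)
    then show "\<Phi>_hom (Y n) = y_eval mconst e_gen (y_eval (single 0) y_moment (Y n))"
      by (simp add: \<Phi>_Y y_sym_eq_moment)
  qed
qed

lemma bij_betw_e_eval: "bij_betw (y_eval mconst e_gen) UNIV Sym"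
proof (rule bij_betw_imageI)
  note hom = ring_hom_y_eval[OF ring_hom_mscale, where v = e_gen]
  show "inj (y_eval mconst e_gen)"
  proof (rule injI)
    fix p q assume "y_eval mconst e_gen p = y_eval mconst e_gen q"
    then have "y_eval mconst e_gen (p - q) = 0" by (simp add: ring_hom_diff[OF hom])
    then have "p - q = 0" by (rule e_eval_inj)
    then show "p = q" by simp
  qed
  show "range (y_eval mconst e_gen) = Sym"
    using e_eval_surj y_eval_Sym[of e_gen, OF e_gen_Sym] by fastforce
qed

lemma bij_betw_\<Phi>: "bij_betw \<Phi>_hom UNIV Sym"
proof -
  have "\<Phi>_hom = y_eval mconst e_gen \<circ> y_eval (single 0) y_moment" by (simp add: fun_eq_iff \<Phi>_factor)
  then show ?thesis using bij_betw_trans[OF bij_y_moment_eval bij_betw_e_eval] by simp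
qed

lemma homogeneous_\<Phi>:
  assumes "mcoeff (y_monomial y_sym m) \<mu> \<noteq> 0"
  shows "mdeg \<mu> = wdeg Suc m"
  using homogeneousD[OF homogeneous_y_monomial[of y_sym, OF homogeneous_y_sym] assms] .

text \<open>
  For the nontrivial inclusion, the part of degree \<open>d\<close> of a preimage is again a preimage, since the images of
  the monomials are homogeneous.
\<close>

lemma \<Phi>_grade: "\<Phi>_hom ` y_grade d = sym_grade d"
proof
  show "\<Phi>_hom ` y_grade d \<subseteq> sym_grade d"
  proof
    fix f assume "f \<in> \<Phi>_hom ` y_grade d"
    then obtain p where p: "f = \<Phi>_hom p" "\<And>m. m \<in> keys p \<Longrightarrow> wdeg Suc m = d"
      by (auto simp: y_grade_eq_wdeg)
    have "mdeg \<mu> = d" if "mcoeff f \<mu> \<noteq> 0" for \<mu>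
    proof -
      from that have "(\<Sum>m\<in>keys p. lookup p m * mcoeff (y_monomial y_sym m) \<mu>) \<noteq> 0"
        by (simp add: p(1) \<Phi>_hom_def mcoeff_y_eval)
      then obtain m where "m \<in> keys p" "lookup p m * mcoeff (y_monomial y_sym m) \<mu> \<noteq> 0"
        by (rule sum.not_neutral_contains_not_neutral)
      then show ?thesis using homogeneous_\<Phi>[of m \<mu>] p(2) by simp
    qed
    then show "f \<in> sym_grade d" using \<Phi>_Sym by (simp add: sym_grade_def p(1))
  qed
  show "sym_grade d \<subseteq> \<Phi>_hom ` y_grade d"
  proof
    fix f assume f: "f \<in> sym_grade d"
    then have "f \<in> Sym" and deg: "\<And>\<mu>. mcoeff f \<mu> \<noteq> 0 \<Longrightarrow> mdeg \<mu> = d" by (auto simp: sym_grade_def)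
    then obtain p where p: "f = \<Phi>_hom p" using bij_betw_\<Phi> by (auto simp: bij_betw_def)
    \<comment> \<open>\<open>q\<close> is the homogeneous part of degree \<open>d\<close> of \<open>p\<close>.\<close>
    define A where "A = {m \<in> keys p. wdeg Suc m = d}"
    define q where "q = (\<Sum>m\<in>A. single m (lookup p m))"
    have lookup_q: "lookup q m = (if m \<in> A then lookup p m else 0)" for m
      by (simp add: q_def lookup_sum lookup_single when_def A_def)
    then have keys_q: "keys q = A" by (auto simp: in_keys_iff A_def split: if_splits)
    have "\<Phi>_hom q = f"
    proof (rule mser_eqI)
      fix \<mu>
      have q: "mcoeff (\<Phi>_hom q) \<mu> = (\<Sum>m\<in>A. lookup p m * mcoeff (y_monomial y_sym m) \<mu>)"
        by (simp add: \<Phi>_hom_def mcoeff_y_eval keys_q lookup_q)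
      have p': "mcoeff f \<mu> = (\<Sum>m\<in>keys p. lookup p m * mcoeff (y_monomial y_sym m) \<mu>)"
        by (simp add: p \<Phi>_hom_def mcoeff_y_eval)
      show "mcoeff (\<Phi>_hom q) \<mu> = mcoeff f \<mu>"
      proof (cases "mdeg \<mu> = d")
        case True
        have "mcoeff (y_monomial y_sym m) \<mu> = 0" if "m \<in> keys p - A" for m
          using homogeneous_\<Phi>[of m \<mu>] that True by (fastforce simp: A_def)
        then show ?thesis unfolding q p' by (intro sum.mono_neutral_left) (auto simp: A_def)
      next
        case False
        have "mcoeff (y_monomial y_sym m) \<mu> = 0" if "m \<in> A" for m
          using homogeneous_\<Phi>[of m \<mu>] that False by (fastforce simp: A_def)
        then have "mcoeff (\<Phi>_hom q) \<mu> = 0" unfolding q by (intro sum.neutral) simp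
        then show ?thesis using deg[of \<mu>] False by auto
      qed
    qed
    moreover have "q \<in> y_grade d" by (auto simp: y_grade_eq_wdeg keys_q A_def)
    ultimately show "f \<in> \<Phi>_hom ` y_grade d" by blast
  qed
qed

section \<open>Power series in two alphabets\<close>

text \<open>
  A monomial in two alphabets is a pair of monomials.
\<close>

definition join_exp :: "('a \<Rightarrow>\<^sub>0 nat) \<Rightarrow> ('b \<Rightarrow>\<^sub>0 nat) \<Rightarrow> ('a + 'b) \<Rightarrow>\<^sub>0 nat" where
  "join_exp a b = Abs_poly_mapping (case_sum (lookup a) (lookup b))"

lemma lookup_join_exp: "lookup (join_exp a b) x = case_sum (lookup a) (lookup b) x"
proof -
  have "{x. case_sum (lookup a) (lookup b) x \<noteq> 0} \<subseteq> Inl ` keys a \<union> Inr ` keys b"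
  proof
    fix x assume "x \<in> {x. case_sum (lookup a) (lookup b) x \<noteq> 0}"
    then show "x \<in> Inl ` keys a \<union> Inr ` keys b" by (cases x) (auto simp: in_keys_iff)
  qed
  then have "finite {x. case_sum (lookup a) (lookup b) x \<noteq> 0}" by (rule finite_subset) simp
  then show ?thesis by (simp add: join_exp_def)
qed

lemma lookup_map_key_Inl: "lookup (map_key Inl m) i = lookup m (Inl i)"
  and lookup_map_key_Inr: "lookup (map_key Inr m) j = lookup m (Inr j)"
  by (simp_all add: lookup_map_key)

lemma map_key_join [simp]: "map_key Inl (join_exp a b) = a" "map_key Inr (join_exp a b) = b"
  by (auto intro!: poly_mapping_eqI simp: lookup_map_key_Inl lookup_map_key_Inr lookup_join_exp)

lemma join_map_key [simp]: "join_exp (map_key Inl m) (map_key Inr m) = m"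
proof (rule poly_mapping_eqI)
  fix x show "lookup (join_exp (map_key Inl m) (map_key Inr m)) x = lookup m x"
    by (cases x) (simp_all add: lookup_map_key_Inl lookup_map_key_Inr lookup_join_exp)
qed

lemma join_exp_add: "join_exp a b + join_exp a' b' = join_exp (a + a') (b + b')"
proof (rule poly_mapping_eqI)
  fix x show "lookup (join_exp a b + join_exp a' b') x = lookup (join_exp (a + a') (b + b')) x"
    by (cases x) (simp_all add: lookup_add lookup_join_exp)
qed

lemma mcoeff_sym_tensor: "mcoeff (sym_tensor f g) m = mcoeff f (map_key Inl m) * mcoeff g (map_key Inr m)"
  by (simp add: sym_tensor_def)

lemma sym_tensor_mult: "sym_tensor (f * f') (g * g') = sym_tensor f g * sym_tensor f' g'"
proof (rule mser_eqI)
  fix m :: "nat + nat \<Rightarrow>\<^sub>0 nat"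
  let ?X = "{(a, a'). a + a' = map_key Inl m} \<times> {(b, b'). b + b' = map_key Inr m}"
  have "mcoeff (sym_tensor (f * f') (g * g')) m =
      (\<Sum>x\<in>?X. (mcoeff f (fst (fst x)) * mcoeff f' (snd (fst x))) * (mcoeff g (fst (snd x)) * mcoeff g' (snd (snd x))))"
    by (simp add: mcoeff_sym_tensor mcoeff_mult sum_product sum.cartesian_product case_prod_unfold)
  also have "\<dots> = (\<Sum>(c, d) | c + d = m. mcoeff (sym_tensor f g) c * mcoeff (sym_tensor f' g') d)"
  proof (rule sum.reindex_bij_witness[of _
        "\<lambda>(c, d). ((map_key Inl c, map_key Inl d), (map_key Inr c, map_key Inr d))"
        "\<lambda>((a, a'), (b, b')). (join_exp a b, join_exp a' b')"])
    fix y assume "y \<in> {(c, d). c + d = m}"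
    then show "(case y of (c, d) \<Rightarrow> ((map_key Inl c, map_key Inl d), (map_key Inr c, map_key Inr d))) \<in> ?X"
      by (auto simp: map_key_plus[symmetric])
  qed (auto simp: join_exp_add mcoeff_sym_tensor)
  also have "\<dots> = mcoeff (sym_tensor f g * sym_tensor f' g') m" by (simp add: mcoeff_mult)
  finally show "mcoeff (sym_tensor (f * f') (g * g')) m = mcoeff (sym_tensor f g * sym_tensor f' g') m" .
qed

lemma map_key_zero_iff: "map_key Inl m = 0 \<and> map_key Inr m = 0 \<longleftrightarrow> m = (0 :: 'a + 'b \<Rightarrow>\<^sub>0 nat)"
proof
  assume "map_key Inl m = 0 \<and> map_key Inr m = 0"
  then have "m = join_exp 0 0" using join_map_key[of m] by simp
  also have "\<dots> = 0" by (rule poly_mapping_eqI) (simp add: lookup_join_exp split: sum.splits)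
  finally show "m = 0" .
qed simp

lemma sym_tensor_1: "sym_tensor 1 1 = 1"
  by (rule mser_eqI) (use map_key_zero_iff in \<open>auto simp: mcoeff_sym_tensor mcoeff_1\<close>)

lemma sym_tensor_add:
  "sym_tensor (f + f') g = sym_tensor f g + sym_tensor f' g"
  "sym_tensor f (g + g') = sym_tensor f g + sym_tensor f g'"
  by (auto intro!: mser_eqI simp: mcoeff_sym_tensor algebra_simps)

text \<open>
  The two embeddings \<open>f \<mapsto> f \<otimes> 1\<close> and \<open>g \<mapsto> 1 \<otimes> g\<close> reduce computations in the tensor square to
  computations in one commutative ring.
\<close>

definition left_alphabet :: "nat mser \<Rightarrow> (nat + nat) mser" where
  "left_alphabet f = sym_tensor f 1"

definition right_alphabet :: "nat mser \<Rightarrow> (nat + nat) mser" where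
  "right_alphabet g = sym_tensor 1 g"

lemma ring_hom_left_alphabet: "ring_hom left_alphabet"
  using sym_tensor_mult[of _ _ 1 1] by (simp add: ring_hom_def left_alphabet_def sym_tensor_1 sym_tensor_add)

lemma ring_hom_right_alphabet: "ring_hom right_alphabet"
  using sym_tensor_mult[of 1 1] by (simp add: ring_hom_def right_alphabet_def sym_tensor_1 sym_tensor_add)

lemma sym_tensor_eq_mult: "sym_tensor f g = left_alphabet f * right_alphabet g"
  using sym_tensor_mult[of f 1 1 g] by (simp add: left_alphabet_def right_alphabet_def)

lemma sym_comult_eq_relabel: "sym_comult = relabel sum_decode"
  by (simp add: fun_eq_iff sym_comult_def relabel_def)

lemma keys_sum_type: "keys m = Inl ` keys (map_key Inl m) \<union> Inr ` keys (map_key Inr m)"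
proof (rule set_eqI)
  fix x show "x \<in> keys m \<longleftrightarrow> x \<in> Inl ` keys (map_key Inl m) \<union> Inr ` keys (map_key Inr m)"
    by (cases x) (auto simp: in_keys_iff lookup_map_key_Inl lookup_map_key_Inr)
qed

text \<open>
  A squarefree monomial of degree \<open>n\<close> in both alphabets has a well-defined number \<open>i\<close> of variables in the first
  alphabet, so exactly one summand contributes.
\<close>

lemma sym_comult_esym: "sym_comult (esym n) = (\<Sum>i\<le>n. left_alphabet (esym i) * right_alphabet (esym (n - i)))"
proof (rule mser_eqI)
  fix m :: "nat + nat \<Rightarrow>\<^sub>0 nat"
  let ?L = "map_key Inl m" and ?R = "map_key Inr m"
  let ?a = "card (keys ?L)" and ?b = "card (keys ?R)"
  have bij: "bij sum_decode" by (rule bij_sum_decode)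
  note inj = bij_is_inj[OF bij]
  have card: "card (keys (map_key sum_decode m)) = ?a + ?b"
  proof -
    have "card (keys (map_key sum_decode m)) = card (keys m)"
      unfolding keys_map_key[OF inj] using bij by (simp add: card_vimage_inj bij_is_inj bij_is_surj)
    also have "\<dots> = ?a + ?b"
      by (subst keys_sum_type) (subst card_Un_disjoint, auto simp: card_image)
    finally show ?thesis .
  qed
  have all: "(\<forall>i. lookup m (sum_decode i) \<le> 1) \<longleftrightarrow> (\<forall>i. lookup ?L i \<le> 1) \<and> (\<forall>i. lookup ?R i \<le> 1)"
    unfolding lookup_map_key_Inl lookup_map_key_Inr
    using bij_is_surj[OF bij] by (metis obj_sumE surj_def)
  have "mcoeff (\<Sum>i\<le>n. left_alphabet (esym i) * right_alphabet (esym (n - i))) m =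
      (\<Sum>i\<le>n. mcoeff (esym i) ?L * mcoeff (esym (n - i)) ?R)"
    by (simp add: mcoeff_sum sym_tensor_eq_mult[symmetric] mcoeff_sym_tensor)
  also have "\<dots> = (\<Sum>i\<le>n. if i = ?a then mcoeff (esym ?a) ?L * mcoeff (esym (n - ?a)) ?R else 0)"
    by (intro sum.cong refl) (auto simp: mcoeff_esym)
  also have "\<dots> = (if ?a \<le> n then mcoeff (esym ?a) ?L * mcoeff (esym (n - ?a)) ?R else 0)"
    by simp
  also have "\<dots> = mcoeff (sym_comult (esym n)) m"
    using all card by (auto simp: sym_comult_eq_relabel mcoeff_esym lookup_map_key[OF inj])
  finally show "mcoeff (sym_comult (esym n)) m =
      mcoeff (\<Sum>i\<le>n. left_alphabet (esym i) * right_alphabet (esym (n - i))) m" by simp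
qed

lemma ring_hom_moment:
  assumes "ring_hom H"
  shows "H (moment e n) = moment (\<lambda>k. H (e k)) n"
  by (simp add: moment_def ring_hom_sum[OF assms] ring_hom_prod[OF assms])

section \<open>The tensor square\<close>

lemma tensor_map_add: "tensor_map \<Phi> (s + t) = tensor_map \<Phi> s + tensor_map \<Phi> t"
proof -
  have "mscale 0 f = 0" "mscale (c + d) f = mscale c f + mscale d f" for c d and f :: "(nat + nat) mser"
    by (auto intro!: mser_eqI simp: distrib_right)
  then show ?thesis
    unfolding tensor_map_def case_prod_unfold prod.collapse
    by (intro setsum_keys_plus_distrib) simp_all
qed

lemma tensor_map_single:
  "tensor_map \<Phi> (single (a, b) c) = mscale c (sym_tensor (\<Phi> (single a 1)) (\<Phi> (single b 1)))"
proof -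
  have "mscale 0 f = 0" for f :: "(nat + nat) mser" by (auto intro!: mser_eqI)
  then show ?thesis by (simp add: tensor_map_def)
qed

lemma tensor_map_sum: "tensor_map \<Phi> (\<Sum>i\<in>A. f i) = (\<Sum>i\<in>A. tensor_map \<Phi> (f i))"
proof -
  have "tensor_map \<Phi> 0 = 0" by (simp add: tensor_map_def)
  then show ?thesis by (induction A rule: infinite_finite_induct) (simp_all add: tensor_map_add)
qed

lemma ring_hom_tensor_map: "ring_hom (tensor_map \<Phi>_hom)"
proof -
  note hom = ring_hom_\<Phi>
  have mm: "mscale c f * mscale d g = mscale (c * d) (f * g)" for c d and f g :: "(nat + nat) mser"
    by (rule mser_eqI) (simp add: mscale_mult_left mult.commute[of f "mscale d g"] mult.commute[of g f])
  have single: "tensor_map \<Phi>_hom (single k c * single l d) = tensor_map \<Phi>_hom (single k c) * tensor_map \<Phi>_hom (single l d)" for k l c d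
  proof -
    obtain a b where k: "k = (a, b)" by (rule prod.exhaust)
    obtain a' b' where l: "l = (a', b')" by (rule prod.exhaust)
    have s: "\<Phi>_hom (single (x + y) 1) = \<Phi>_hom (single x 1) * \<Phi>_hom (single y 1)" for x y
      using ring_homD(3)[OF hom, of "single x 1" "single y 1"] by (simp add: mult_single)
    show ?thesis
      by (simp add: k l mult_single tensor_map_single s sym_tensor_mult mm)
  qed
  have "tensor_map \<Phi>_hom (s * t) = tensor_map \<Phi>_hom s * tensor_map \<Phi>_hom t" for s t
  proof (induction s rule: poly_mapping_additive_induct)
    case s: (single k c)
    show ?case
      by (induction t rule: poly_mapping_additive_induct) (simp_all add: single distrib_left tensor_map_add)
  qed (simp add: distrib_right tensor_map_add)
  moreover have "tensor_map \<Phi>_hom 1 = 1"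
    using tensor_map_single[of \<Phi>_hom 0 0 1] ring_homD(1)[OF hom] ring_homD(1)[OF ring_hom_mscale]
    by (simp add: sym_tensor_1 zero_prod_def[symmetric])
  ultimately show ?thesis by (simp add: ring_hom_def tensor_map_add)
qed

section \<open>Comultiplication and counit\<close>

lemma \<Phi>_expand: "\<Phi>_hom p = (\<Sum>a\<in>keys p. mscale (lookup p a) (\<Phi>_hom (single a 1)))"
proof -
  have "\<Phi>_hom p = \<Phi>_hom (\<Sum>a\<in>keys p. single a (lookup p a))"
    by (simp only: poly_mapping_sum_singles[symmetric])
  also have "\<dots> = (\<Sum>a\<in>keys p. \<Phi>_hom (single a (lookup p a)))" by (rule ring_hom_sum[OF ring_hom_\<Phi>])
  also have "\<dots> = (\<Sum>a\<in>keys p. mscale (lookup p a) (\<Phi>_hom (single a 1)))"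
    unfolding \<Phi>_single by (intro sum.cong refl mser_eqI) simp
  finally show ?thesis .
qed

lemma tensor_map_y_tensor: "tensor_map \<Phi>_hom (y_tensor p q) = sym_tensor (\<Phi>_hom p) (\<Phi>_hom q)"
proof (rule mser_eqI)
  fix m
  have "mcoeff (tensor_map \<Phi>_hom (y_tensor p q)) m =
     (\<Sum>a\<in>keys p. \<Sum>b\<in>keys q. lookup p a * mcoeff (\<Phi>_hom (single a 1)) (map_key Inl m) *
        (lookup q b * mcoeff (\<Phi>_hom (single b 1)) (map_key Inr m)))"
    unfolding y_tensor_def tensor_map_sum tensor_map_single mcoeff_sum
    by (simp add: mcoeff_sym_tensor mult_ac)
  also have "\<dots> = mcoeff (sym_tensor (\<Phi>_hom p) (\<Phi>_hom q)) m"
    unfolding mcoeff_sym_tensor \<Phi>_expand[of p] \<Phi>_expand[of q] mcoeff_sum mcoeff_mscale sum_product ..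
  finally show "mcoeff (tensor_map \<Phi>_hom (y_tensor p q)) m = mcoeff (sym_tensor (\<Phi>_hom p) (\<Phi>_hom q)) m" .
qed

lemma y_comult_generator:
  "2 \<le> n \<Longrightarrow> y_comult (Y n) = (\<Sum>\<pi>\<in>NC n. y_tensor (Y_part \<pi>) (Y_part (kreweras n \<pi>)))"
  unfolding y_comult_def by (simp add: y_eval_Y[OF ring_hom_single])

text \<open>
  On generators, the left-hand side is a sum over \<open>\<pi>\<close> and \<open>K(\<pi>)\<close> of moments in the two alphabets, and the
  right-hand side is the moment for the convolved cumulants \<open>\<Sum> e\<^sub>i \<otimes> e\<^bsub>n-i\<^esub>\<close>.
\<close>

lemma \<Phi>_comult: "tensor_map \<Phi>_hom (y_comult p) = sym_comult (\<Phi>_hom p)"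
proof -
  note hom_sym = ring_hom_relabel[OF bij_sum_decode, folded sym_comult_eq_relabel]
  have hom_y: "ring_hom y_comult"
    unfolding y_comult_def by (rule ring_hom_y_eval[OF ring_hom_single])
  show ?thesis
  proof (rule ring_hom_y_ext[OF ring_hom_comp[OF ring_hom_tensor_map hom_y] ring_hom_comp[OF hom_sym ring_hom_\<Phi>]])
    fix c
    have "y_comult (single 0 c) = single (0, 0) c"
      unfolding y_comult_def y_eval_single[OF ring_hom_single] by (simp add: zero_prod_def)
    then have "tensor_map \<Phi>_hom (y_comult (single 0 c)) = mscale c 1"
      using ring_homD(1)[OF ring_hom_\<Phi>] by (simp add: tensor_map_single sym_tensor_1)
    moreover have "sym_comult (\<Phi>_hom (single 0 c)) = mscale c 1"
      using ring_homD(1)[OF hom_sym] by (simp add: \<Phi>_single sym_comult_eq_relabel relabel_mscale)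
    ultimately show "tensor_map \<Phi>_hom (y_comult (single 0 c)) = sym_comult (\<Phi>_hom (single 0 c))" by simp
  next
    fix n :: nat assume n: "2 \<le> n"
    have part: "\<Phi>_hom (Y_part \<pi>) = (\<Prod>A\<in>\<pi>. y_sym (card A))" for \<pi>
      by (simp add: Y_part_def ring_hom_prod[OF ring_hom_\<Phi>] \<Phi>_Y)
    let ?e = "\<lambda>k. left_alphabet (esym k)" and ?g = "\<lambda>k. right_alphabet (esym k)"
    have "tensor_map \<Phi>_hom (y_comult (Y n)) =
        (\<Sum>\<pi>\<in>NC n. (\<Prod>A\<in>\<pi>. moment ?e (card A)) * (\<Prod>B\<in>kreweras n \<pi>. moment ?g (card B)))"
      unfolding y_comult_generator[OF n] tensor_map_sum tensor_map_y_tensor part sym_tensor_eq_mult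
      by (simp only: ring_hom_prod[OF ring_hom_left_alphabet] ring_hom_prod[OF ring_hom_right_alphabet]
          y_sym_eq_moment ring_hom_moment[OF ring_hom_left_alphabet] ring_hom_moment[OF ring_hom_right_alphabet])
    also have "\<dots> = moment (\<lambda>k. \<Sum>i\<le>k. ?e i * ?g (k - i)) n"
      by (rule moment_multiplicative_convolution)
        (use n in \<open>simp_all add: ring_homD(1)[OF ring_hom_left_alphabet] ring_homD(1)[OF ring_hom_right_alphabet]\<close>)
    also have "\<dots> = sym_comult (\<Phi>_hom (Y n))"
      by (simp only: sym_comult_esym[symmetric] \<Phi>_Y y_sym_eq_moment ring_hom_moment[OF hom_sym])
    finally show "tensor_map \<Phi>_hom (y_comult (Y n)) = sym_comult (\<Phi>_hom (Y n))" .
  qed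
qed

lemma ring_hom_sym_counit: "ring_hom sym_counit"
proof -
  have "mcoeff (f * g) 0 = mcoeff f 0 * mcoeff g 0" for f g :: "nat mser"
  proof -
    have zero: "a = 0 \<and> b = 0" if "a + b = 0" for a b :: "nat \<Rightarrow>\<^sub>0 nat"
    proof -
      have "lookup a i + lookup b i = 0" for i using that by (metis lookup_add lookup_zero)
      then show ?thesis by (auto intro!: poly_mapping_eqI)
    qed
    have "{(a, b). a + b = (0 :: nat \<Rightarrow>\<^sub>0 nat)} = {(0, 0)}"
    proof
      show "{(a, b). a + b = (0 :: nat \<Rightarrow>\<^sub>0 nat)} \<subseteq> {(0, 0)}"
      proof
        fix x :: "(nat \<Rightarrow>\<^sub>0 nat) \<times> (nat \<Rightarrow>\<^sub>0 nat)"
        assume "x \<in> {(a, b). a + b = 0}"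
        then have "fst x + snd x = 0" by (simp add: case_prod_unfold)
        then show "x \<in> {(0, 0)}" using zero[of "fst x" "snd x"] by (simp add: prod_eq_iff)
      qed
    qed simp
    then show ?thesis by (simp add: mcoeff_mult)
  qed
  then show ?thesis by (simp add: ring_hom_def sym_counit_def mcoeff_1)
qed

lemma \<Phi>_counit: "sym_counit (\<Phi>_hom p) = y_counit p"
proof -
  have id: "ring_hom (\<lambda>c::complex. c)" by (simp add: ring_hom_def)
  have hom: "ring_hom y_counit" unfolding y_counit_def by (rule ring_hom_y_eval[OF id])
  show ?thesis
  proof (rule ring_hom_y_ext[OF ring_hom_comp[OF ring_hom_sym_counit ring_hom_\<Phi>] hom])
    fix c show "sym_counit (\<Phi>_hom (single 0 c)) = y_counit (single 0 c)"
      by (simp add: \<Phi>_single sym_counit_def mcoeff_1 y_counit_def y_eval_single[OF id])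
  next
    fix n :: nat assume n: "2 \<le> n"
    have "mcoeff (y_sym n) 0 = 0"
      using homogeneousD[OF homogeneous_y_sym[of n], of 0] n by (fastforce simp: mdeg_def)
    then show "sym_counit (\<Phi>_hom (Y n)) = y_counit (Y n)"
      using n by (simp add: \<Phi>_Y sym_counit_def y_counit_def y_eval_Y[OF id])
  qed
qed

lemma unital_algebra_hom_\<Phi>: "unital_algebra_hom \<Phi>_hom"
proof -
  have "\<Phi>_hom (y_scale c p) = mscale c (\<Phi>_hom p)" for c p
    by (simp add: y_scale_def ring_homD[OF ring_hom_\<Phi>] \<Phi>_single mscale_eq_mult[symmetric])
  then show ?thesis
    by (simp add: unital_algebra_hom_def \<Phi>_Sym ring_homD[OF ring_hom_\<Phi>])
qed

lemma \<Phi>_unique: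
  assumes \<Psi>: "unital_algebra_hom \<Psi>" and gen: "\<forall>n\<ge>2. \<Psi> (Y n) = y_sym n"
  shows "\<Psi> = \<Phi>_hom"
proof
  fix p
  have hom: "ring_hom \<Psi>" using \<Psi> by (simp add: ring_hom_def unital_algebra_hom_def)
  show "\<Psi> p = \<Phi>_hom p"
  proof (rule ring_hom_y_ext[OF hom ring_hom_\<Phi>])
    fix c
    have "\<Psi> (single 0 c) = \<Psi> (y_scale c 1)" by (simp add: y_scale_def)
    also have "\<dots> = mscale c 1" using \<Psi> by (simp add: unital_algebra_hom_def)
    finally show "\<Psi> (single 0 c) = \<Phi>_hom (single 0 c)" by (simp add: \<Phi>_single)
  qed (use gen \<Phi>_Y in simp)
qed

theorem theorem7p5:
  "(\<exists>!\<Phi>. unital_algebra_hom \<Phi> \<and> (\<forall>n\<ge>2. \<Phi> (Y n) = y_sym n)) \<and>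
   (\<forall>\<Phi>. unital_algebra_hom \<Phi> \<and> (\<forall>n\<ge>2. \<Phi> (Y n) = y_sym n) \<longrightarrow> graded_hopf_iso \<Phi>)"
proof -
  have "unital_algebra_hom \<Phi>_hom \<and> (\<forall>n\<ge>2. \<Phi>_hom (Y n) = y_sym n)"
    by (simp add: unital_algebra_hom_\<Phi> \<Phi>_Y)
  moreover have "graded_hopf_iso \<Phi>_hom"
    unfolding graded_hopf_iso_def
    using unital_algebra_hom_\<Phi> bij_betw_\<Phi> \<Phi>_comult \<Phi>_counit \<Phi>_grade by blast
  ultimately show ?thesis using \<Phi>_unique by blast
qed

end
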